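(* Let $\pi\colon(T,X)\to(T,Y)$ be an extension of minimal compact dynamics which is not PI. Then $(T,\mathtt M_\infty)$ is an M-dynamic contained in $\mathtt R_\pi$, with $\Delta_X\subsetneq\mathtt M_\infty$ and $\mathtt{RP}_{\pi|\mathtt M_\infty}=\mathtt M_\infty$.
   Context: $T$ is a group or monoid acting continuously, regarded as discrete. An extension is a continuous equivariant surjection. $\mathtt R_\pi=\{(x_1,x_2):\pi x_1=\pi x_2\}$ with diagonal action; $\Delta_X$ is the diagonal. A point is a.p. if its return times to each neighborhood form a syndetic set (there is a finite $K$ with $Kt\cap A\ne\emptyset$ for all $t$). A dynamic is T.T. if $\{t: V\cap tU\ne\emptyset\}\neq\emptyset$ for all nonempty open $U,V$; it is an M-dynamic if T.T. with a dense set of a.p. points. For $L\subseteq\mathtt R_\pi$, $\mathtt{RP}_{\pi|L}$ is the set of $\tilde x\in L$ for which there are nets $\tilde x_j\in L$, $t_j\in T$ and $\tilde x'\in\Delta_X$ with $\tilde x_j\to\tilde x$, $t_j\tilde x_j\to\tilde x'$. Extension $\pi$ is proximal if $\overline{Tz}\cap\Delta_X\ne\emptyset$ for all $z\in\mathtt R_\pi$; it is a.p. if there is no $(x,x')\in\mathtt R_\pi\setminus\Delta_X$ such that $\overline{T((U\times V)\cap\mathtt R_\pi)}\cap\Delta_X\ne\emptyset$ for all neighborhoods $U$ of $x$, $V$ of $x'$. $\pi$ is PI if there are a minimal compact dynamic $X'$ and a proximal extension $\rho\colon X'\to X$ such that $\pi'=\pi\circ\rho$ admits a PI-tower: an ordinal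 $\vartheta$, minimal compact dynamics $Y_\gamma$ ($\gamma\le\vartheta$) with $Y_0=Y$, extensions $\pi'_\gamma\colon X'\to Y_\gamma$ ($\pi'_0=\pi'$) and $\psi_\gamma^{\gamma+1}\colon Y_{\gamma+1}\to Y_\gamma$ compatible with the $\pi'_\gamma$, each $\psi_\gamma^{\gamma+1}$ proximal or a.p., $Y_\gamma=\varprojlim_{\lambda<\gamma}Y_\lambda$ for limit $\gamma$, and $\pi'_\vartheta$ an isomorphism. Ellis machinery: let $\mathbb I$ be a minimal left ideal of $\beta T$, $(T,\mathbb I)$ the universal minimal dynamic, $\mathrm{Aut}(\mathbb I)$ its automorphism group, and $\Gamma[\alpha]=\{(m,\alpha m):m\in\mathbb I\}$. The $\tau$-topology: $\alpha_i\to_\tau\alpha$ iff for every $m\in\mathbb I$ there is a net $m_i\to m$ with $\alpha_im_i\to\alpha m$. For a $\tau$-closed subgroup $\mathbb F$, its derived group is $\mathbb F'=\{\alpha\in\mathbb F:\exists\delta_i\in\mathbb F,\ \delta_i\to_\tau\alpha,\ \delta_i\to_\tau\mathrm{id}_{\mathbb I}\}$. Fix an extension $\pi_X\colon\mathbb I\to X$ and put $\pi_Y=\pi\circ\pi_X$, $\mathbb F=\{\alpha:\pi_Y\circ\alpha=\pi_Y\}$. Set $\mathbb F_0=\mathbb F$, $\mathbb F_{o+1}=\mathbb F_o'$, $\mathbb F_o=\bigcap_{\gamma<o}\mathbb F_\gamma$ for limit $o$; $\mathbb F_\infty$ is the stable value of this transfinite sequence. Finally $\mathtt M_\infty=(\pi_X\times\pi_X)\big(\overline{\bigcup_{\alpha\in\mathbb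 F_\infty}\Gamma[\alpha]}\big)$. *)

theory Defs
  imports "HOL-Analysis.Analysis"
begin

definition dynamic :: "'a topology \<Rightarrow> ('t::monoid_mult \<Rightarrow> 'a \<Rightarrow> 'a) \<Rightarrow> bool" where
  "dynamic X act \<longleftrightarrow>
     (\<forall>t. continuous_map X X (act t)) \<and>
     (\<forall>x\<in>topspace X. act 1 x = x) \<and>
     (\<forall>s t. \<forall>x\<in>topspace X. act (s * t) x = act s (act t x))"

text \<open>compact = compact Hausdorff (Ellis' convention)\<close>
definition compact_dynamic :: "'a topology \<Rightarrow> ('t::monoid_mult \<Rightarrow> 'a \<Rightarrow> 'a) \<Rightarrow> bool" where
  "compact_dynamic X act \<longleftrightarrow> dynamic X act \<and> compact_space X \<and> Hausdorff_space X"

definition invariant_set :: "('t \<Rightarrow> 'a \<Rightarrow> 'a) \<Rightarrow> 'a set \<Rightarrow> bool" where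
  "invariant_set act A \<longleftrightarrow> (\<forall>t. act t ` A \<subseteq> A)"

definition minimal_compact_dynamic :: "'a topology \<Rightarrow> ('t::monoid_mult \<Rightarrow> 'a \<Rightarrow> 'a) \<Rightarrow> bool" where
  "minimal_compact_dynamic X act \<longleftrightarrow> compact_dynamic X act \<and> topspace X \<noteq> {} \<and>
     (\<forall>A. closedin X A \<and> invariant_set act A \<longrightarrow> A = {} \<or> A = topspace X)"

definition extension :: "'a topology \<Rightarrow> ('t \<Rightarrow> 'a \<Rightarrow> 'a) \<Rightarrow> 'b topology \<Rightarrow> ('t \<Rightarrow> 'b \<Rightarrow> 'b)
     \<Rightarrow> ('a \<Rightarrow> 'b) \<Rightarrow> bool" where
  "extension X actX Y actY f \<longleftrightarrow> continuous_map X Y f \<and> f ` topspace X = topspace Y \<and>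
     (\<forall>t. \<forall>x\<in>topspace X. f (actX t x) = actY t (f x))"

definition iso_dynamic :: "'a topology \<Rightarrow> ('t \<Rightarrow> 'a \<Rightarrow> 'a) \<Rightarrow> 'b topology \<Rightarrow> ('t \<Rightarrow> 'b \<Rightarrow> 'b)
     \<Rightarrow> ('a \<Rightarrow> 'b) \<Rightarrow> bool" where
  "iso_dynamic X actX Y actY f \<longleftrightarrow> homeomorphic_map X Y f \<and>
     (\<forall>t. \<forall>x\<in>topspace X. f (actX t x) = actY t (f x))"

definition diag_act :: "('t \<Rightarrow> 'a \<Rightarrow> 'a) \<Rightarrow> 't \<Rightarrow> 'a \<times> 'a \<Rightarrow> 'a \<times> 'a" where
  "diag_act act t z = (act t (fst z), act t (snd z))"

definition Rel :: "'a topology \<Rightarrow> ('a \<Rightarrow> 'b) \<Rightarrow> ('a \<times> 'a) set" where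
  "Rel X f = {(x1, x2). x1 \<in> topspace X \<and> x2 \<in> topspace X \<and> f x1 = f x2}"

definition Delta :: "'a topology \<Rightarrow> ('a \<times> 'a) set" where
  "Delta X = {(x, x) | x. x \<in> topspace X}"

definition syndetic :: "'t::monoid_mult set \<Rightarrow> bool" where
  "syndetic A \<longleftrightarrow> (\<exists>K. finite K \<and> (\<forall>t. (\<lambda>k. k * t) ` K \<inter> A \<noteq> {}))"

definition ap_point :: "'a topology \<Rightarrow> ('t::monoid_mult \<Rightarrow> 'a \<Rightarrow> 'a) \<Rightarrow> 'a \<Rightarrow> bool" where
  "ap_point X act x \<longleftrightarrow> x \<in> topspace X \<and>
     (\<forall>U. openin X U \<and> x \<in> U \<longrightarrow> syndetic {t. act t x \<in> U})"

definition TT :: "'a topology \<Rightarrow> ('t \<Rightarrow> 'a \<Rightarrow> 'a) \<Rightarrow> bool" where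
  "TT X act \<longleftrightarrow> (\<forall>U V. openin X U \<and> U \<noteq> {} \<and> openin X V \<and> V \<noteq> {} \<longrightarrow>
                     {t. V \<inter> act t ` U \<noteq> {}} \<noteq> {})"

definition M_dynamic :: "'a topology \<Rightarrow> ('t::monoid_mult \<Rightarrow> 'a \<Rightarrow> 'a) \<Rightarrow> bool" where
  "M_dynamic X act \<longleftrightarrow> dynamic X act \<and> TT X act \<and>
     X closure_of {x. ap_point X act x} = topspace X"

text \<open>\<open>RP_{\<pi>|L}\<close>; nets are rendered as proper filters on the index type \<open>T \<times> (X \<times> X)\<close>
  (a net \<open>j \<mapsto> (t_j, x_j)\<close> and its section filter).\<close>
definition RP :: "'a topology \<Rightarrow> ('t \<Rightarrow> 'a \<Rightarrow> 'a) \<Rightarrow> ('a \<times> 'a) set \<Rightarrow> ('a \<times> 'a) set" where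
  "RP X act L = {z \<in> L. \<exists>(F :: ('t \<times> ('a \<times> 'a)) filter) x'. F \<noteq> bot \<and> x' \<in> Delta X \<and>
       eventually (\<lambda>j. snd j \<in> L) F \<and>
       limitin (prod_topology X X) snd z F \<and>
       limitin (prod_topology X X) (\<lambda>j. diag_act act (fst j) (snd j)) x' F}"

definition proximal_ext :: "'a topology \<Rightarrow> ('t \<Rightarrow> 'a \<Rightarrow> 'a) \<Rightarrow> ('a \<Rightarrow> 'b) \<Rightarrow> bool" where
  "proximal_ext X act f \<longleftrightarrow>
     (\<forall>z \<in> Rel X f. (prod_topology X X) closure_of (range (\<lambda>t. diag_act act t z)) \<inter> Delta X \<noteq> {})"

definition ap_ext :: "'a topology \<Rightarrow> ('t \<Rightarrow> 'a \<Rightarrow> 'a) \<Rightarrow> ('a \<Rightarrow> 'b) \<Rightarrow> bool" where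
  "ap_ext X act f \<longleftrightarrow> \<not> (\<exists>x x'. (x, x') \<in> Rel X f - Delta X \<and>
     (\<forall>U V. openin X U \<and> x \<in> U \<and> openin X V \<and> x' \<in> V \<longrightarrow>
        (prod_topology X X) closure_of (\<Union>t. diag_act act t ` ((U \<times> V) \<inter> Rel X f)) \<inter> Delta X \<noteq> {}))"

text \<open>Ordinals \<open>\<le> \<vartheta>\<close> are rendered as a well-order \<open>r\<close> on an index set \<open>Field r\<close> with a
  greatest element \<open>\<vartheta>\<close> and least element \<open>0\<close>.\<close>
definition wo_less :: "('o \<times> 'o) set \<Rightarrow> 'o \<Rightarrow> 'o \<Rightarrow> bool" where
  "wo_less r a b \<longleftrightarrow> (a, b) \<in> r \<and> a \<noteq> b"

definition wo_succ :: "('o \<times> 'o) set \<Rightarrow> 'o \<Rightarrow> 'o \<Rightarrow> bool" where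
  "wo_succ r a b \<longleftrightarrow> wo_less r a b \<and> \<not> (\<exists>c. wo_less r a c \<and> wo_less r c b)"

definition wo_limit :: "('o \<times> 'o) set \<Rightarrow> 'o \<Rightarrow> 'o \<Rightarrow> bool" where
  \<comment> \<open>\<open>g\<close> is a limit ordinal (non-zero, not a successor); \<open>z\<close> is the least element\<close>
  "wo_limit r z g \<longleftrightarrow> g \<in> Field r \<and> g \<noteq> z \<and> \<not> (\<exists>a. wo_succ r a g)"

definition inv_limit_cond :: "('o \<times> 'o) set \<Rightarrow> ('o \<Rightarrow> 'p topology) \<Rightarrow> ('o \<Rightarrow> 'o \<Rightarrow> 'p \<Rightarrow> 'p)
     \<Rightarrow> 'o \<Rightarrow> bool" where
  "inv_limit_cond r Ys psi g \<longleftrightarrow>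
     (let L = {l. wo_less r l g};
          threads = {f \<in> topspace (product_topology Ys L).
                       \<forall>l\<in>L. \<forall>m\<in>L. (l, m) \<in> r \<longrightarrow> psi l m (f m) = f l}
      in homeomorphic_map (Ys g) (subtopology (product_topology Ys L) threads)
           (\<lambda>y. restrict (\<lambda>l. psi l g y) L))"

text \<open>PI tower for \<open>\<pi>' : X' \<rightarrow> Y\<close>. The spaces \<open>Y_\<gamma>\<close> are carried by the (large) type \<open>'p\<close>;
  \<open>psi l m : Y_m \<rightarrow> Y_l\<close> for \<open>l \<le> m\<close> are the bonding maps (those with \<open>m = l + 1\<close>
  are the maps \<open>\<psi>_l^{l+1}\<close>), \<open>pis g = \<pi>'_g\<close>.\<close>
definition PI_tower :: "'p topology \<Rightarrow> ('t::monoid_mult \<Rightarrow> 'p \<Rightarrow> 'p) \<Rightarrow> 'y topology \<Rightarrow> ('t \<Rightarrow> 'y \<Rightarrow> 'y)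
     \<Rightarrow> ('p \<Rightarrow> 'y) \<Rightarrow> bool" where
  "PI_tower Xp actp Y actY f \<longleftrightarrow>
    (\<exists>(r :: ('p set \<times> 'p set) set) z th (Ys :: 'p set \<Rightarrow> 'p topology) acts pis psi.
       Well_order r \<and> z \<in> Field r \<and> th \<in> Field r \<and>
       (\<forall>a\<in>Field r. (z, a) \<in> r \<and> (a, th) \<in> r) \<and>
       (\<forall>g\<in>Field r. minimal_compact_dynamic (Ys g) (acts g) \<and>
                    extension Xp actp (Ys g) (acts g) (pis g)) \<and>
       (\<exists>h. iso_dynamic (Ys z) (acts z) Y actY h \<and> (\<forall>x\<in>topspace Xp. h (pis z x) = f x)) \<and>
       (\<forall>l\<in>Field r. \<forall>m\<in>Field r. (l, m) \<in> r \<longrightarrow>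
           extension (Ys m) (acts m) (Ys l) (acts l) (psi l m) \<and>
           (\<forall>x\<in>topspace Xp. psi l m (pis m x) = pis l x)) \<and>
       (\<forall>a b. wo_succ r a b \<longrightarrow>
           proximal_ext (Ys b) (acts b) (psi a b) \<or> ap_ext (Ys b) (acts b) (psi a b)) \<and>
       (\<forall>g. wo_limit r z g \<longrightarrow> inv_limit_cond r Ys psi g) \<and>
       iso_dynamic Xp actp (Ys th) (acts th) (pis th))"

text \<open>PI extension. The auxiliary minimal dynamic \<open>X'\<close> is carried by the type \<open>'t set set\<close>
  (the type carrying \<open>\<beta>T\<close>), which is large enough: every minimal dynamic is a factor of the
  universal minimal dynamic \<open>\<subseteq> \<beta>T\<close>.\<close>
definition is_PI :: "'x topology \<Rightarrow> ('t::monoid_mult \<Rightarrow> 'x \<Rightarrow> 'x) \<Rightarrow> 'y topology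
     \<Rightarrow> ('t \<Rightarrow> 'y \<Rightarrow> 'y) \<Rightarrow> ('x \<Rightarrow> 'y) \<Rightarrow> bool" where
  "is_PI X actX Y actY f \<longleftrightarrow>
    (\<exists>(Xp :: 't set set topology) actp rho.
       minimal_compact_dynamic Xp actp \<and> extension Xp actp X actX rho \<and>
       proximal_ext Xp actp rho \<and> PI_tower Xp actp Y actY (f \<circ> rho))"

definition is_ultrafilter :: "'t set set \<Rightarrow> bool" where
  "is_ultrafilter U \<longleftrightarrow> UNIV \<in> U \<and> {} \<notin> U \<and>
     (\<forall>A B. A \<in> U \<and> A \<subseteq> B \<longrightarrow> B \<in> U) \<and>
     (\<forall>A B. A \<in> U \<and> B \<in> U \<longrightarrow> A \<inter> B \<in> U) \<and>
     (\<forall>A. A \<in> U \<or> - A \<in> U)"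

definition betaT :: "'t set set set" where
  "betaT = {U. is_ultrafilter U}"

definition beta_top :: "'t set set topology" where
  "beta_top = topology_generated_by {{U \<in> betaT. A \<in> U} | A. True}"

definition bact :: "'t::monoid_mult \<Rightarrow> 't set set \<Rightarrow> 't set set" where
  "bact t U = {A. {s. t * s \<in> A} \<in> U}"

definition bmult :: "'t::monoid_mult set set \<Rightarrow> 't set set \<Rightarrow> 't set set" where
  "bmult p q = {A. {t. {s. t * s \<in> A} \<in> q} \<in> p}"

definition left_ideal :: "'t::monoid_mult set set set \<Rightarrow> bool" where
  "left_ideal L \<longleftrightarrow> L \<noteq> {} \<and> L \<subseteq> betaT \<and> (\<forall>p\<in>betaT. \<forall>q\<in>L. bmult p q \<in> L)"

definition minimal_left_ideal :: "'t::monoid_mult set set set \<Rightarrow> bool" where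
  "minimal_left_ideal L \<longleftrightarrow> left_ideal L \<and> (\<forall>L'. left_ideal L' \<and> L' \<subseteq> L \<longrightarrow> L' = L)"

definition Itop :: "'t set set set \<Rightarrow> 't set set topology" where
  "Itop II = subtopology beta_top II"

definition Aut :: "'t::monoid_mult set set set \<Rightarrow> ('t set set \<Rightarrow> 't set set) set" where
  "Aut II = {a. homeomorphic_map (Itop II) (Itop II) a \<and>
                (\<forall>t. \<forall>m\<in>II. a (bact t m) = bact t (a m))}"

definition Gamma :: "'t set set set \<Rightarrow> ('t set set \<Rightarrow> 't set set) \<Rightarrow> ('t set set \<times> 't set set) set" where
  "Gamma II a = {(m, a m) | m. m \<in> II}"

text \<open>\<open>\<tau>\<close>-convergence of a net of automorphisms (net = proper filter \<open>F\<close> on an index type)\<close>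
definition tau_conv :: "'t set set set \<Rightarrow> 'i filter \<Rightarrow> ('i \<Rightarrow> 't set set \<Rightarrow> 't set set)
     \<Rightarrow> ('t set set \<Rightarrow> 't set set) \<Rightarrow> bool" where
  "tau_conv II F d a \<longleftrightarrow> (\<forall>m\<in>II. \<exists>g. limitin (Itop II) g m F \<and>
                                       limitin (Itop II) (\<lambda>i. d i (g i)) (a m) F)"

text \<open>derived group; nets of automorphisms are indexed by proper filters on the fixed index type
  \<open>Aut \<times> (\<II> \<Rightarrow> \<II>) \<times> (\<II> \<Rightarrow> \<II>)\<close>, which is w.l.o.g. (push forward the section filter of
  any net along \<open>j \<mapsto> (\<delta>_j, m \<mapsto> m_j, m \<mapsto> m'_j)\<close>).\<close>
definition derived :: "'t set set set \<Rightarrow> ('t set set \<Rightarrow> 't set set) set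
     \<Rightarrow> ('t set set \<Rightarrow> 't set set) set" where
  "derived II G = {a \<in> G. \<exists>F :: (('t set set \<Rightarrow> 't set set) \<times> ('t set set \<Rightarrow> 't set set)
                                  \<times> ('t set set \<Rightarrow> 't set set)) filter.
       F \<noteq> bot \<and> eventually (\<lambda>i. fst i \<in> G) F \<and> tau_conv II F fst a \<and> tau_conv II F fst id}"

definition Fgrp :: "'t::monoid_mult set set set \<Rightarrow> ('t set set \<Rightarrow> 'y) \<Rightarrow> ('t set set \<Rightarrow> 't set set) set" where
  "Fgrp II piY = {a \<in> Aut II. \<forall>m\<in>II. piY (a m) = piY m}"

text \<open>the transfinite derived sequence \<open>\<FF>_o\<close>, as the smallest family containing \<open>\<FF>\<close> and closed
  under derivation and under intersections (limit stages)\<close>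
inductive_set Fseq :: "'t set set set \<Rightarrow> ('t set set \<Rightarrow> 't set set) set
     \<Rightarrow> ('t set set \<Rightarrow> 't set set) set set" for II G where
  base: "G \<in> Fseq II G"
| deriv: "H \<in> Fseq II G \<Longrightarrow> derived II H \<in> Fseq II G"
| inter: "(\<And>H. H \<in> C \<Longrightarrow> H \<in> Fseq II G) \<Longrightarrow> C \<noteq> {} \<Longrightarrow> \<Inter> C \<in> Fseq II G"

definition Finf :: "'t set set set \<Rightarrow> ('t set set \<Rightarrow> 't set set) set \<Rightarrow> ('t set set \<Rightarrow> 't set set) set" where
  "Finf II G = \<Inter> (Fseq II G)"

definition Minf :: "'x topology \<Rightarrow> ('x \<Rightarrow> 'y) \<Rightarrow> 't::monoid_mult set set set \<Rightarrow> ('t set set \<Rightarrow> 'x)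
     \<Rightarrow> ('x \<times> 'x) set" where
  "Minf X f II piX = (\<lambda>(m1, m2). (piX m1, piX m2)) `
      ((prod_topology (Itop II) (Itop II)) closure_of
         (\<Union>a \<in> Finf II (Fgrp II (f \<circ> piX)). Gamma II a))"

end

theory Submission
  imports Defs
begin

text \<open>Automorphisms of the universal minimal system \<open>I\<close> are right multiplications by elements of the
  group \<open>G = uI\<close>, \<open>u\<close> an idempotent of \<open>I\<close>. A point \<open>\<alpha>\<close> of a group \<open>K\<close> lies in \<open>K'\<close> iff it cannot be
  separated from the identity by \<open>\<tau>\<close>-open subsets of \<open>K\<close>, and inseparability is a translation invariant
  equivalence relation. As \<open>\<FF>\<^sub>\<infinity>\<close> equals its derived group, one element of \<open>\<FF>\<^sub>\<infinity>\<close> has a graph that meets any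
  two given open sets meeting \<open>\<Gamma>[\<alpha>]\<close> and \<open>\<Gamma>[\<beta>]\<close>; this graph is minimal, so \<open>M\<^sub>\<infinity>\<close> is topologically
  transitive, and \<open>RP = M\<^sub>\<infinity>\<close> follows because \<open>M\<^sub>\<infinity>\<close> contains the diagonal.

  If \<open>M\<^sub>\<infinity>\<close> were the diagonal, \<open>\<FF>\<^sub>\<infinity>\<close> would lie in the group \<open>A\<close> of \<open>X\<close>. For a \<open>\<tau>\<close>-closed group \<open>K\<close>
  the closure \<open>N K\<close> of the graphs of its elements is a closed equivalence relation with group \<open>K\<close>.
  Extensions with equal groups are proximal, and \<open>I / N K\<close> has an almost periodic extension with
  group \<open>A K'\<close>. Alternating the two yields a PI tower below the proximal extension \<open>I / N A\<close> of \<open>X\<close>. It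
  stops at a group \<open>K = A K'\<close>, and a \<open>\<tau>\<close>-closed \<open>L\<close> minimal with \<open>L A = K\<close> then satisfies \<open>L' = L\<close>,
  whence \<open>L \<subseteq> \<FF>\<^sub>\<infinity> \<subseteq> A\<close>, \<open>K = A\<close>, and the tower reaches \<open>I / N A\<close>.\<close>

section \<open>The Stone-Cech compactification of the acting monoid\<close>

text \<open>The \<tau>-topology need not be Hausdorff, so no topology is put on the group. Limits
  are taken in closed relations on the compact space \<open>I\<close> and brought back to the group
  by \<open>prt\<close>, which reads off the group element attached to a pair of points. The
  obstacle at the end of the tower is that \<open>K = A K'\<close> does not by itself give
  \<open>K = A\<close>, nor any control over the further derived groups of \<open>K\<close>. Descent
  is possible because \<open>K \<subseteq> L A\<close> implies \<open>K' \<subseteq> L' A\<close>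
  when \<open>A\<close> normalises \<open>L\<close>; compactness of \<open>I\<close> handles
  intersections of chains of such \<open>L\<close>. The formal notion of a PI tower fixes the
  carrier of its stages and the type of its indices. Quotients of \<open>I\<close> are therefore
  realised on representatives inside \<open>I\<close>, and ordinals are replaced by the set of all
  relations reached by the iteration, ordered by reverse inclusion and coded injectively.\<close>

lemma betaT_UNIV: "p \<in> betaT \<Longrightarrow> UNIV \<in> p"
  by (simp add: betaT_def is_ultrafilter_def)

lemma betaT_empty: "p \<in> betaT \<Longrightarrow> {} \<notin> p"
  by (simp add: betaT_def is_ultrafilter_def)

lemma betaT_mono: "p \<in> betaT \<Longrightarrow> A \<in> p \<Longrightarrow> A \<subseteq> B \<Longrightarrow> B \<in> p"
  unfolding betaT_def is_ultrafilter_def by blast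

lemma betaT_Int: "p \<in> betaT \<Longrightarrow> A \<inter> B \<in> p \<longleftrightarrow> A \<in> p \<and> B \<in> p"
  unfolding betaT_def is_ultrafilter_def mem_Collect_eq by (meson Int_lower1 Int_lower2)

lemma betaT_Compl: "p \<in> betaT \<Longrightarrow> - A \<in> p \<longleftrightarrow> A \<notin> p"
  unfolding betaT_def is_ultrafilter_def by (metis (no_types, lifting) Compl_disjoint mem_Collect_eq)

lemma betaT_nonempty_mem: "p \<in> betaT \<Longrightarrow> A \<in> p \<Longrightarrow> \<exists>t. t \<in> A"
  using betaT_empty by (metis all_not_in_conv)

lemma betaT_eqI: "p \<in> betaT \<Longrightarrow> q \<in> betaT \<Longrightarrow> (\<And>A. A \<in> p \<Longrightarrow> A \<in> q) \<Longrightarrow> p = q"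
  using betaT_Compl by blast

lemma betaT_I:
  assumes "UNIV \<in> p" "{} \<notin> p" "\<And>A B. A \<in> p \<Longrightarrow> A \<subseteq> B \<Longrightarrow> B \<in> p"
    "\<And>A B. A \<in> p \<Longrightarrow> B \<in> p \<Longrightarrow> A \<inter> B \<in> p" "\<And>A. A \<in> p \<or> - A \<in> p"
  shows "p \<in> betaT"
  unfolding betaT_def is_ultrafilter_def using assms by blast

text \<open>Zorn's lemma on families with the finite intersection property: a maximal one contains
  every set that meets all of its finite intersections (\<open>memI\<close>), and the closure and
  complement axioms follow from this.\<close>

lemma ultrafilter_extends:
  fixes C :: "'t set set"
  assumes fip: "\<And>F. finite F \<Longrightarrow> F \<subseteq> C \<Longrightarrow> \<Inter>F \<noteq> {}"
  obtains p where "p \<in> betaT" "C \<subseteq> p"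
proof -
  define S where "S = {D. C \<subseteq> D \<and> (\<forall>F. finite F \<longrightarrow> F \<subseteq> D \<longrightarrow> \<Inter>F \<noteq> {})}"
  have "\<exists>M\<in>S. \<forall>X\<in>S. M \<subseteq> X \<longrightarrow> X = M"
  proof (rule subset_Zorn_nonempty)
    show "S \<noteq> {}" using fip by (auto simp: S_def)
    fix \<C> assume c: "\<C> \<noteq> {}" "subset.chain S \<C>"
    then have cs: "\<C> \<subseteq> S" by (simp add: subset.chain_def)
    have "\<Inter>F \<noteq> {}" if F: "finite F" "F \<subseteq> \<Union>\<C>" for F
    proof -
      obtain B where "B \<in> \<C>" "F \<subseteq> B"
        using finite_subset_Union_chain[OF F c] by metis
      then show ?thesis using cs F(1) by (auto simp: S_def)
    qed
    moreover have "C \<subseteq> \<Union>\<C>" using c(1) cs by (auto simp: S_def)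
    ultimately show "\<Union>\<C> \<in> S" by (simp add: S_def)
  qed
  then obtain M where M: "M \<in> S" and max: "\<And>X. X \<in> S \<Longrightarrow> M \<subseteq> X \<Longrightarrow> X = M" by blast
  have fM: "\<Inter>F \<noteq> {}" if "finite F" "F \<subseteq> M" for F using M that by (auto simp: S_def)
  have memI: "A \<in> M" if h: "\<And>F. finite F \<Longrightarrow> F \<subseteq> M \<Longrightarrow> A \<inter> \<Inter>F \<noteq> {}" for A
  proof -
    have "insert A M \<in> S"
      unfolding S_def
    proof (intro CollectI conjI allI impI)
      show "C \<subseteq> insert A M" using M by (auto simp: S_def)
      fix F assume F: "finite F" "F \<subseteq> insert A M"
      have "A \<inter> \<Inter>(F - {A}) \<noteq> {}" using h[of "F - {A}"] F by blast
      then show "\<Inter>F \<noteq> {}" by blast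
    qed
    then show ?thesis using max[of "insert A M"] by blast
  qed
  have "M \<in> betaT"
  proof (rule betaT_I)
    show "UNIV \<in> M" by (rule memI) (use fM in auto)
    show "{} \<notin> M" using fM[of "{{}}"] by auto
    show "B \<in> M" if "A \<in> M" "A \<subseteq> B" for A B
    proof (rule memI)
      fix F assume "finite F" "F \<subseteq> M"
      then show "B \<inter> \<Inter>F \<noteq> {}" using fM[of "insert A F"] that by auto
    qed
    show "A \<inter> B \<in> M" if "A \<in> M" "B \<in> M" for A B
    proof (rule memI)
      fix F assume "finite F" "F \<subseteq> M"
      then show "A \<inter> B \<inter> \<Inter>F \<noteq> {}" using fM[of "insert A (insert B F)"] that by auto
    qed
    show "A \<in> M \<or> - A \<in> M" for A
    proof (rule ccontr)
      assume n: "\<not> (A \<in> M \<or> - A \<in> M)"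
      obtain F where F: "finite F" "F \<subseteq> M" "A \<inter> \<Inter>F = {}" using n memI[of A] by metis
      obtain F' where F': "finite F'" "F' \<subseteq> M" "- A \<inter> \<Inter>F' = {}" using n memI[of "- A"] by metis
      have "\<Inter>(F \<union> F') = {}" using F(3) F'(3) by auto
      then show False using fM[of "F \<union> F'"] F F' by simp
    qed
  qed
  then show thesis using that M by (auto simp: S_def)
qed

text \<open>The generating sets \<open>{q. A \<in> q}\<close> are closed under finite intersections,
  since they correspond to intersections of the \<open>A\<close>; so the subbase is already a
  base.\<close>

lemma openin_beta_iff:
  "openin beta_top W \<longleftrightarrow> (W \<subseteq> betaT \<and> (\<forall>p\<in>W. \<exists>A\<in>p. {q \<in> betaT. A \<in> q} \<subseteq> W))" (is "_ \<longleftrightarrow> ?P W")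
proof
  assume "openin beta_top W"
  then have "generate_topology_on {{U \<in> betaT. A \<in> U} | A. True} W"
    by (simp add: beta_top_def openin_topology_generated_by_iff)
  then show "?P W"
  proof induction
    case (Int a b)
    show ?case
    proof (intro conjI ballI)
      show "a \<inter> b \<subseteq> betaT" using Int by blast
      fix p assume p: "p \<in> a \<inter> b"
      then have pb: "p \<in> betaT" and "p \<in> a" "p \<in> b" using Int.IH by auto
      obtain A where A: "A \<in> p" "{q \<in> betaT. A \<in> q} \<subseteq> a" using Int.IH(1) \<open>p \<in> a\<close> by metis
      obtain B where B: "B \<in> p" "{q \<in> betaT. B \<in> q} \<subseteq> b" using Int.IH(2) \<open>p \<in> b\<close> by metis
      show "\<exists>A\<in>p. {q \<in> betaT. A \<in> q} \<subseteq> a \<inter> b"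
        using pb A B by (intro bexI[of _ "A \<inter> B"]) (auto simp: betaT_Int)
    qed
  next
    case (UN K)
    show ?case
    proof (intro conjI ballI)
      show "\<Union>K \<subseteq> betaT" using UN.IH by blast
      fix p assume "p \<in> \<Union>K"
      then obtain k where k: "k \<in> K" "p \<in> k" by blast
      then obtain A where "A \<in> p" "{q \<in> betaT. A \<in> q} \<subseteq> k" using UN.IH by blast
      then show "\<exists>A\<in>p. {q \<in> betaT. A \<in> q} \<subseteq> \<Union>K" using k by blast
    qed
  qed auto
next
  assume W: "?P W"
  have "openin beta_top {q \<in> betaT. A \<in> q}" for A :: "'a set"
    unfolding beta_top_def openin_topology_generated_by_iff
    by (rule generate_topology_on.Basis) auto
  moreover have "\<exists>A. p \<in> {q \<in> betaT. A \<in> q} \<and> {q \<in> betaT. A \<in> q} \<subseteq> W" if "p \<in> W" for p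
    using W that by blast
  ultimately show "openin beta_top W" by (subst openin_subopen) metis
qed

lemma topspace_beta_top [simp]: "topspace beta_top = betaT"
proof
  show "betaT \<subseteq> topspace (beta_top :: 'a set set topology)"
    by (rule openin_subset) (use betaT_UNIV in \<open>auto simp: openin_beta_iff\<close>)
  show "topspace (beta_top :: 'a set set topology) \<subseteq> betaT"
    using openin_beta_iff[of "topspace beta_top"] by auto
qed

lemma openin_beta_basic: "openin beta_top {q \<in> betaT. A \<in> q}"
  by (auto simp: openin_beta_iff)

lemma Hausdorff_beta_top: "Hausdorff_space beta_top"
  unfolding Hausdorff_space_def topspace_beta_top
proof (intro allI impI)
  fix p q :: "'a set set" assume "p \<in> betaT \<and> q \<in> betaT \<and> p \<noteq> q"
  then obtain A where A: "A \<in> p" "A \<notin> q" "p \<in> betaT" "q \<in> betaT" using betaT_eqI by metis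
  show "\<exists>U V. openin beta_top U \<and> openin beta_top V \<and> p \<in> U \<and> q \<in> V \<and> disjnt U V"
    by (rule exI[of _ "{q \<in> betaT. A \<in> q}"], rule exI[of _ "{q \<in> betaT. - A \<in> q}"])
      (use A in \<open>auto simp: openin_beta_basic betaT_Compl disjnt_iff\<close>)
qed

text \<open>Refine the cover to basic sets, indexed by subsets \<open>A\<close> of the monoid. If no
  finitely many of these \<open>A\<close> covered the monoid, their complements would extend to an
  ultrafilter lying in no member of the cover.\<close>

lemma compact_beta_top: "compact_space (beta_top :: 'a set set topology)"
  unfolding compact_space_def compactin_def
proof (intro conjI allI impI)
  fix \<U> :: "'a set set set set"
  assume U: "(\<forall>U\<in>\<U>. openin beta_top U) \<and> topspace beta_top \<subseteq> \<Union>\<U>"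
  define \<A> where "\<A> = {A. \<exists>U\<in>\<U>. {q \<in> betaT. A \<in> q} \<subseteq> U}"
  have cov: "\<exists>A\<in>\<A>. A \<in> p" if "p \<in> betaT" for p
  proof -
    have "p \<in> \<Union>\<U>" using U that unfolding topspace_beta_top by blast
    then obtain W where W: "W \<in> \<U>" "p \<in> W" by blast
    then obtain A where "A \<in> p" "{q \<in> betaT. A \<in> q} \<subseteq> W" using U openin_beta_iff by metis
    then show ?thesis using W by (auto simp: \<A>_def)
  qed
  have "\<exists>F. finite F \<and> F \<subseteq> uminus ` \<A> \<and> \<Inter>F = {}"
  proof (rule ccontr)
    assume "\<not> ?thesis"
    then obtain p where p: "p \<in> betaT" "uminus ` \<A> \<subseteq> p"
      using ultrafilter_extends[of "uminus ` \<A>"] by metis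
    then show False using cov[of p] betaT_Compl[of p] by auto
  qed
  then obtain F where F: "finite F" "F \<subseteq> uminus ` \<A>" "\<Inter>F = {}" by blast
  obtain \<B> where B: "finite \<B>" "\<B> \<subseteq> \<A>" "F = uminus ` \<B>"
    using F(1,2) by (metis finite_subset_image)
  then have cov2: "\<Union>\<B> = UNIV" using F(3) by auto
  have "\<forall>A\<in>\<B>. \<exists>U\<in>\<U>. {q \<in> betaT. A \<in> q} \<subseteq> U" using B by (auto simp: \<A>_def)
  then obtain g where g: "\<And>A. A \<in> \<B> \<Longrightarrow> g A \<in> \<U> \<and> {q \<in> betaT. A \<in> q} \<subseteq> g A" by metis
  have "\<exists>A\<in>\<B>. A \<in> p" if p: "p \<in> betaT" for p
  proof (rule ccontr)
    assume n: "\<not> ?thesis"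
    have "\<Inter>(uminus ` \<B>') \<in> p" if "finite \<B>'" "\<B>' \<subseteq> \<B>" for \<B>'
      using that by (induction rule: finite_induct) (use p n in \<open>auto simp: betaT_UNIV betaT_Int betaT_Compl\<close>)
    then have "\<Inter>(uminus ` \<B>) \<in> p" using B by auto
    then show False using p F(3) B betaT_empty by auto
  qed
  then have "topspace beta_top \<subseteq> \<Union>(g ` \<B>)" using g by fastforce
  then show "\<exists>\<F>. finite \<F> \<and> \<F> \<subseteq> \<U> \<and> topspace beta_top \<subseteq> \<Union> \<F>"
    using g B(1) by (intro exI[of _ "g ` \<B>"]) blast
qed simp

text \<open>The principal ultrafilters map the acting monoid into its compactification; through them
  \<open>bact\<close> is a special case of \<open>bmult\<close>.\<close>

definition ppal :: "'t \<Rightarrow> 't set set" where "ppal t = {A. t \<in> A}"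

lemma ppal_betaT: "ppal t \<in> betaT"
  by (rule betaT_I) (auto simp: ppal_def)

lemma bact_eq: "bact t q = bmult (ppal t) q"
  by (simp add: bact_def bmult_def ppal_def)

lemma mem_bmult: "A \<in> bmult p q \<longleftrightarrow> {t. A \<in> bact t q} \<in> p"
  by (simp add: bmult_def bact_def)

lemma bmult_betaT:
  assumes p: "p \<in> betaT" and q: "q \<in> betaT"
  shows "bmult p q \<in> betaT"
proof (rule betaT_I)
  show "UNIV \<in> bmult p q" using assms by (simp add: bmult_def betaT_UNIV)
  show "{} \<notin> bmult p q" using assms by (simp add: bmult_def betaT_empty)
  show "B \<in> bmult p q" if "A \<in> bmult p q" "A \<subseteq> B" for A B
  proof -
    have "{t. {s. t * s \<in> A} \<in> q} \<subseteq> {t. {s. t * s \<in> B} \<in> q}"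
      using that by (auto intro: betaT_mono[OF q])
    then show ?thesis using that(1) betaT_mono[OF p] by (auto simp: bmult_def)
  qed
  have *: "{s. t * s \<in> A \<inter> B} = {s. t * s \<in> A} \<inter> {s. t * s \<in> B}" for t A B by auto
  have **: "{t. P t \<and> Q t} = {t. P t} \<inter> {t. Q t}" for P Q :: "'a \<Rightarrow> bool" by auto
  show "A \<inter> B \<in> bmult p q" if "A \<in> bmult p q" "B \<in> bmult p q" for A B
    using that unfolding bmult_def mem_Collect_eq * by (simp add: betaT_Int[OF q] betaT_Int[OF p] **)
  have c: "{s. t * s \<in> - A} = - {s. t * s \<in> A}" for t A by auto
  have cc: "{t. \<not> P t} = - {t. P t}" for P :: "'a \<Rightarrow> bool" by auto
  show "A \<in> bmult p q \<or> - A \<in> bmult p q" for A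
    unfolding bmult_def mem_Collect_eq c betaT_Compl[OF q] cc betaT_Compl[OF p] by blast
qed

lemma bact_betaT: "q \<in> betaT \<Longrightarrow> bact t q \<in> betaT"
  by (simp add: bact_eq bmult_betaT ppal_betaT)

lemma bmult_assoc: "bmult (bmult p q) r = bmult p (bmult q r)"
  by (simp add: bmult_def mult.assoc)

lemma bact_bmult: "bact t (bmult p q) = bmult (bact t p) q"
  by (simp add: bact_eq bmult_assoc)

lemma bact_one: "bact 1 q = q"
  by (simp add: bact_def)

lemma bact_mult: "bact (s * t) q = bact s (bact t q)"
  by (simp add: bact_def mult.assoc)

lemma continuous_map_bmult_right:
  fixes q :: "'a::monoid_mult set set"
  assumes q: "q \<in> betaT"
  shows "continuous_map beta_top beta_top (\<lambda>p. bmult p q)"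
  unfolding continuous_map_def topspace_beta_top
proof (intro conjI allI impI)
  show "(\<lambda>p. bmult p q) \<in> betaT \<rightarrow> betaT" using q by (auto simp: bmult_betaT)
  fix U :: "'a set set set" assume U: "openin beta_top U"
  show "openin beta_top {x \<in> betaT. bmult x q \<in> U}"
    unfolding openin_beta_iff
  proof (intro conjI ballI)
    fix p assume p: "p \<in> {x \<in> betaT. bmult x q \<in> U}"
    then obtain A where A: "A \<in> bmult p q" "{r \<in> betaT. A \<in> r} \<subseteq> U" using U openin_beta_iff by blast
    have "{r \<in> betaT. {t. {s. t * s \<in> A} \<in> q} \<in> r} \<subseteq> {x \<in> betaT. bmult x q \<in> U}"
    proof (intro subsetI)
      fix r assume "r \<in> {r \<in> betaT. {t. {s. t * s \<in> A} \<in> q} \<in> r}"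
      then have "r \<in> betaT" "A \<in> bmult r q" by (auto simp: bmult_def)
      then show "r \<in> {x \<in> betaT. bmult x q \<in> U}" using A(2) bmult_betaT[OF _ q] by blast
    qed
    moreover have "{t. {s. t * s \<in> A} \<in> q} \<in> p" using A(1) by (simp add: bmult_def)
    ultimately show "\<exists>A\<in>p. {r \<in> betaT. A \<in> r} \<subseteq> {x \<in> betaT. bmult x q \<in> U}" by blast
  qed blast
qed

lemma continuous_map_bact: "continuous_map beta_top beta_top (bact (t::'a::monoid_mult))"
  unfolding continuous_map_def topspace_beta_top
proof (intro conjI allI impI)
  show "bact t \<in> betaT \<rightarrow> betaT" by (auto simp: bact_betaT)
  fix U :: "'a set set set" assume U: "openin beta_top U"
  show "openin beta_top {x \<in> betaT. bact t x \<in> U}"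
    unfolding openin_beta_iff
  proof (intro conjI ballI)
    fix p assume p: "p \<in> {x \<in> betaT. bact t x \<in> U}"
    then obtain A where A: "A \<in> bact t p" "{r \<in> betaT. A \<in> r} \<subseteq> U" using U openin_beta_iff by blast
    have "{r \<in> betaT. {s. t * s \<in> A} \<in> r} \<subseteq> {x \<in> betaT. bact t x \<in> U}"
    proof (intro subsetI)
      fix r assume "r \<in> {r \<in> betaT. {s. t * s \<in> A} \<in> r}"
      then have "r \<in> betaT" "A \<in> bact t r" by (auto simp: bact_def)
      then show "r \<in> {x \<in> betaT. bact t x \<in> U}" using A(2) bact_betaT by blast
    qed
    moreover have "{s. t * s \<in> A} \<in> p" using A(1) by (simp add: bact_def)
    ultimately show "\<exists>A\<in>p. {r \<in> betaT. A \<in> r} \<subseteq> {x \<in> betaT. bact t x \<in> U}" by blast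
  qed blast
qed

section \<open>Minimal left ideals\<close>

lemma left_ideal_principal: "q \<in> betaT \<Longrightarrow> left_ideal ((\<lambda>p. bmult p q) ` betaT)"
  unfolding left_ideal_def
  using ppal_betaT by (auto simp: bmult_betaT simp flip: bmult_assoc)

text \<open>Both images are left ideals contained in \<open>L\<close>, so minimality identifies them
  with \<open>L\<close>.\<close>

lemma minimal_left_ideal_eq:
  assumes "minimal_left_ideal L" "q \<in> L"
  shows "(\<lambda>p. bmult p q) ` L = L" "(\<lambda>p. bmult p q) ` betaT = L"
proof -
  have L: "left_ideal L" "q \<in> betaT" using assms by (auto simp: minimal_left_ideal_def left_ideal_def)
  have "left_ideal ((\<lambda>p. bmult p q) ` L)"
    using L assms(2) unfolding left_ideal_def by (auto simp: bmult_betaT simp flip: bmult_assoc)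
  moreover have "(\<lambda>p. bmult p q) ` L \<subseteq> L" using L assms(2) by (auto simp: left_ideal_def)
  ultimately show 1: "(\<lambda>p. bmult p q) ` L = L" using assms(1) by (auto simp: minimal_left_ideal_def)
  have "(\<lambda>p. bmult p q) ` betaT \<subseteq> L" using L(1) assms(2) by (auto simp: left_ideal_def)
  then show "(\<lambda>p. bmult p q) ` betaT = L"
    using left_ideal_principal[OF L(2)] assms(1) unfolding minimal_left_ideal_def by blast
qed

lemma closedin_minimal_left_ideal:
  assumes "minimal_left_ideal L" shows "closedin beta_top L"
proof -
  obtain q where q: "q \<in> L" "q \<in> betaT" using assms by (auto simp: minimal_left_ideal_def left_ideal_def)
  have "closedin beta_top ((\<lambda>p. bmult p q) ` betaT)"
    using continuous_imp_closed_map[OF continuous_map_bmult_right[OF q(2)] compact_beta_top Hausdorff_beta_top]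
    unfolding closed_map_def by (metis closedin_topspace topspace_beta_top)
  then show ?thesis using minimal_left_ideal_eq(2)[OF assms q(1)] by simp
qed

text \<open>\<open>p q\<close> is the limit of the points \<open>t q\<close> along \<open>p\<close>,
  so it cannot leave a closed invariant set: a basic neighbourhood of \<open>p q\<close> outside
  \<open>C\<close> would contain some \<open>t q\<close>.\<close>

lemma closed_invariant_imp_left_ideal:
  assumes C: "closedin beta_top C" "\<And>t q. q \<in> C \<Longrightarrow> bact t q \<in> C" and p: "p \<in> betaT" and q: "q \<in> C"
  shows "bmult p q \<in> C"
proof (rule ccontr)
  assume n: "bmult p q \<notin> C"
  have qb: "q \<in> betaT" using C(1) q closedin_subset by fastforce
  have "openin beta_top (betaT - C)" using C(1) by (simp add: closedin_def)
  moreover have "bmult p q \<in> betaT - C" using n bmult_betaT[OF p qb] by simp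
  ultimately obtain A where A: "A \<in> bmult p q" "{r \<in> betaT. A \<in> r} \<subseteq> betaT - C"
    unfolding openin_beta_iff by blast
  then have "{t. A \<in> bact t q} \<in> p" by (simp add: mem_bmult)
  then obtain t where "A \<in> bact t q" using betaT_nonempty_mem[OF p] by blast
  then show False using A(2) C(2)[OF q] bact_betaT[OF qb] by blast
qed

section \<open>Chains of closed sets and minimal elements\<close>

lemma compact_chain_Inter_nonempty:
  assumes "compact_space X" and ne: "\<D> \<noteq> {}"
    and cl: "\<And>A. A \<in> \<D> \<Longrightarrow> closedin X A \<and> A \<noteq> {}"
    and ch: "\<And>A B. A \<in> \<D> \<Longrightarrow> B \<in> \<D> \<Longrightarrow> A \<subseteq> B \<or> B \<subseteq> A"
  shows "\<Inter>\<D> \<noteq> {}"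
proof -
  have "\<Inter>\<F> \<noteq> {}" if "finite \<F>" "\<F> \<subseteq> \<D>" for \<F>
  proof (cases "\<F> = {}")
    case False
    have "\<exists>B\<in>\<F>. \<forall>A\<in>\<F>. B \<subseteq> A"
      using that(1) False that(2)
    proof (induction rule: finite_ne_induct)
      case (insert A \<F>)
      then obtain B where B: "B \<in> \<F>" "\<forall>A\<in>\<F>. B \<subseteq> A" by blast
      have "A \<in> \<D>" "B \<in> \<D>" using insert.prems B(1) by auto
      then consider "A \<subseteq> B" | "B \<subseteq> A" using ch[of A B] by blast
      then show ?case
      proof cases
        case 1 then show ?thesis using B by (intro bexI[of _ A]) auto
      next
        case 2 then show ?thesis using B by (intro bexI[of _ B]) auto
      qed
    qed auto
    then obtain B where B: "B \<in> \<F>" "\<And>A. A \<in> \<F> \<Longrightarrow> B \<subseteq> A" by blast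
    then have "B \<subseteq> \<Inter>\<F>" "B \<noteq> {}" using cl[of B] that(2) by auto
    then show ?thesis by auto
  qed simp
  then show ?thesis
    using compact_space_fip[THEN iffD1, OF assms(1), rule_format, of \<D>] cl by simp
qed

lemma subset_Zorn_minimal:
  assumes "S \<noteq> {}"
    and ch: "\<And>\<D>. \<D> \<noteq> {} \<Longrightarrow> \<D> \<subseteq> S \<Longrightarrow> (\<And>A B. A \<in> \<D> \<Longrightarrow> B \<in> \<D> \<Longrightarrow> A \<subseteq> B \<or> B \<subseteq> A) \<Longrightarrow> \<Inter>\<D> \<in> S"
  shows "\<exists>M\<in>S. \<forall>X\<in>S. X \<subseteq> M \<longrightarrow> X = M"
proof -
  have "\<exists>M\<in>uminus ` S. \<forall>X\<in>uminus ` S. M \<subseteq> X \<longrightarrow> X = M"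
  proof (rule subset_Zorn_nonempty)
    show "uminus ` S \<noteq> {}" using assms(1) by blast
    fix \<C> assume c: "\<C> \<noteq> {}" "subset.chain (uminus ` S) \<C>"
    define \<D> where "\<D> = uminus ` \<C>"
    have "\<Inter>\<D> \<in> S"
    proof (rule ch)
      show "\<D> \<noteq> {}" "\<D> \<subseteq> S" using c by (auto simp: \<D>_def subset.chain_def)
      show "A \<subseteq> B \<or> B \<subseteq> A" if "A \<in> \<D>" "B \<in> \<D>" for A B
        using c(2) that by (fastforce simp: \<D>_def subset.chain_def)
    qed
    moreover have "\<Union>\<C> = - \<Inter>\<D>" by (auto simp: \<D>_def)
    ultimately show "\<Union>\<C> \<in> uminus ` S" by blast
  qed
  then show ?thesis by auto
qed

text \<open>Ellis' idempotent lemma: a minimal nonempty closed subsemigroup is a singleton.\<close>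

lemma exists_idempotent:
  assumes L: "minimal_left_ideal L"
  obtains u where "u \<in> L" "bmult u u = u"
proof -
  define S where "S = {C. closedin beta_top C \<and> C \<subseteq> L \<and> C \<noteq> {} \<and> (\<forall>p\<in>C. \<forall>q\<in>C. bmult p q \<in> C)}"
  have LS: "L \<in> S"
    using L closedin_minimal_left_ideal[OF L] by (auto simp: S_def minimal_left_ideal_def left_ideal_def)
  have "\<exists>M\<in>S. \<forall>X\<in>S. X \<subseteq> M \<longrightarrow> X = M"
  proof (rule subset_Zorn_minimal[of S])
    show "S \<noteq> {}" using LS by blast
    fix \<D> assume D: "\<D> \<noteq> {}" "\<D> \<subseteq> S" "\<And>A B. A \<in> \<D> \<Longrightarrow> B \<in> \<D> \<Longrightarrow> A \<subseteq> B \<or> B \<subseteq> A"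
    have inS: "closedin beta_top A" "A \<subseteq> L" "A \<noteq> {}" "\<And>p q. p \<in> A \<Longrightarrow> q \<in> A \<Longrightarrow> bmult p q \<in> A"
      if "A \<in> \<D>" for A
      using D(2) that by (auto simp: S_def)
    show "\<Inter>\<D> \<in> S"
      unfolding S_def
    proof (intro CollectI conjI ballI)
      show "closedin beta_top (\<Inter>\<D>)" by (rule closedin_Inter) (use D inS in auto)
      show "\<Inter>\<D> \<subseteq> L" using D(1) inS(2) by blast
      show "\<Inter>\<D> \<noteq> {}"
        by (rule compact_chain_Inter_nonempty[OF compact_beta_top D(1) _ D(3)]) (use inS in auto)
      show "bmult p q \<in> \<Inter>\<D>" if "p \<in> \<Inter>\<D>" "q \<in> \<Inter>\<D>" for p q
        using inS(4) that by blast
    qed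
  qed
  then obtain M where M: "M \<in> S" and min: "\<And>X. X \<in> S \<Longrightarrow> X \<subseteq> M \<Longrightarrow> X = M" by metis
  have M': "closedin beta_top M" "M \<subseteq> L" "\<And>p q. p \<in> M \<Longrightarrow> q \<in> M \<Longrightarrow> bmult p q \<in> M" 
    using M by (auto simp: S_def)
  have Mb: "M \<subseteq> betaT" using M'(1) closedin_subset by fastforce
  obtain u where u: "u \<in> M" using M by (auto simp: S_def)
  have ub: "u \<in> betaT" using u Mb by auto
  have "(\<lambda>p. bmult p u) ` M \<in> S"
    unfolding S_def
  proof (intro CollectI conjI)
    show "closedin beta_top ((\<lambda>p. bmult p u) ` M)"
      using continuous_imp_closed_map[OF continuous_map_bmult_right[OF ub] compact_beta_top Hausdorff_beta_top] M'(1)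
      by (simp add: closed_map_def)
    show "\<forall>p\<in>(\<lambda>p. bmult p u) ` M. \<forall>q\<in>(\<lambda>p. bmult p u) ` M. bmult p q \<in> (\<lambda>p. bmult p u) ` M"
      using M'(3) u by (auto simp flip: bmult_assoc)
  qed (use M' u in auto)
  then have Mu: "(\<lambda>p. bmult p u) ` M = M" by (rule min) (use M'(3) u in auto)
  \<comment> \<open>The solutions of \<open>p u = u\<close> in \<open>M\<close> form a closed
    subsemigroup, nonempty because \<open>M u = M\<close>; minimality makes it all of
    \<open>M\<close>, so it contains \<open>u\<close>.\<close>
  define N where "N = {p \<in> M. bmult p u = u}"
  have "N \<in> S"
    unfolding S_def
  proof (intro CollectI conjI)
    have "closedin beta_top {p \<in> topspace beta_top. bmult p u \<in> {u}}"
      using closedin_Hausdorff_singleton[OF Hausdorff_beta_top, of u] ub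
      by (intro closedin_continuous_map_preimage[OF continuous_map_bmult_right[OF ub]]) auto
    moreover have "N = M \<inter> {p \<in> topspace beta_top. bmult p u \<in> {u}}" using Mb by (auto simp: N_def)
    ultimately show "closedin beta_top N" using M'(1) by (simp add: closedin_Int)
    have "u \<in> (\<lambda>p. bmult p u) ` M" using u Mu by simp
    then show "N \<noteq> {}" by (auto simp: N_def)
    show "\<forall>p\<in>N. \<forall>q\<in>N. bmult p q \<in> N"
      using M'(3) by (auto simp: N_def bmult_assoc)
  qed (use M'(2) in \<open>auto simp: N_def\<close>)
  then have "N = M" by (rule min) (auto simp: N_def)
  then have "bmult u u = u" using u by (auto simp: N_def)
  then show thesis using that u M'(2) by auto
qed

section \<open>The group of a minimal left ideal\<close>

locale ellis_group =
  fixes I :: "'t::monoid_mult set set set" and u :: "'t set set"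
  assumes minI: "minimal_left_ideal I" and uI: "u \<in> I" and uu: "bmult u u = u"
begin

notation bmult (infixl "\<odot>" 70)

abbreviation "J \<equiv> Itop I"
abbreviation "JJ \<equiv> prod_topology J J"

lemma I_betaT: "m \<in> I \<Longrightarrow> m \<in> betaT"
  using minI by (auto simp: minimal_left_ideal_def left_ideal_def)

lemma I_mult: "p \<in> betaT \<Longrightarrow> m \<in> I \<Longrightarrow> p \<odot> m \<in> I"
  using minI by (auto simp: minimal_left_ideal_def left_ideal_def)

lemma I_act: "m \<in> I \<Longrightarrow> bact t m \<in> I"
  by (simp add: bact_eq I_mult ppal_betaT)

lemma I_mult': "p \<in> I \<Longrightarrow> m \<in> I \<Longrightarrow> p \<odot> m \<in> I"
  by (simp add: I_mult I_betaT)

lemma I_reach: assumes "m \<in> I" "n \<in> I" shows "\<exists>p\<in>I. n = p \<odot> m"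
proof -
  have "n \<in> (\<lambda>p. p \<odot> m) ` I" using minimal_left_ideal_eq(1)[OF minI assms(1)] assms(2) by simp
  then show ?thesis by auto
qed

text \<open>Every element of \<open>I\<close> has the form \<open>p u\<close>, so the idempotent is
  a right identity on the whole ideal and not only on its group.\<close>

lemma mult_u: assumes "m \<in> I" shows "m \<odot> u = m"
proof -
  obtain p where "m = p \<odot> u" using I_reach[OF uI assms] by blast
  then show ?thesis by (simp add: bmult_assoc uu)
qed

lemma topspace_J [simp]: "topspace J = I"
  using I_betaT by (auto simp: Itop_def)

lemma compact_J: "compact_space J"
  unfolding Itop_def
  by (simp add: closedin_compact_space closedin_minimal_left_ideal compact_beta_top compact_space_subtopology minI)

lemma Hausdorff_J: "Hausdorff_space J"
  unfolding Itop_def by (simp add: Hausdorff_beta_top Hausdorff_space_subtopology)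

lemma compact_JJ: "compact_space JJ"
  by (simp add: compact_space_prod_topology compact_J)

lemma Hausdorff_JJ: "Hausdorff_space JJ"
  by (simp add: Hausdorff_space_prod_topology Hausdorff_J)

lemma openin_J_basic: "openin J {m \<in> I. A \<in> m}"
proof -
  have "{m \<in> I. A \<in> m} = {m \<in> betaT. A \<in> m} \<inter> I" using I_betaT by auto
  then show ?thesis unfolding Itop_def openin_subtopology using openin_beta_basic by blast
qed

lemma openin_J_D:
  assumes "openin J U" "m \<in> U"
  obtains A where "A \<in> m" "\<And>q. q \<in> I \<Longrightarrow> A \<in> q \<Longrightarrow> q \<in> U"
proof -
  obtain W where W: "openin beta_top W" "U = W \<inter> I"
    using assms(1) by (auto simp: Itop_def openin_subtopology)
  then obtain A where "A \<in> m" "{q \<in> betaT. A \<in> q} \<subseteq> W"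
    using assms(2) by (auto simp: openin_beta_iff)
  then show thesis using that[of A] W I_betaT by blast
qed

lemma openin_JJ_D:
  assumes "openin JJ W" "(m, n) \<in> W"
  obtains A B where "A \<in> m" "B \<in> n" "\<And>x y. x \<in> I \<Longrightarrow> y \<in> I \<Longrightarrow> A \<in> x \<Longrightarrow> B \<in> y \<Longrightarrow> (x, y) \<in> W"
proof -
  obtain U V where UV: "openin J U" "openin J V" "m \<in> U" "n \<in> V" "U \<times> V \<subseteq> W"
    using assms unfolding openin_prod_topology_alt by metis
  obtain A where A: "A \<in> m" "\<And>q. q \<in> I \<Longrightarrow> A \<in> q \<Longrightarrow> q \<in> U" using openin_J_D UV by metis
  obtain B where B: "B \<in> n" "\<And>q. q \<in> I \<Longrightarrow> B \<in> q \<Longrightarrow> q \<in> V" using openin_J_D UV by metis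
  show thesis by (rule that[OF A(1) B(1)]) (use A B UV in blast)
qed

lemma openin_JJ_subset: "openin JJ W \<Longrightarrow> (m, n) \<in> W \<Longrightarrow> m \<in> I \<and> n \<in> I"
  using openin_subset by fastforce

lemma openin_JJ_basic: "openin JJ {(m, n). m \<in> I \<and> n \<in> I \<and> A \<in> m \<and> B \<in> n}"
proof -
  have "{(m, n). m \<in> I \<and> n \<in> I \<and> A \<in> m \<and> B \<in> n} = {m \<in> I. A \<in> m} \<times> {m \<in> I. B \<in> m}" by auto
  then show ?thesis by (simp add: openin_prod_Times_iff openin_J_basic)
qed

lemma continuous_act_J: "continuous_map J J (bact t)"
  unfolding Itop_def
  by (rule continuous_map_into_subtopology)
    (auto simp: continuous_map_bact continuous_map_from_subtopology I_act)

lemma continuous_rmult_J: "g \<in> I \<Longrightarrow> continuous_map J J (\<lambda>m. m \<odot> g)"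
  unfolding Itop_def
  by (rule continuous_map_into_subtopology)
    (auto simp: continuous_map_bmult_right continuous_map_from_subtopology I_betaT I_mult')

lemma openin_JJ_preimage:
  assumes "continuous_map J J f" "continuous_map J J h" "openin JJ W"
  shows "openin JJ {(m, n). m \<in> I \<and> n \<in> I \<and> (f m, h n) \<in> W}"
proof -
  have "continuous_map JJ JJ (\<lambda>(m, n). (f m, h n))"
    using assms by (simp add: continuous_map_prod_top)
  from openin_continuous_map_preimage[OF this assms(3)]
  show ?thesis by (rule back_subst) auto
qed

lemma openin_JJ_act:
  "openin JJ W \<Longrightarrow> openin JJ {(m, n). m \<in> I \<and> n \<in> I \<and> (bact t m, bact t n) \<in> W}"
  by (rule openin_JJ_preimage[OF continuous_act_J continuous_act_J])

lemma openin_JJ_rmult: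
  "g \<in> I \<Longrightarrow> h \<in> I \<Longrightarrow> openin JJ W \<Longrightarrow> openin JJ {(m, n). m \<in> I \<and> n \<in> I \<and> (m \<odot> g, n \<odot> h) \<in> W}"
  by (rule openin_JJ_preimage[OF continuous_rmult_J continuous_rmult_J])

lemma openin_JJ_swap:
  assumes "openin JJ W" shows "openin JJ {(m, n). (n, m) \<in> W}"
proof -
  have "continuous_map JJ JJ (\<lambda>z. (snd z, fst z))"
    by (simp add: continuous_map_paired continuous_map_fst continuous_map_snd)
  from openin_continuous_map_preimage[OF this assms]
  show ?thesis by (rule back_subst) (use openin_JJ_subset[OF assms] in auto)
qed

text \<open>Membership of translates in a basic set is decided by the ultrafilter \<open>p\<close>.
  The two coordinates give two members of \<open>p\<close>, and any \<open>t\<close> in their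
  intersection serves both coordinates at once.\<close>

lemma orbit_approx:
  assumes W: "openin JJ W" and "p \<in> betaT" "m \<in> I" "n \<in> I" "(p \<odot> m, p \<odot> n) \<in> W"
  obtains t where "(bact t m, bact t n) \<in> W"
proof -
  obtain A B where AB: "A \<in> p \<odot> m" "B \<in> p \<odot> n"
      "\<And>x y. x \<in> I \<Longrightarrow> y \<in> I \<Longrightarrow> A \<in> x \<Longrightarrow> B \<in> y \<Longrightarrow> (x, y) \<in> W"
    using openin_JJ_D[OF W assms(5)] by metis
  have "{t. A \<in> bact t m} \<inter> {t. B \<in> bact t n} \<in> p"
    using AB assms(2) by (simp add: mem_bmult betaT_Int)
  then obtain t where "A \<in> bact t m" "B \<in> bact t n" using betaT_nonempty_mem[OF assms(2)] by blast
  then show thesis using that AB(3) assms(3,4) I_act by blast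
qed

definition G where "G = {p \<in> I. u \<odot> p = p}"

lemma G_I: "g \<in> G \<Longrightarrow> g \<in> I" by (simp add: G_def)
lemma u_G: "u \<in> G" by (simp add: G_def uI uu)
lemma u_mult: "g \<in> G \<Longrightarrow> u \<odot> g = g" by (simp add: G_def)
lemma G_mult: "g \<in> G \<Longrightarrow> h \<in> G \<Longrightarrow> g \<odot> h \<in> G"
  by (simp add: G_def I_mult' flip: bmult_assoc)
lemma um_G: "m \<in> I \<Longrightarrow> u \<odot> m \<in> G"
  by (simp add: G_def I_mult' uI uu flip: bmult_assoc)
lemma G_mult_u: "g \<in> G \<Longrightarrow> g \<odot> u = g" by (simp add: G_I mult_u)

lemma G_inverse_ex:
  assumes "g \<in> G" shows "\<exists>h\<in>G. h \<odot> g = u"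
proof -
  obtain p where "p \<in> I" "u = p \<odot> g" using I_reach[of g u] assms G_I uI by blast
  then show ?thesis using um_G uu by (intro bexI[of _ "u \<odot> p"]) (simp_all add: bmult_assoc)
qed

definition iv where "iv g = (SOME h. h \<in> G \<and> h \<odot> g = u)"

lemma iv_G: "g \<in> G \<Longrightarrow> iv g \<in> G" and iv_left: "g \<in> G \<Longrightarrow> iv g \<odot> g = u"
  unfolding iv_def using someI_ex[of "\<lambda>h. h \<in> G \<and> h \<odot> g = u"] G_inverse_ex by auto

lemma iv_right: assumes g: "g \<in> G" shows "g \<odot> iv g = u"
proof -
  have "g \<odot> iv g = u \<odot> (g \<odot> iv g)" by (simp add: G_mult iv_G u_mult g)
  also have "\<dots> = iv (iv g) \<odot> (iv g \<odot> g) \<odot> iv g"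
    by (metis bmult_assoc iv_G iv_left g)
  also have "\<dots> = u" by (metis G_mult_u bmult_assoc iv_G iv_left g)
  finally show ?thesis .
qed

lemma iv_cancel: "g \<in> G \<Longrightarrow> m \<in> I \<Longrightarrow> m \<odot> g \<odot> iv g = m" "g \<in> G \<Longrightarrow> m \<in> I \<Longrightarrow> m \<odot> iv g \<odot> g = m"
  by (simp_all add: bmult_assoc iv_left iv_right mult_u)

lemma iv_cancel_left: "g \<in> G \<Longrightarrow> h \<in> G \<Longrightarrow> iv g \<odot> (g \<odot> h) = h" "g \<in> G \<Longrightarrow> h \<in> G \<Longrightarrow> g \<odot> (iv g \<odot> h) = h"
  by (simp_all add: iv_left iv_right u_mult flip: bmult_assoc)

lemma iv_iv: "g \<in> G \<Longrightarrow> iv (iv g) = g"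
  using iv_cancel_left(1)[of "iv g" g] by (simp add: iv_G iv_left mult_u G_I)

text \<open>\<open>hits W g\<close>: the graph \<open>\<Gamma>\<close> of the automorphism \<open>m \<mapsto> m g\<close> meets \<open>W\<close>. The sets
  \<open>{g. hits W g}\<close>, for \<open>W\<close> open, form a base of the \<open>\<tau>\<close>-topology.\<close>

definition hits where "hits W g \<longleftrightarrow> (\<exists>m\<in>I. (m, m \<odot> g) \<in> W)"

lemma hitsI: "m \<in> I \<Longrightarrow> (m, m \<odot> g) \<in> W \<Longrightarrow> hits W g" by (auto simp: hits_def)

text \<open>If \<open>x = p m\<close>, then \<open>(x, x g) = p (m, m g)\<close>: every point of the
  graph lies in the orbit closure of every other one. This is the minimality of graphs.\<close>

lemma graph_orbit:
  assumes W: "openin JJ W" and "hits W g" "g \<in> I" "m \<in> I"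
  obtains t where "(bact t m, bact t m \<odot> g) \<in> W"
proof -
  obtain x where x: "x \<in> I" "(x, x \<odot> g) \<in> W" using assms(2) by (auto simp: hits_def)
  then obtain p where "p \<in> I" "x = p \<odot> m" using I_reach assms(4) by blast
  then have "(p \<odot> m, p \<odot> (m \<odot> g)) \<in> W" using x by (simp add: bmult_assoc)
  then obtain t where "(bact t m, bact t (m \<odot> g)) \<in> W"
    using orbit_approx[OF W] \<open>p \<in> I\<close> assms(3,4) I_betaT I_mult' by metis
  then show thesis using that by (simp add: bact_bmult)
qed

text \<open>\<open>(u m, u n) = (u m, u m g)\<close> for \<open>g = prt m n\<close>: the orbit closure of \<open>(m, n)\<close> contains the graph
  of \<open>prt m n\<close>.\<close>

definition prt where "prt m n = iv (u \<odot> m) \<odot> (u \<odot> n)"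

lemma prt_G: "m \<in> I \<Longrightarrow> n \<in> I \<Longrightarrow> prt m n \<in> G"
  by (simp add: prt_def G_mult iv_G um_G)

text \<open>The formula for \<open>prt\<close> is a cocycle: the inner factors cancel. It turns
  chains of related points into products in the group.\<close>

lemma prt_trans: "m \<in> I \<Longrightarrow> n \<in> I \<Longrightarrow> q \<in> I \<Longrightarrow> prt m n \<odot> prt n q = prt m q"
  unfolding prt_def bmult_assoc[of "iv (u \<odot> m)"] by (simp add: iv_cancel_left um_G)

lemma prt_mult: "m \<in> I \<Longrightarrow> g \<in> G \<Longrightarrow> prt m (m \<odot> g) = g"
  unfolding prt_def bmult_assoc[of u m, symmetric] by (simp add: iv_cancel_left um_G)

lemma prt_u: "g \<in> G \<Longrightarrow> prt u g = g"
  using prt_mult[OF uI] by (simp add: u_mult)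

lemma um_prt: "m \<in> I \<Longrightarrow> n \<in> I \<Longrightarrow> u \<odot> m \<odot> prt m n = u \<odot> n"
  unfolding prt_def using iv_cancel_left(2)[OF um_G um_G] by simp

lemma prt_orbit:
  assumes W: "openin JJ W" and h: "hits W (prt m n)" and mn: "m \<in> I" "n \<in> I"
  obtains t where "(bact t m, bact t n) \<in> W"
proof -
  obtain x where x: "x \<in> I" "(x, x \<odot> prt m n) \<in> W" using h by (auto simp: hits_def)
  then obtain p where p: "p \<in> I" "x = p \<odot> (u \<odot> m)" using I_reach[of "u \<odot> m"] mn um_G G_I by blast
  have "p \<odot> (u \<odot> m) \<odot> prt m n = p \<odot> (u \<odot> n)" using um_prt[OF mn] by (simp add: bmult_assoc)
  then have "((p \<odot> u) \<odot> m, (p \<odot> u) \<odot> n) \<in> W" using x p by (simp add: bmult_assoc)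
  then show thesis using orbit_approx[OF W _ mn] that p(1) uI I_mult' I_betaT by metis
qed

section \<open>Closed invariant equivalence relations and their groups\<close>

text \<open>Invariant closed equivalence relations, that is, the kernels of factor maps of the
  universal minimal system.\<close>

definition icer where "icer R \<longleftrightarrow> closedin JJ R \<and> (\<forall>m\<in>I. (m, m) \<in> R) \<and> sym R \<and> trans R
    \<and> (\<forall>t m n. (m, n) \<in> R \<longrightarrow> (bact t m, bact t n) \<in> R)"

text \<open>For an \<open>icer\<close> relation \<open>R\<close> this is the Ellis group of the
  factor \<open>I / R\<close>: the elements whose right multiplication has its graph inside
  \<open>R\<close>.\<close>

definition grp where "grp R = {g \<in> G. (u, g) \<in> R}"

definition subgrp where "subgrp K \<longleftrightarrow> K \<subseteq> G \<and> u \<in> K \<and> (\<forall>g\<in>K. \<forall>h\<in>K. g \<odot> h \<in> K) \<and> (\<forall>g\<in>K. iv g \<in> K)"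

lemma closed_rel_subset: "closedin JJ R \<Longrightarrow> (m, n) \<in> R \<Longrightarrow> m \<in> I \<and> n \<in> I"
  using closedin_subset by fastforce

lemma icer_subset: "icer R \<Longrightarrow> (m, n) \<in> R \<Longrightarrow> m \<in> I \<and> n \<in> I"
  unfolding icer_def using closed_rel_subset by blast

lemma icer_refl: "icer R \<Longrightarrow> m \<in> I \<Longrightarrow> (m, m) \<in> R" by (simp add: icer_def)
lemma icer_sym: "icer R \<Longrightarrow> (m, n) \<in> R \<Longrightarrow> (n, m) \<in> R" by (auto simp: icer_def dest: symD)
lemma icer_trans: "icer R \<Longrightarrow> (m, n) \<in> R \<Longrightarrow> (n, q) \<in> R \<Longrightarrow> (m, q) \<in> R"
  unfolding icer_def by (meson transD)
lemma icer_act: "icer R \<Longrightarrow> (m, n) \<in> R \<Longrightarrow> (bact t m, bact t n) \<in> R" by (simp add: icer_def)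
lemma icer_closed: "icer R \<Longrightarrow> closedin JJ R" by (simp add: icer_def)

lemma closed_invariant_mult:
  assumes R: "closedin JJ R" and inv: "\<And>t. (bact t m, bact t n) \<in> R" and p: "p \<in> betaT" and mn: "m \<in> I" "n \<in> I"
  shows "(p \<odot> m, p \<odot> n) \<in> R"
proof (rule ccontr)
  assume "(p \<odot> m, p \<odot> n) \<notin> R"
  then have "(p \<odot> m, p \<odot> n) \<in> I \<times> I - R" using mn p I_mult by auto
  moreover have "openin JJ (I \<times> I - R)" using R by (simp add: closedin_def)
  ultimately obtain t where "(bact t m, bact t n) \<in> I \<times> I - R"
    using orbit_approx[OF _ p mn] by metis
  then show False using inv by auto
qed

lemma icer_mult: "icer R \<Longrightarrow> (m, n) \<in> R \<Longrightarrow> p \<in> betaT \<Longrightarrow> (p \<odot> m, p \<odot> n) \<in> R"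
  using closed_invariant_mult[of R m n p] icer_closed icer_act icer_subset by blast

text \<open>Multiplying the pair on the left by \<open>u\<close> and then by the inverse of
  \<open>u m\<close> keeps it in \<open>R\<close> and moves it to
  \<open>(u, prt m n)\<close>.\<close>

lemma icer_prt: assumes R: "icer R" "(m, n) \<in> R" shows "prt m n \<in> grp R"
proof -
  have mn: "m \<in> I" "n \<in> I" using icer_subset[OF R] by auto
  have "(iv (u \<odot> m) \<odot> (u \<odot> m), iv (u \<odot> m) \<odot> (u \<odot> n)) \<in> R"
    using icer_mult[OF R(1) icer_mult[OF R, of u], of "iv (u \<odot> m)"] mn uI by (simp add: I_betaT G_I iv_G um_G)
  then have "(u, prt m n) \<in> R" by (simp only: prt_def iv_left[OF um_G[OF mn(1)]])
  then show ?thesis using mn by (simp add: grp_def prt_G)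
qed

lemma icer_graph: assumes R: "icer R" "g \<in> grp R" "m \<in> I" shows "(m, m \<odot> g) \<in> R"
  using icer_mult[OF R(1), of u g m] R by (simp add: grp_def I_betaT mult_u)

lemma subgrp_grp: assumes R: "icer R" shows "subgrp (grp R)"
  unfolding subgrp_def
proof (intro conjI ballI)
  show "grp R \<subseteq> G" by (auto simp: grp_def)
  show "u \<in> grp R" by (simp add: grp_def u_G icer_refl R uI)
  show "g \<odot> h \<in> grp R" if gh: "g \<in> grp R" "h \<in> grp R" for g h
  proof -
    have "(g, g \<odot> h) \<in> R" using icer_graph[OF R gh(2), of g] gh(1) by (auto simp: grp_def G_I)
    then show ?thesis using gh icer_trans[OF R] by (auto simp: grp_def G_mult)
  qed
  show "iv g \<in> grp R" if g: "g \<in> grp R" for g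
  proof -
    have gG: "g \<in> G" using g by (simp add: grp_def)
    have "(iv g, iv g \<odot> g) \<in> R" by (rule icer_graph[OF R g G_I[OF iv_G[OF gG]]])
    then show ?thesis using icer_sym[OF R] by (simp add: grp_def iv_G gG iv_left)
  qed
qed

lemma subgrpD: assumes "subgrp K"
  shows "g \<in> K \<Longrightarrow> g \<in> G" "g \<in> K \<Longrightarrow> g \<in> I" "u \<in> K" "g \<in> K \<Longrightarrow> h \<in> K \<Longrightarrow> g \<odot> h \<in> K" "g \<in> K \<Longrightarrow> iv g \<in> K"
  using assms G_I by (auto simp: subgrp_def)

text \<open>\<open>N K\<close> is the partition of the universal minimal system into the sets \<open>m \<circ> K\<close>, where
  \<open>\<circ>\<close> is the circle operation of \<open>\<beta>T\<close> on the hyperspace. The formula expresses that \<open>n\<close> lies in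
  \<open>m \<circ> K = lim\<^bsub>t \<rightarrow> m\<^esub> t K\<close>.\<close>

definition N where "N K = {(m, n). m \<in> I \<and> n \<in> I \<and> (\<forall>A\<in>n. {t. \<exists>k\<in>K. A \<in> bact t k} \<in> m)}"

text \<open>The bridge from the ultrafilter formula to approximation by graphs. Since
  \<open>m = m u\<close>, the points \<open>t u\<close> tend to \<open>m\<close> along
  \<open>m\<close>; the pairs \<open>(t u, t k)\<close> with \<open>k\<close> in \<open>K\<close>
  lie on graphs and approximate \<open>(m, n)\<close>.\<close>

lemma N_iff:
  assumes K: "K \<subseteq> G"
  shows "(m, n) \<in> N K \<longleftrightarrow> m \<in> I \<and> n \<in> I \<and> (\<forall>W. openin JJ W \<and> (m, n) \<in> W \<longrightarrow> (\<exists>k\<in>K. hits W k))"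
proof (intro iffI conjI allI impI)
  assume mn: "(m, n) \<in> N K"
  then show I: "m \<in> I" "n \<in> I" by (auto simp: N_def)
  fix W assume W: "openin JJ W \<and> (m, n) \<in> W"
  then obtain A B where AB: "A \<in> m" "B \<in> n"
      "\<And>x y. x \<in> I \<Longrightarrow> y \<in> I \<Longrightarrow> A \<in> x \<Longrightarrow> B \<in> y \<Longrightarrow> (x, y) \<in> W"
    using openin_JJ_D by metis
  have "A \<in> m \<odot> u" using AB I mult_u by simp
  then have "{t. A \<in> bact t u} \<inter> {t. \<exists>k\<in>K. B \<in> bact t k} \<in> m"
    using mn AB(2) I I_betaT by (auto simp: mem_bmult betaT_Int N_def)
  then obtain t k where t: "A \<in> bact t u" "k \<in> K" "B \<in> bact t k" using betaT_nonempty_mem I I_betaT by blast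
  then have kG: "k \<in> G" using K by auto
  have "(bact t u, bact t u \<odot> k) \<in> W"
    using t kG AB(3) I_act uI u_mult G_I by (simp flip: bact_bmult)
  then show "\<exists>k\<in>K. hits W k" using t(2) I_act uI hitsI by blast
next
  assume R: "m \<in> I \<and> n \<in> I \<and> (\<forall>W. openin JJ W \<and> (m, n) \<in> W \<longrightarrow> (\<exists>k\<in>K. hits W k))"
  have "{t. \<exists>k\<in>K. A \<in> bact t k} \<in> m" if A: "A \<in> n" for A
  proof (rule ccontr)
    let ?E = "{t. \<exists>k\<in>K. A \<in> bact t k}"
    assume "?E \<notin> m"
    then have "- ?E \<in> m" using R I_betaT betaT_Compl by blast
    \<comment> \<open>Lying outside \<open>?E\<close> is an open condition on the first coordinate.
      A graph point satisfying it, with \<open>A\<close> in the second coordinate, produces a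
      \<open>t\<close> both inside and outside \<open>?E\<close>.\<close>
    then have "(m, n) \<in> {(m, n). m \<in> I \<and> n \<in> I \<and> - ?E \<in> m \<and> A \<in> n}" using R A by auto
    then obtain k where k: "k \<in> K" "hits {(m, n). m \<in> I \<and> n \<in> I \<and> - ?E \<in> m \<and> A \<in> n} k"
      using R openin_JJ_basic by blast
    then obtain x where x: "x \<in> I" "- ?E \<in> x" "A \<in> x \<odot> k" by (auto simp: hits_def)
    then have "- ?E \<inter> {t. A \<in> bact t k} \<in> x" using I_betaT by (simp add: betaT_Int mem_bmult)
    then show False using k(1) betaT_nonempty_mem[OF I_betaT[OF x(1)]] by blast
  qed
  then show "(m, n) \<in> N K" using R by (auto simp: N_def)
qed

lemma N_eq_closure: assumes "K \<subseteq> G" shows "N K = JJ closure_of {(m, m \<odot> g) | m g. m \<in> I \<and> g \<in> K}"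
proof -
  have "(m, n) \<in> N K \<longleftrightarrow> (m, n) \<in> JJ closure_of {(m, m \<odot> g) | m g. m \<in> I \<and> g \<in> K}" for m n
    unfolding N_iff[OF assms] in_closure_of hits_def by (simp add: conj_assoc) (rule conj_cong refl all_cong1 | blast)+
  then show ?thesis by auto
qed

lemma closedin_N: "K \<subseteq> G \<Longrightarrow> closedin JJ (N K)"
  by (simp add: N_eq_closure)

lemma N_minimal:
  assumes "K \<subseteq> G" "closedin JJ R" "\<And>m g. m \<in> I \<Longrightarrow> g \<in> K \<Longrightarrow> (m, m \<odot> g) \<in> R"
  shows "N K \<subseteq> R"
  unfolding N_eq_closure[OF assms(1)] by (rule closure_of_minimal) (use assms in auto)

lemma N_graph: "K \<subseteq> G \<Longrightarrow> m \<in> I \<Longrightarrow> g \<in> K \<Longrightarrow> (m, m \<odot> g) \<in> N K"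
  unfolding N_iff using I_mult' G_I hitsI by blast

lemma N_mono: "K \<subseteq> L \<Longrightarrow> N K \<subseteq> N L"
proof
  fix z assume KL: "K \<subseteq> L" and "z \<in> N K"
  then obtain m n where z: "z = (m, n)" "m \<in> I" "n \<in> I" "\<forall>A\<in>n. {t. \<exists>k\<in>K. A \<in> bact t k} \<in> m"
    by (auto simp: N_def)
  have "{t. \<exists>k\<in>L. A \<in> bact t k} \<in> m" if "A \<in> n" for A
    by (rule betaT_mono[OF I_betaT[OF z(2)], of "{t. \<exists>k\<in>K. A \<in> bact t k}"]) (use z(4) that KL in auto)
  then show "z \<in> N L" using z by (auto simp: N_def)
qed

lemma N_act: assumes K: "K \<subseteq> G" and mn: "(m, n) \<in> N K" shows "(bact t m, bact t n) \<in> N K"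
  unfolding N_iff[OF K]
proof (intro conjI allI impI)
  show "bact t m \<in> I" "bact t n \<in> I" using mn I_act by (auto simp: N_def)
  fix W assume W: "openin JJ W \<and> (bact t m, bact t n) \<in> W"
  let ?W = "{(m, n). m \<in> I \<and> n \<in> I \<and> (bact t m, bact t n) \<in> W}"
  have "(m, n) \<in> ?W" using mn W by (auto simp: N_def)
  then obtain k where k: "k \<in> K" "hits ?W k" using mn W openin_JJ_act unfolding N_iff[OF K] by blast
  then have "hits W k" unfolding hits_def using I_act by (auto simp: bact_bmult)
  then show "\<exists>k\<in>K. hits W k" using k by blast
qed

text \<open>The graphs near \<open>(m, n)\<close> and near \<open>(n, q)\<close> pass through
  different points close to \<open>n\<close>, so they cannot be composed directly. The defining
  formula helps: \<open>?E \<in> n\<close> is an open condition on \<open>n\<close> that already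
  encodes the second step, and it survives when \<open>(m, n)\<close> is replaced by a nearby graph
  point \<open>(x, x k)\<close>.\<close>

lemma N_trans:
  assumes K: "subgrp K" and 1: "(m, n) \<in> N K" and 2: "(n, q) \<in> N K"
  shows "(m, q) \<in> N K"
proof -
  have KG: "K \<subseteq> G" using K by (simp add: subgrp_def)
  have I: "m \<in> I" "n \<in> I" "q \<in> I" using 1 2 by (auto simp: N_def)
  show ?thesis
    unfolding N_iff[OF KG]
  proof (intro conjI allI impI I)
    fix W assume W: "openin JJ W \<and> (m, q) \<in> W"
    then obtain A B where AB: "A \<in> m" "B \<in> q"
      "\<And>x y. x \<in> I \<Longrightarrow> y \<in> I \<Longrightarrow> A \<in> x \<Longrightarrow> B \<in> y \<Longrightarrow> (x, y) \<in> W"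
      using openin_JJ_D by metis
    let ?E = "{t. \<exists>k\<in>K. B \<in> bact t k}"
    let ?V = "{(m, n). m \<in> I \<and> n \<in> I \<and> A \<in> m \<and> ?E \<in> n}"
    have "?E \<in> n" using 2 AB(2) by (auto simp: N_def)
    then have "(m, n) \<in> ?V" using I AB by auto
    then obtain k where k: "k \<in> K" "hits ?V k" using 1 openin_JJ_basic unfolding N_iff[OF KG] by blast
    then obtain x where x: "x \<in> I" "A \<in> x" "?E \<in> x \<odot> k" by (auto simp: hits_def)
    have kG: "k \<in> G" using k KG by auto
    have xk: "x \<odot> k \<in> I" using x kG by (simp add: I_mult' G_I)
    \<comment> \<open>Seen from \<open>x k\<close>, the point \<open>x\<close> is
      \<open>x k (iv k)\<close>; so a single \<open>s\<close> chosen by the ultrafilter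
      \<open>x k\<close> controls both coordinates, through \<open>s (iv k)\<close> and
      \<open>s l\<close>.\<close>
    have "A \<in> x \<odot> k \<odot> iv k" using x kG by (simp add: iv_cancel)
    then have "{s. A \<in> bact s (iv k)} \<inter> ?E \<in> x \<odot> k"
      using x(3) unfolding betaT_Int[OF I_betaT[OF xk]] mem_bmult[of A "x \<odot> k" "iv k"] by simp
    then obtain s l where s: "A \<in> bact s (iv k)" "l \<in> K" "B \<in> bact s l"
      using betaT_nonempty_mem[OF I_betaT[OF xk]] by blast
    have lG: "l \<in> G" using s KG by auto
    have "(bact s (iv k), bact s (iv k) \<odot> (k \<odot> l)) \<in> W"
      using AB(3) s kG lG by (simp add: I_act G_I iv_G iv_cancel_left flip: bact_bmult)
    moreover have "bact s (iv k) \<in> I" using kG by (simp add: I_act G_I iv_G)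
    ultimately have "hits W (k \<odot> l)" by (rule hitsI[rotated])
    then show "\<exists>k\<in>K. hits W k" using K k(1) s(2) subgrpD(4) by blast
  qed
qed

text \<open>Interchanging the coordinates turns the graph of \<open>k\<close> into the graph of
  \<open>iv k\<close>.\<close>

lemma N_sym:
  assumes K: "subgrp K" and 1: "(m, n) \<in> N K" shows "(n, m) \<in> N K"
proof -
  have KG: "K \<subseteq> G" using K by (simp add: subgrp_def)
  show ?thesis
    unfolding N_iff[OF KG]
  proof (intro conjI allI impI)
    show "m \<in> I" "n \<in> I" using 1 by (auto simp: N_def)
    fix W assume W: "openin JJ W \<and> (n, m) \<in> W"
    then have "openin JJ {(m, n). (n, m) \<in> W}" "(m, n) \<in> {(m, n). (n, m) \<in> W}"
      using openin_JJ_swap by auto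
    then obtain k where k: "k \<in> K" "hits {(m, n). (n, m) \<in> W} k" using 1 unfolding N_iff[OF KG] by blast
    then obtain x where x: "x \<in> I" "(x \<odot> k, x) \<in> W" by (auto simp: hits_def)
    have kG: "k \<in> G" using k KG by auto
    have "hits W (iv k)"
      by (rule hitsI[of "x \<odot> k"]) (use x kG in \<open>auto simp: iv_cancel I_mult' G_I\<close>)
    then show "\<exists>k\<in>K. hits W k" using k(1) K subgrpD(5) by blast
  qed
qed

lemma icer_N: assumes K: "subgrp K" shows "icer (N K)"
proof -
  have KG: "K \<subseteq> G" using K by (simp add: subgrp_def)
  have "(m, m) \<in> N K" if "m \<in> I" for m
    using N_graph[OF KG that subgrpD(3)[OF K]] mult_u that by simp
  then show ?thesis
    unfolding icer_def using closedin_N[OF KG] N_act[OF KG]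
    by (intro conjI ballI symI transI allI impI) (blast intro: N_sym[OF K] N_trans[OF K])+
qed

text \<open>\<open>grp (N K)\<close> is the \<open>\<tau>\<close>-closure of \<open>K\<close>.\<close>

definition tcl where "tcl K \<longleftrightarrow> subgrp K \<and> grp (N K) \<subseteq> K"

lemma tclD: "tcl K \<Longrightarrow> subgrp K" "tcl K \<Longrightarrow> (m, n) \<in> N K \<Longrightarrow> prt m n \<in> K"
  using icer_prt[OF icer_N] by (auto simp: tcl_def)

lemma N_grp_subset: assumes "icer R" shows "N (grp R) \<subseteq> R"
  by (rule N_minimal) (use assms icer_graph icer_closed in \<open>auto simp: grp_def\<close>)

lemma tcl_grp: assumes "icer R" shows "tcl (grp R)"
  unfolding tcl_def using subgrp_grp[OF assms] N_grp_subset[OF assms] by (auto simp: grp_def)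

end

text \<open>A composition of relations is the projection of a closed set of triples, and continuous
  maps from compact to Hausdorff spaces are closed.\<close>

lemma closedin_relcomp:
  assumes R: "closedin (prod_topology X Y) R" and S: "closedin (prod_topology Y Z) S"
    and cpt: "compact_space X" "compact_space Y" "compact_space Z"
    and haus: "Hausdorff_space X" "Hausdorff_space Z"
  shows "closedin (prod_topology X Z) (R O S)"
proof -
  let ?P = "prod_topology X (prod_topology Y Z)"
  have c: "compact_space ?P" using cpt by (simp add: compact_space_prod_topology)
  have h: "Hausdorff_space (prod_topology X Z)" using haus by (simp add: Hausdorff_space_prod_topology)
  have f1: "continuous_map ?P (prod_topology X Y) (\<lambda>w. (fst w, fst (snd w)))"
    by (simp add: continuous_map_paired continuous_map_fst continuous_map_fst_of[unfolded o_def] continuous_map_snd continuous_map_compose[OF continuous_map_snd continuous_map_fst, unfolded o_def])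
  have f2: "continuous_map ?P (prod_topology X Z) (\<lambda>w. (fst w, snd (snd w)))"
    by (simp add: continuous_map_paired continuous_map_fst continuous_map_compose[OF continuous_map_snd continuous_map_snd, unfolded o_def])
  let ?C = "{w \<in> topspace ?P. (fst w, fst (snd w)) \<in> R} \<inter> {w \<in> topspace ?P. snd w \<in> S}"
  have "closedin ?P ?C"
    by (intro closedin_Int closedin_continuous_map_preimage[OF f1 R]
        closedin_continuous_map_preimage[OF continuous_map_snd S])
  then have "closedin (prod_topology X Z) ((\<lambda>w. (fst w, snd (snd w))) ` ?C)"
    using continuous_imp_closed_map[OF f2 c h] by (simp add: closed_map_def)
  moreover have "(\<lambda>w. (fst w, snd (snd w))) ` ?C = R O S"
  proof (intro equalityI subsetI)
    fix z assume "z \<in> R O S"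
    then obtain x y v where z: "z = (x, v)" "(x, y) \<in> R" "(y, v) \<in> S" by auto
    then have "(x, (y, v)) \<in> ?C" using closedin_subset[OF R] closedin_subset[OF S] by auto
    then show "z \<in> (\<lambda>w. (fst w, snd (snd w))) ` ?C" using z(1) by force
  qed auto
  ultimately show ?thesis by simp
qed

context ellis_group begin

section \<open>The derived group and the regionally proximal relation\<close>

text \<open>\<open>nonsep K g h\<close>: a net in \<open>K\<close> \<open>\<tau>\<close>-converges to both \<open>g\<close> and \<open>h\<close>; so \<open>derv K\<close> is the derived group \<open>K'\<close>.\<close>

definition nonsep where "nonsep K g h \<longleftrightarrow>
  (\<forall>V W. openin JJ V \<longrightarrow> openin JJ W \<longrightarrow> hits V g \<longrightarrow> hits W h \<longrightarrow> (\<exists>k\<in>K. hits V k \<and> hits W k))"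

definition derv where "derv K = {g \<in> K. nonsep K g u}"

lemma nonsepD: "nonsep K g h \<Longrightarrow> openin JJ V \<Longrightarrow> openin JJ W \<Longrightarrow> hits V g \<Longrightarrow> hits W h \<Longrightarrow> \<exists>k\<in>K. hits V k \<and> hits W k"
  by (simp add: nonsep_def)

lemma nonsep_refl: "g \<in> K \<Longrightarrow> nonsep K g g" by (auto simp: nonsep_def)
lemma nonsep_sym: "nonsep K g h \<Longrightarrow> nonsep K h g" unfolding nonsep_def by metis

text \<open>Pulling a test set back along \<open>(x, y) \<mapsto> (x (iv c), y d)\<close> has the
  effect \<open>k \<mapsto> c k d\<close> on the group; the substitution is \<open>x = m c\<close>.
  This is how continuity of translations enters.\<close>

lemma hits_translate:
  assumes "c \<in> G" "d \<in> G" "k \<in> G"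
  shows "hits {(x, y). x \<in> I \<and> y \<in> I \<and> (x \<odot> iv c, y \<odot> d) \<in> W} k \<longleftrightarrow> hits W (c \<odot> k \<odot> d)"
proof
  assume "hits {(x, y). x \<in> I \<and> y \<in> I \<and> (x \<odot> iv c, y \<odot> d) \<in> W} k"
  then obtain x where x: "x \<in> I" "(x \<odot> iv c, x \<odot> k \<odot> d) \<in> W" by (auto simp: hits_def)
  have "x \<odot> iv c \<odot> (c \<odot> k \<odot> d) = x \<odot> iv c \<odot> c \<odot> k \<odot> d" by (simp add: bmult_assoc)
  also have "\<dots> = x \<odot> k \<odot> d" using x assms by (simp add: iv_cancel)
  finally show "hits W (c \<odot> k \<odot> d)"
    using x assms by (intro hitsI[of "x \<odot> iv c"]) (auto simp: I_mult' G_I iv_G)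
next
  assume "hits W (c \<odot> k \<odot> d)"
  then obtain m where m: "m \<in> I" "(m, m \<odot> (c \<odot> k \<odot> d)) \<in> W" by (auto simp: hits_def)
  then have "(m \<odot> c \<odot> iv c, m \<odot> c \<odot> k \<odot> d) \<in> W" using assms by (simp add: iv_cancel) (simp add: bmult_assoc)
  then show "hits {(x, y). x \<in> I \<and> y \<in> I \<and> (x \<odot> iv c, y \<odot> d) \<in> W} k"
    using m assms by (intro hitsI[of "m \<odot> c"]) (auto simp: I_mult' G_I)
qed

lemma nonsep_translate:
  assumes gh: "nonsep K g h" "g \<in> G" "h \<in> G" and K: "K \<subseteq> G" and cd: "c \<in> G" "d \<in> G"
    and KL: "\<And>k. k \<in> K \<Longrightarrow> c \<odot> k \<odot> d \<in> L"
  shows "nonsep L (c \<odot> g \<odot> d) (c \<odot> h \<odot> d)"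
  unfolding nonsep_def
proof (intro allI impI)
  fix V W assume VW: "openin JJ V" "openin JJ W" "hits V (c \<odot> g \<odot> d)" "hits W (c \<odot> h \<odot> d)"
  let ?T = "\<lambda>W. {(x, y). x \<in> I \<and> y \<in> I \<and> (x \<odot> iv c, y \<odot> d) \<in> W}"
  have o: "openin JJ (?T V)" "openin JJ (?T W)"
    using VW cd by (auto intro!: openin_JJ_rmult simp: G_I iv_G)
  have "hits (?T V) g" "hits (?T W) h" using VW hits_translate cd gh by auto
  then obtain k where "k \<in> K" "hits (?T V) k" "hits (?T W) k" using nonsepD[OF gh(1) o] by blast
  then show "\<exists>k\<in>L. hits V k \<and> hits W k"
    using hits_translate cd K KL by (intro bexI[of _ "c \<odot> k \<odot> d"]) auto
qed

lemma nonsep_left: assumes K: "subgrp K" and "nonsep K g h" "g \<in> K" "h \<in> K" "c \<in> K"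
  shows "nonsep K (c \<odot> g) (c \<odot> h)"
proof -
  have "nonsep K (c \<odot> g \<odot> u) (c \<odot> h \<odot> u)"
    by (rule nonsep_translate[OF assms(2)]) (use assms subgrpD[OF K] in \<open>auto simp: u_G\<close>)
  then show ?thesis using assms subgrpD[OF K] by (simp add: mult_u)
qed

text \<open>Inseparable elements lie in the closure of the same open sets: translating by \<open>y\<^sup>-\<^sup>1 x\<close> moves a
  neighbourhood of \<open>y\<close> to one of \<open>x\<close>, and by invariance each of its points is inseparable from its
  translate. This makes \<open>nonsep\<close> transitive.\<close>

lemma nonsep_closure:
  assumes K: "subgrp K" and xy: "nonsep K x y" "x \<in> K" "y \<in> K" and W: "openin JJ W"
    and x: "\<And>V. openin JJ V \<Longrightarrow> hits V x \<Longrightarrow> \<exists>k\<in>K. hits V k \<and> hits W k"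
    and V: "openin JJ V" "hits V y"
  shows "\<exists>k\<in>K. hits V k \<and> hits W k"
proof -
  define c where "c = iv y \<odot> x"
  note KG = subgrpD[OF K]
  have c: "c \<in> K" using xy KG by (simp add: c_def)
  have yc: "y \<odot> c = x" using xy KG by (simp add: c_def iv_cancel_left)
  let ?T = "{(a, b). a \<in> I \<and> b \<in> I \<and> (a \<odot> iv u, b \<odot> iv c) \<in> V}"
  have T: "openin JJ ?T" using V c KG by (auto intro!: openin_JJ_rmult)
  have ht: "hits ?T k \<longleftrightarrow> hits V (k \<odot> iv c)" if "k \<in> K" for k
    using hits_translate[of u "iv c" k V] that c KG by (simp add: u_mult u_G)
  have "x \<odot> iv c = y" using yc xy c KG by (metis iv_cancel(1))
  then have "hits ?T x" using ht[OF xy(2)] V(2) by simp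
  then obtain k where k: "k \<in> K" "hits ?T k" "hits W k" using x[OF T] by blast
  define v where "v = k \<odot> iv c"
  have v: "v \<in> K" "hits V v" using k ht c KG by (simp_all add: v_def)
  have "nonsep K (v \<odot> iv y \<odot> x) (v \<odot> iv y \<odot> y)"
    by (rule nonsep_left[OF K xy]) (use v xy KG in auto)
  moreover have "v \<odot> iv y \<odot> x = k" using k c KG by (simp add: v_def bmult_assoc c_def[symmetric] iv_left mult_u)
  moreover have "v \<odot> iv y \<odot> y = v" using v xy KG by (simp add: iv_cancel)
  ultimately have "nonsep K k v" by simp
  then show ?thesis using nonsepD[OF _ W V(1) k(3) v(2)] by blast
qed

lemma nonsep_trans:
  assumes K: "subgrp K" and xy: "nonsep K x y" and yz: "nonsep K y z" and "x \<in> K" "y \<in> K" "z \<in> K"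
  shows "nonsep K x z"
  unfolding nonsep_def
proof (intro allI impI)
  fix V W assume VW: "openin JJ V" "openin JJ W" "hits V x" "hits W z"
  have "\<exists>k\<in>K. hits W k \<and> hits V k"
    by (rule nonsep_closure[OF K yz assms(5,6) VW(1)]) (use nonsepD[OF xy VW(1)] VW in blast)+
  then show "\<exists>k\<in>K. hits V k \<and> hits W k" by blast
qed

lemma derv_subset: "derv K \<subseteq> K" by (auto simp: derv_def)

lemma nonsep_imp_derv:
  assumes K: "subgrp K" and "nonsep K x y" "x \<in> K" "y \<in> K"
  shows "iv y \<odot> x \<in> derv K"
  using nonsep_left[OF assms, of "iv y"] assms subgrpD[OF K] by (simp add: derv_def iv_left)

lemma derv_imp_nonsep:
  assumes K: "subgrp K" and "y \<in> K" "c \<in> derv K"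
  shows "nonsep K (y \<odot> c) y"
  using nonsep_left[OF K, of c u y] assms subgrpD[OF K] by (simp add: derv_def mult_u)

lemma subgrp_derv: assumes K: "subgrp K" shows "subgrp (derv K)"
  unfolding subgrp_def
proof (intro conjI ballI)
  note KG = subgrpD[OF K]
  show "derv K \<subseteq> G" using derv_subset KG by blast
  show "u \<in> derv K" using KG by (simp add: derv_def nonsep_refl)
  show "g \<odot> h \<in> derv K" if "g \<in> derv K" "h \<in> derv K" for g h
    using that nonsep_trans[OF K derv_imp_nonsep[OF K, of g h], of u] KG by (auto simp: derv_def)
  show "iv g \<in> derv K" if "g \<in> derv K" for g
    using that nonsep_imp_derv[OF K nonsep_sym, of g u] KG by (auto simp: derv_def G_mult_u)
qed

text \<open>\<open>c\<close> is only required to normalise \<open>K\<close>, not to belong to it: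
  later the conjugating elements come from \<open>A\<close> and act on groups that need not contain
  them.\<close>

lemma derv_normal:
  assumes K: "subgrp K" and c: "c \<in> G" and cK: "\<And>k. k \<in> K \<Longrightarrow> c \<odot> k \<odot> iv c \<in> K" and g: "g \<in> derv K"
  shows "c \<odot> g \<odot> iv c \<in> derv K"
proof -
  have "nonsep K (c \<odot> g \<odot> iv c) (c \<odot> u \<odot> iv c)"
    by (rule nonsep_translate[of K]) (use g subgrpD[OF K] c cK in \<open>auto simp: derv_def u_G iv_G\<close>)
  moreover have "c \<odot> u \<odot> iv c = u" using c by (simp add: G_mult_u iv_right)
  ultimately show ?thesis using g cK by (auto simp: derv_def)
qed

lemma subgrp_normal: "subgrp K \<Longrightarrow> c \<in> K \<Longrightarrow> k \<in> K \<Longrightarrow> c \<odot> k \<odot> iv c \<in> K"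
  by (simp add: subgrpD(4,5))

text \<open>The right side tests neighbourhoods of the point \<open>(m, n)\<close> instead of open
  sets meeting the graph of \<open>prt m n\<close>. The two tests agree because the orbit of
  \<open>(m, n)\<close> accumulates at that graph, while \<open>(m, n)\<close> itself is a limit of
  graphs of \<open>K\<close>. The pointwise form is the one that passes to closures and
  translates.\<close>

lemma N_nonsep_iff:
  assumes K: "tcl K" and mn: "(m, n) \<in> N K" and y: "y \<in> K"
  shows "nonsep K (prt m n) y \<longleftrightarrow> (\<forall>W V. openin JJ W \<longrightarrow> (m, n) \<in> W \<longrightarrow> openin JJ V \<longrightarrow> hits V y
      \<longrightarrow> (\<exists>k\<in>K. hits V k \<and> hits W k))"
proof -
  have sK: "subgrp K" and KG: "K \<subseteq> G" using K by (auto simp: tcl_def subgrp_def)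
  have I: "m \<in> I" "n \<in> I" using mn by (auto simp: N_def)
  have p: "prt m n \<in> K" using tclD[OF K] mn by blast
  have mv: "hits V k" if "hits {(m, n). m \<in> I \<and> n \<in> I \<and> (bact t m, bact t n) \<in> V} k" for V k t
    using that I_act by (auto simp: hits_def bact_bmult)
  show ?thesis
  proof (intro iffI allI impI)
    fix W V assume ns: "nonsep K (prt m n) y"
      and W: "openin JJ W" "(m, n) \<in> W" and V: "openin JJ V" "hits V y"
    show "\<exists>k\<in>K. hits V k \<and> hits W k"
    proof (rule nonsep_closure[OF sK ns p y W(1) _ V])
      fix O' assume O': "openin JJ O'" "hits O' (prt m n)"
      then obtain t where t: "(bact t m, bact t n) \<in> O'" using prt_orbit I by metis
      let ?O = "{(m, n). m \<in> I \<and> n \<in> I \<and> (bact t m, bact t n) \<in> O'}"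
      have "openin JJ (W \<inter> ?O)" "(m, n) \<in> W \<inter> ?O" using W O' t I openin_JJ_act by auto
      then obtain k where k: "k \<in> K" "hits (W \<inter> ?O) k" using mn unfolding N_iff[OF KG] by blast
      then have "hits W k" "hits ?O k" by (auto simp: hits_def)
      then show "\<exists>k\<in>K. hits O' k \<and> hits W k" using k(1) mv by blast
    qed
  next
    assume R: "\<forall>W V. openin JJ W \<longrightarrow> (m, n) \<in> W \<longrightarrow> openin JJ V \<longrightarrow> hits V y \<longrightarrow> (\<exists>k\<in>K. hits V k \<and> hits W k)"
    show "nonsep K (prt m n) y"
      unfolding nonsep_def
    proof (intro allI impI)
      fix O' V assume O': "openin JJ O'" "openin JJ V" "hits O' (prt m n)" "hits V y"
      then obtain t where t: "(bact t m, bact t n) \<in> O'" using prt_orbit I by metis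
      let ?O = "{(m, n). m \<in> I \<and> n \<in> I \<and> (bact t m, bact t n) \<in> O'}"
      have "openin JJ ?O" "(m, n) \<in> ?O" using O' t I openin_JJ_act by auto
      then obtain k where "k \<in> K" "hits V k" "hits ?O k" using R O' by blast
      then show "\<exists>k\<in>K. hits O' k \<and> hits V k" using mv by blast
    qed
  qed
qed

text \<open>\<open>Q K\<close> is the regionally proximal relation of \<open>I \<rightarrow> I / N K\<close>.\<close>

definition Q where "Q K = {(m, n) \<in> N K. prt m n \<in> derv K}"

text \<open>By \<open>N_nonsep_iff\<close> membership is tested by neighbourhoods of
  \<open>(m, n)\<close>, and each of them contains a point of \<open>Q K\<close> when
  \<open>(m, n)\<close> is in the closure.\<close>

lemma closedin_Q: assumes K: "tcl K" shows "closedin JJ (Q K)"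
proof -
  have sK: "subgrp K" and KG: "K \<subseteq> G" using K by (auto simp: tcl_def subgrp_def)
  have uK: "u \<in> K" using subgrpD[OF sK] by auto
  have "JJ closure_of Q K \<subseteq> Q K"
  proof
    fix z assume z: "z \<in> JJ closure_of Q K"
    obtain m n where mn: "z = (m, n)" by force
    have "Q K \<subseteq> N K" by (auto simp: Q_def)
    then have zN: "(m, n) \<in> N K" using z closure_of_minimal[OF _ closedin_N[OF KG]] mn by blast
    have "nonsep K (prt m n) u"
      unfolding N_nonsep_iff[OF K zN uK]
    proof (intro allI impI)
      fix W V assume W: "openin JJ W" "(m, n) \<in> W" and V: "openin JJ V" "hits V u"
      then obtain a b where ab: "(a, b) \<in> Q K" "(a, b) \<in> W" using z mn in_closure_of by (metis surj_pair)
      then have "nonsep K (prt a b) u" "(a, b) \<in> N K" by (auto simp: Q_def derv_def)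
      then show "\<exists>k\<in>K. hits V k \<and> hits W k" using N_nonsep_iff[OF K _ uK] W V ab by blast
    qed
    then show "z \<in> Q K" using zN mn tclD[OF K] by (auto simp: Q_def derv_def)
  qed
  moreover have "Q K \<subseteq> topspace JJ" by (auto simp: Q_def N_def)
  ultimately show ?thesis by (metis closure_of_subset closure_of_eq subset_antisym)
qed

lemma Q_act: assumes K: "tcl K" and mn: "(m, n) \<in> Q K" shows "(bact t m, bact t n) \<in> Q K"
proof -
  have sK: "subgrp K" and KG: "K \<subseteq> G" using K by (auto simp: tcl_def subgrp_def)
  have uK: "u \<in> K" using subgrpD[OF sK] by auto
  have mnN: "(m, n) \<in> N K" "nonsep K (prt m n) u" using mn by (auto simp: Q_def derv_def)
  have tN: "(bact t m, bact t n) \<in> N K" by (rule N_act[OF KG mnN(1)])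
  have I: "m \<in> I" "n \<in> I" using mnN by (auto simp: N_def)
  have "nonsep K (prt (bact t m) (bact t n)) u"
    unfolding N_nonsep_iff[OF K tN uK]
  proof (intro allI impI)
    fix W V assume W: "openin JJ W" "(bact t m, bact t n) \<in> W" and V: "openin JJ V" "hits V u"
    let ?W = "{(m, n). m \<in> I \<and> n \<in> I \<and> (bact t m, bact t n) \<in> W}"
    have "openin JJ ?W" "(m, n) \<in> ?W" using W I openin_JJ_act by auto
    then obtain k where "k \<in> K" "hits V k" "hits ?W k"
      using mnN(2) V unfolding N_nonsep_iff[OF K mnN(1) uK] by blast
    moreover have "hits W k" using \<open>hits ?W k\<close> I_act by (auto simp: hits_def bact_bmult)
    ultimately show "\<exists>k\<in>K. hits V k \<and> hits W k" by blast
  qed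
  then show ?thesis using tN tclD[OF K] by (auto simp: Q_def derv_def)
qed

lemma closedin_JJ_relcomp: "closedin JJ R \<Longrightarrow> closedin JJ S \<Longrightarrow> closedin JJ (R O S)"
  by (rule closedin_relcomp) (auto simp: compact_J Hausdorff_J)

text \<open>For \<open>derv K \<subseteq> B \<subseteq> K\<close>, \<open>I / E K B\<close> is the almost periodic extension of \<open>I / N K\<close> with group \<open>B\<close>.\<close>

definition E where "E K B = {(m, n) \<in> N K. prt m n \<in> B}"

text \<open>Moving \<open>n\<close> by the inverse of \<open>prt m n\<close> makes the group part
  trivial, so the new pair is in \<open>Q K\<close>; the way back to \<open>n\<close> lies on a
  graph of \<open>B\<close>. As a composition of closed invariant relations, \<open>E K B\<close> is
  then closed and invariant.\<close>

lemma E_eq: assumes K: "tcl K" and B: "tcl B" "derv K \<subseteq> B" "B \<subseteq> K"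
  shows "E K B = Q K O N B"
proof -
  have sK: "subgrp K" and KG: "K \<subseteq> G" and sB: "subgrp B" and BG: "B \<subseteq> G"
    using K B by (auto simp: tcl_def subgrp_def)
  show ?thesis
  proof (intro equalityI subrelI)
    fix m n assume mn: "(m, n) \<in> E K B"
    then have N: "(m, n) \<in> N K" "prt m n \<in> B" and I: "m \<in> I" "n \<in> I" by (auto simp: E_def N_def)
    let ?b = "prt m n"
    have bG: "?b \<in> G" "iv ?b \<in> B" "iv ?b \<in> K" "iv ?b \<in> G" using N subgrpD[OF sB] B(3) by auto
    let ?q = "n \<odot> iv ?b"
    have q: "?q \<in> I" using I bG by (simp add: I_mult' G_I)
    have "(n, ?q) \<in> N K" using N_graph[OF KG I(2) bG(3)] .
    then have 1: "(m, ?q) \<in> N K" using N_trans[OF sK N(1)] by blast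
    have "prt m ?q = ?b \<odot> iv ?b" using prt_trans[OF I q] prt_mult[OF I(2) bG(4)] by simp
    then have "prt m ?q = u" using bG by (simp add: iv_right)
    then have "(m, ?q) \<in> Q K" using 1 subgrpD[OF subgrp_derv[OF sK]] by (auto simp: Q_def)
    moreover have "(?q, n) \<in> N B" using N_sym[OF sB N_graph[OF BG I(2) bG(2)]] .
    ultimately show "(m, n) \<in> Q K O N B" by blast
  next
    fix m q assume "(m, q) \<in> Q K O N B"
    then obtain n where n: "(m, n) \<in> Q K" "(n, q) \<in> N B" by blast
    then have I: "m \<in> I" "n \<in> I" "q \<in> I" by (auto simp: Q_def N_def)
    have "(m, q) \<in> N K" using n N_mono[OF B(3)] N_trans[OF sK] by (auto simp: Q_def)
    moreover have "prt m n \<in> B" "prt n q \<in> B" using n B(2) tclD[OF B(1)] by (auto simp: Q_def)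
    ultimately show "(m, q) \<in> E K B"
      using prt_trans[OF I] subgrpD(4)[OF sB, of "prt m n" "prt n q"] by (simp add: E_def)
  qed
qed

lemma icer_E: assumes K: "tcl K" and B: "tcl B" "derv K \<subseteq> B" "B \<subseteq> K"
  shows "icer (E K B)"
  unfolding icer_def
proof (intro conjI allI impI ballI symI transI)
  have sK: "subgrp K" and KG: "K \<subseteq> G" and sB: "subgrp B" and BG: "B \<subseteq> G"
    using K B by (auto simp: tcl_def subgrp_def)
  note iN = icer_N[OF sK]
  show "closedin JJ (E K B)"
    unfolding E_eq[OF assms] by (intro closedin_JJ_relcomp closedin_Q closedin_N K BG)
  show "(m, m) \<in> E K B" if m: "m \<in> I" for m
    using prt_mult[OF m u_G] mult_u[OF m] icer_refl[OF iN m] subgrpD[OF sB] by (simp add: E_def)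
  show "(n, m) \<in> E K B" if mn: "(m, n) \<in> E K B" for m n
  proof -
    have I: "m \<in> I" "n \<in> I" "(m, n) \<in> N K" "prt m n \<in> B" using mn by (auto simp: E_def N_def)
    have "prt m n \<odot> prt n m = u" using prt_trans[of m n m] I prt_mult[OF I(1) u_G] mult_u by simp
    then have "iv (prt m n) \<odot> u = prt n m" using iv_cancel_left(1)[OF prt_G prt_G] I by metis
    then have "prt n m \<in> B" using I subgrpD[OF sB] by metis
    then show ?thesis using icer_sym[OF iN] I by (simp add: E_def)
  qed
  show "(m, q) \<in> E K B" if "(m, n) \<in> E K B" "(n, q) \<in> E K B" for m n q
  proof -
    have I: "m \<in> I" "n \<in> I" "q \<in> I" using that by (auto simp: E_def N_def)
    show ?thesis
      using that icer_trans[OF iN, of m n q] prt_trans[OF I] subgrpD(4)[OF sB, of "prt m n" "prt n q"]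
      by (simp add: E_def)
  qed
  show "(bact t m, bact t n) \<in> E K B" if "(m, n) \<in> E K B" for t m n
    using that Q_act[OF K] N_act[OF BG] unfolding E_eq[OF assms] by blast
qed

lemma grp_E: assumes K: "tcl K" and B: "B \<subseteq> K" shows "grp (E K B) = B"
proof -
  have sK: "subgrp K" and KG: "K \<subseteq> G" using K by (auto simp: tcl_def subgrp_def)
  have "(u, g) \<in> N K" if "g \<in> K" for g using N_graph[OF KG uI that] that KG by (simp add: u_mult subset_iff)
  then show ?thesis using B KG prt_u by (auto simp: grp_def E_def)
qed

text \<open>The graphs of the derived group lie in the closed relation \<open>Q K\<close>, hence so
  does their closure, and a pair \<open>(u, g)\<close> of \<open>Q K\<close> with \<open>g\<close>
  in \<open>G\<close> has \<open>g\<close> in the derived group.\<close>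

lemma tcl_derv: assumes K: "tcl K" shows "tcl (derv K)"
proof -
  have sK: "subgrp K" and KG: "K \<subseteq> G" using K by (auto simp: tcl_def subgrp_def)
  have "N (derv K) \<subseteq> Q K"
  proof (rule N_minimal[OF _ closedin_Q[OF K]])
    show "(m, m \<odot> g) \<in> Q K" if m: "m \<in> I" and g: "g \<in> derv K" for m g
    proof -
      have gK: "g \<in> K" "g \<in> G" using g KG by (auto simp: derv_def)
      then show ?thesis using N_graph[OF KG m gK(1)] prt_mult[OF m gK(2)] g by (simp add: Q_def)
    qed
    show "derv K \<subseteq> G" using KG by (auto simp: derv_def)
  qed
  then show ?thesis using subgrp_derv[OF sK] prt_u by (auto simp: tcl_def grp_def Q_def)
qed

section \<open>Products of \<tau>-closed groups and supplements of a subgroup\<close>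

definition gprod where "gprod A B = {a \<odot> b | a b. a \<in> A \<and> b \<in> B}"

lemma gprodI: "a \<in> A \<Longrightarrow> b \<in> B \<Longrightarrow> a \<odot> b \<in> gprod A B"
  by (auto simp: gprod_def)

lemma gprod_commute:
  assumes A: "subgrp A" and L: "subgrp L" and AL: "\<And>a l. a \<in> A \<Longrightarrow> l \<in> L \<Longrightarrow> a \<odot> l \<odot> iv a \<in> L"
  shows "gprod A L = gprod L A"
proof (intro equalityI subsetI)
  note A' = subgrpD[OF A] and L' = subgrpD[OF L]
  show "x \<in> gprod L A" if x: "x \<in> gprod A L" for x
  proof -
    obtain a l where al: "x = a \<odot> l" "a \<in> A" "l \<in> L" using x by (auto simp: gprod_def)
    have "x = (a \<odot> l \<odot> iv a) \<odot> a" using al A' L' G_I G_mult iv_cancel(2) by simp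
    then show ?thesis using AL[OF al(2,3)] al(2) unfolding gprod_def by blast
  qed
  show "x \<in> gprod A L" if x: "x \<in> gprod L A" for x
  proof -
    obtain a l where al: "x = l \<odot> a" "a \<in> A" "l \<in> L" using x by (auto simp: gprod_def)
    have i: "iv (iv a) = a" using al A' by (simp add: iv_iv)
    have "x = a \<odot> (iv a \<odot> l \<odot> iv (iv a))"
      unfolding i using al A' L' by (simp add: bmult_assoc) (simp add: iv_cancel_left G_mult)
    moreover have "iv a \<odot> l \<odot> iv (iv a) \<in> L" using al AL A'(5) by blast
    ultimately show ?thesis using al by (auto simp: gprod_def)
  qed
qed

lemma subgrp_gprod:
  assumes A: "subgrp A" and L: "subgrp L" and AL: "gprod A L = gprod L A"
  shows "subgrp (gprod A L)"
proof -
  note A' = subgrpD[OF A] and L' = subgrpD[OF L]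
  have mult: "x \<odot> y \<in> gprod A L" if "x \<in> gprod A L" "y \<in> gprod A L" for x y
  proof -
    obtain a l where x: "x = a \<odot> l" "a \<in> A" "l \<in> L" using \<open>x \<in> gprod A L\<close> by (auto simp: gprod_def)
    obtain b k where y: "y = b \<odot> k" "b \<in> A" "k \<in> L" using \<open>y \<in> gprod A L\<close> by (auto simp: gprod_def)
    have "l \<odot> b \<in> gprod A L" using x y unfolding AL by (auto simp: gprod_def)
    then obtain c d where cd: "l \<odot> b = c \<odot> d" "c \<in> A" "d \<in> L" by (auto simp: gprod_def)
    have "x \<odot> y = a \<odot> (l \<odot> b) \<odot> k" using x y by (simp add: bmult_assoc)
    also have "\<dots> = (a \<odot> c) \<odot> (d \<odot> k)" using cd by (simp add: bmult_assoc)
    finally have "x \<odot> y = (a \<odot> c) \<odot> (d \<odot> k)" .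
    moreover have "a \<odot> c \<in> A" "d \<odot> k \<in> L" using x y cd A'(4) L'(4) by auto
    ultimately show ?thesis by (auto simp: gprod_def)
  qed
  have inv: "iv x \<in> gprod A L" if x0: "x \<in> gprod A L" for x
  proof -
    obtain a l where x: "x = a \<odot> l" "a \<in> A" "l \<in> L" using x0 by (auto simp: gprod_def)
    have G: "a \<in> G" "l \<in> G" "x \<in> G" using x A' L' G_mult by auto
    have "iv x = iv x \<odot> (x \<odot> (iv l \<odot> iv a))"
    proof -
      have "x \<odot> (iv l \<odot> iv a) = a \<odot> (l \<odot> (iv l \<odot> iv a))" by (simp add: x bmult_assoc)
      also have "\<dots> = u" using G by (simp add: iv_cancel_left iv_G iv_right)
      finally show ?thesis using G by (simp add: G_mult_u iv_G)
    qed
    also have "\<dots> = iv l \<odot> iv a" using G by (simp add: iv_cancel_left iv_G G_mult)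
    finally show ?thesis using gprodI[OF L'(5)[OF x(3)] A'(5)[OF x(2)]] AL by simp
  qed
  have "u \<odot> u \<in> gprod A L" using A'(3) L'(3) unfolding gprod_def by blast
  then have "u \<in> gprod A L" by (simp add: uu)
  moreover have "gprod A L \<subseteq> G" using A' L' by (auto simp: gprod_def G_mult)
  ultimately show ?thesis using mult inv by (auto simp: subgrp_def)
qed

text \<open>\<open>N A O N L\<close> is closed and contains the graphs of all products
  \<open>a l\<close>. The intermediate point of a pair \<open>(u, g)\<close> in it factors
  \<open>g\<close>, by the cocycle identity of \<open>prt\<close>.\<close>

lemma tcl_gprod:
  assumes A: "tcl A" and L: "tcl L" and AL: "gprod A L = gprod L A"
  shows "tcl (gprod A L)"
proof -
  have sA: "subgrp A" "A \<subseteq> G" and sL: "subgrp L" "L \<subseteq> G" using A L by (auto simp: tcl_def subgrp_def)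
  have s: "subgrp (gprod A L)" by (rule subgrp_gprod[OF sA(1) sL(1) AL])
  have "N (gprod A L) \<subseteq> N A O N L"
  proof (rule N_minimal)
    show "gprod A L \<subseteq> G" using s by (simp add: subgrp_def)
    show "closedin JJ (N A O N L)" by (intro closedin_JJ_relcomp closedin_N sA sL)
    fix m g assume m: "m \<in> I" and "g \<in> gprod A L"
    then obtain a l where g: "g = a \<odot> l" "a \<in> A" "l \<in> L" by (auto simp: gprod_def)
    have "m \<odot> a \<in> I" using m g sA G_I I_mult' by blast
    then have "(m \<odot> a, m \<odot> a \<odot> l) \<in> N L" using N_graph[OF sL(2)] g by blast
    then show "(m, m \<odot> g) \<in> N A O N L" using N_graph[OF sA(2) m g(2)] g(1) by (auto simp: bmult_assoc)
  qed
  moreover have "g \<in> gprod A L" if g: "g \<in> G" "(u, g) \<in> N A O N L" for g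
  proof -
    obtain n where n: "(u, n) \<in> N A" "(n, g) \<in> N L" using g by blast
    then have "prt u n \<in> A" "prt n g \<in> L" "n \<in> I" using tclD[OF A] tclD[OF L] by (auto simp: N_def)
    moreover have "g = prt u n \<odot> prt n g" using prt_trans[of u n g] uI G_I g prt_u \<open>n \<in> I\<close> by simp
    ultimately show ?thesis unfolding gprod_def by blast
  qed
  ultimately show ?thesis using s by (auto simp: tcl_def grp_def)
qed


abbreviation "JJJ \<equiv> prod_topology JJ JJ"

lemma tcl_Inter:
  assumes "\<D> \<noteq> {}" "\<And>L. L \<in> \<D> \<Longrightarrow> tcl L" shows "tcl (\<Inter>\<D>)"
proof -
  have s: "subgrp L" "grp (N L) \<subseteq> L" if "L \<in> \<D>" for L using assms(2) that by (auto simp: tcl_def)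
  obtain L0 where L0: "L0 \<in> \<D>" using assms(1) by blast
  have "subgrp (\<Inter>\<D>)"
    unfolding subgrp_def
  proof (intro conjI ballI)
    show "\<Inter>\<D> \<subseteq> G" using subgrpD(1)[OF s(1)[OF L0]] L0 by blast
  qed (use subgrpD[OF s(1)] in auto)
  moreover have "grp (N (\<Inter>\<D>)) \<subseteq> L" if "L \<in> \<D>" for L
    using N_mono[of "\<Inter>\<D>" L] s(2)[OF that] that by (auto simp: grp_def)
  ultimately show ?thesis by (auto simp: tcl_def)
qed

lemma closedin_section_right: assumes "closedin JJ R" "m \<in> I" shows "closedin J {n \<in> I. (m, n) \<in> R}"
  using closedin_continuous_map_preimage[OF _ assms(1), of J "\<lambda>n. (m, n)"] assms(2)
  by (simp add: continuous_map_paired)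

lemma closedin_section_left: assumes "closedin JJ R" "n \<in> I" shows "closedin J {m \<in> I. (m, n) \<in> R}"
  using closedin_continuous_map_preimage[OF _ assms(1), of J "\<lambda>m. (m, n)"] assms(2)
  by (simp add: continuous_map_paired)

text \<open>A factorisation \<open>k = l a\<close> is traded for an intermediate point
  \<open>n\<close> between \<open>u\<close> and \<open>k\<close>. The elements \<open>l\<close> have
  no evident limit along the chain, but the sets of admissible \<open>n\<close> are closed, nonempty
  and nested in a compact space; \<open>prt\<close> converts a common point back into a
  factorisation.\<close>

lemma chain_Inter_supplement:
  assumes A: "tcl A" and ne: "\<D> \<noteq> {}" and tcl: "\<And>L. L \<in> \<D> \<Longrightarrow> tcl L"
    and ch: "\<And>L M. L \<in> \<D> \<Longrightarrow> M \<in> \<D> \<Longrightarrow> L \<subseteq> M \<or> M \<subseteq> L"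
    and k: "k \<in> G" "\<And>L. L \<in> \<D> \<Longrightarrow> k \<in> gprod L A"
  shows "k \<in> gprod (\<Inter>\<D>) A"
proof -
  have sA: "subgrp A" "A \<subseteq> G" using A by (auto simp: tcl_def subgrp_def)
  have kI: "k \<in> I" using k(1) G_I by blast
  define S where "S L = {n \<in> I. (u, n) \<in> N L} \<inter> {n \<in> I. (n, k) \<in> N A}" for L
  have "\<Inter>(S ` \<D>) \<noteq> {}"
  proof (rule compact_chain_Inter_nonempty[OF compact_J])
    show "S ` \<D> \<noteq> {}" using ne by simp
    fix T assume "T \<in> S ` \<D>"
    then obtain L where L: "L \<in> \<D>" "T = S L" by blast
    have LG: "L \<subseteq> G" using tcl[OF L(1)] by (auto simp: tcl_def subgrp_def)
    obtain l a where la: "k = l \<odot> a" "l \<in> L" "a \<in> A" using k(2)[OF L(1)] by (auto simp: gprod_def)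
    have lG: "l \<in> G" "l \<in> I" using la LG G_I by auto
    have "(u, u \<odot> l) \<in> N L" by (rule N_graph[OF LG uI la(2)])
    moreover have "(l, l \<odot> a) \<in> N A" by (rule N_graph[OF sA(2) lG(2) la(3)])
    ultimately have "l \<in> S L" using la(1) lG u_mult by (auto simp: S_def)
    then show "closedin J T \<and> T \<noteq> {}"
      unfolding L(2) using closedin_Int[OF closedin_section_right closedin_section_left] closedin_N[OF LG]
        closedin_N[OF sA(2)] uI kI by (auto simp: S_def)
  next
    fix T T' assume "T \<in> S ` \<D>" "T' \<in> S ` \<D>"
    then obtain L L' where "L \<in> \<D>" "T = S L" "L' \<in> \<D>" "T' = S L'" by blast
    moreover have "S L \<subseteq> S L'" if "L \<subseteq> L'" for L L' using N_mono[OF that] by (auto simp: S_def)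
    ultimately show "T \<subseteq> T' \<or> T' \<subseteq> T" using ch by metis
  qed
  then obtain n where n: "\<And>L. L \<in> \<D> \<Longrightarrow> n \<in> S L" by blast
  obtain L0 where L0: "L0 \<in> \<D>" using ne by blast
  have nA: "n \<in> I" "(n, k) \<in> N A" using n[OF L0] by (auto simp: S_def)
  have "prt u n \<in> \<Inter>\<D>" using n tclD(2)[OF tcl] by (auto simp: S_def)
  moreover have "prt n k \<in> A" using tclD(2)[OF A nA(2)] .
  moreover have "prt u n \<odot> prt n k = k" using prt_trans[OF uI nA(1) kI] prt_u[OF k(1)] by simp
  ultimately show ?thesis using gprodI by metis
qed

text \<open>An element \<open>d\<close> of \<open>K\<close> close to both \<open>\<kappa>\<close>
  and \<open>u\<close> factors as \<open>l a\<close>, and its graph differs from that of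
  \<open>l\<close> only by \<open>N A\<close>. So pairs of points on a common graph of
  \<open>L\<close>, changed by \<open>N A\<close> on either side, approximate
  \<open>((u, \<kappa>), (u, u))\<close>. Compactness yields a limit pair, whose two group elements
  are inseparable in \<open>L\<close>.\<close>

lemma derv_supplement:
  assumes A: "tcl A" and L: "tcl L" and AL: "\<And>a l. a \<in> A \<Longrightarrow> l \<in> L \<Longrightarrow> a \<odot> l \<odot> iv a \<in> L"
    and K: "tcl K" "K \<subseteq> gprod L A" and \<kappa>: "\<kappa> \<in> derv K"
  shows "\<kappa> \<in> gprod (derv L) A"
proof -
  have sA: "subgrp A" "A \<subseteq> G" and sL: "subgrp L" "L \<subseteq> G" and sK: "subgrp K" "K \<subseteq> G"
    using A L K by (auto simp: tcl_def subgrp_def)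
  have ns: "nonsep K \<kappa> u" and kG: "\<kappa> \<in> G" using \<kappa> sK by (auto simp: derv_def)
  have kI: "\<kappa> \<in> I" using kG G_I by blast
  note iA = icer_N[OF sA(1)]
  \<comment> \<open>Both points lie on the graph of the same \<open>l\<close>; the closure
    \<open>P'\<close> retains this coincidence, which \<open>N L \<times> N L\<close>
    forgets.\<close>
  define P where "P = {((m, m \<odot> l), (m', m' \<odot> l)) | m m' l. m \<in> I \<and> m' \<in> I \<and> l \<in> L}"
  define R where "R = {((m, n), (x, y)). (m, x) \<in> N A \<and> (n, y) \<in> N A}"
  define P' where "P' = JJJ closure_of P"
  have PL: "P \<subseteq> N L \<times> N L" using N_graph[OF sL(2)] by (auto simp: P_def)
  have PT: "P \<subseteq> topspace JJJ" using sL(2) G_I by (auto simp: P_def I_mult')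
  have P'L: "P' \<subseteq> N L \<times> N L"
    unfolding P'_def by (rule closure_of_minimal[OF PL]) (simp add: closedin_prod_Times_iff closedin_N sL)
  have clR: "closedin JJJ R"
  proof -
    have "continuous_map JJJ JJ (\<lambda>w. (fst (fst w), fst (snd w)))"
      "continuous_map JJJ JJ (\<lambda>w. (snd (fst w), snd (snd w)))"
      by (auto simp: continuous_map_paired intro!: continuous_map_compose[OF continuous_map_fst continuous_map_fst, unfolded o_def]
         continuous_map_compose[OF continuous_map_snd continuous_map_fst, unfolded o_def]
         continuous_map_compose[OF continuous_map_fst continuous_map_snd, unfolded o_def]
         continuous_map_compose[OF continuous_map_snd continuous_map_snd, unfolded o_def])
    from this[THEN closedin_continuous_map_preimage, OF closedin_N[OF sA(2)]]
    have "closedin JJJ ({w \<in> topspace JJJ. (fst (fst w), fst (snd w)) \<in> N A} \<inter> {w \<in> topspace JJJ. (snd (fst w), snd (snd w)) \<in> N A})"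
      by (intro closedin_Int)
    moreover have "R = {w \<in> topspace JJJ. (fst (fst w), fst (snd w)) \<in> N A} \<inter> {w \<in> topspace JJJ. (snd (fst w), snd (snd w)) \<in> N A}"
      by (auto simp: R_def N_def)
    ultimately show ?thesis by simp
  qed
  have clT: "closedin JJJ (R O P' O R)"
    by (intro closedin_relcomp[where Y = JJ] clR compact_JJ Hausdorff_JJ) (simp add: P'_def)
  have "((u, \<kappa>), (u, u)) \<in> R O P' O R"
  proof (rule ccontr)
    assume "((u, \<kappa>), (u, u)) \<notin> R O P' O R"
    then have "((u, \<kappa>), (u, u)) \<in> topspace JJJ - R O P' O R" using uI kI by simp
    moreover have "openin JJJ (topspace JJJ - R O P' O R)" using clT by (simp add: closedin_def)
    ultimately obtain V W where VW: "openin JJ V" "openin JJ W" "(u, \<kappa>) \<in> V" "(u, u) \<in> W"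
      "V \<times> W \<subseteq> topspace JJJ - R O P' O R"
      unfolding openin_prod_topology_alt by metis
    have "hits V \<kappa>" "hits W u" using VW uI kG u_mult uu by (auto intro!: hitsI)
    then obtain d where d: "d \<in> K" "hits V d" "hits W d" using nonsepD[OF ns VW(1,2)] by blast
    then obtain m m' where m: "m \<in> I" "(m, m \<odot> d) \<in> V" "m' \<in> I" "(m', m' \<odot> d) \<in> W"
      by (auto simp: hits_def)
    have "d \<in> gprod L A" using d K by blast
    then obtain l a where la: "d = l \<odot> a" "l \<in> L" "a \<in> A" by (auto simp: gprod_def)
    have NA: "(x \<odot> l, x \<odot> d) \<in> N A" if "x \<in> I" for x
      using N_graph[OF sA(2) _ la(3), of "x \<odot> l"] la that sL(2) by (auto simp: bmult_assoc I_mult' G_I)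
    have "((m, m \<odot> d), (m, m \<odot> l)) \<in> R" "((m', m' \<odot> l), (m', m' \<odot> d)) \<in> R"
      using NA m icer_refl[OF iA] icer_sym[OF iA] by (auto simp: R_def)
    moreover have "((m, m \<odot> l), (m', m' \<odot> l)) \<in> P'"
      using closure_of_subset[OF PT] m la unfolding P'_def P_def by blast
    ultimately have "((m, m \<odot> d), (m', m' \<odot> d)) \<in> R O P' O R" by blast
    then show False using VW(5) m by blast
  qed
  then obtain m n m' n' where mn: "((u, \<kappa>), (m, n)) \<in> R" "((m, n), (m', n')) \<in> P'" "((m', n'), (u, u)) \<in> R"
    by (auto simp: relcomp_unfold)
  have NA: "(u, m) \<in> N A" "(n, \<kappa>) \<in> N A" "(m', u) \<in> N A" "(u, n') \<in> N A"
    using mn icer_sym[OF iA] by (auto simp: R_def)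
  have NL: "(m, n) \<in> N L" "(m', n') \<in> N L" using P'L mn(2) by auto
  have I: "m \<in> I" "n \<in> I" "m' \<in> I" "n' \<in> I" using NL by (auto simp: N_def)
  have "nonsep L (prt m n) (prt m' n')"
    unfolding nonsep_def
  proof (intro allI impI)
    fix V W assume VW: "openin JJ V" "openin JJ W" "hits V (prt m n)" "hits W (prt m' n')"
    obtain t where t: "(bact t m, bact t n) \<in> V" using prt_orbit VW I by metis
    obtain s where s: "(bact s m', bact s n') \<in> W" using prt_orbit VW I by metis
    let ?V = "{(m, n). m \<in> I \<and> n \<in> I \<and> (bact t m, bact t n) \<in> V}"
    let ?W = "{(m, n). m \<in> I \<and> n \<in> I \<and> (bact s m, bact s n) \<in> W}"
    have VW': "openin JJJ (?V \<times> ?W)" "((m, n), (m', n')) \<in> ?V \<times> ?W"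
      using openin_JJ_act VW I t s by (auto simp: openin_prod_Times_iff)
    obtain y where "y \<in> P" "y \<in> ?V \<times> ?W"
      using mn(2)[unfolded P'_def in_closure_of, THEN conjunct2, rule_format, OF conjI[OF VW'(2,1)]] by blast
    then obtain x x' l where l: "x \<in> I" "x' \<in> I" "l \<in> L" "(bact t x, bact t (x \<odot> l)) \<in> V"
      "(bact s x', bact s (x' \<odot> l)) \<in> W" by (auto simp: P_def)
    then have "hits V l" "hits W l" using I_act by (auto simp: bact_bmult intro: hitsI)
    then show "\<exists>k\<in>L. hits V k \<and> hits W k" using l(3) by blast
  qed
  then have c: "iv (prt m' n') \<odot> prt m n \<in> derv L" (is "?c \<in> _")
    using nonsep_imp_derv[OF sL(1)] tclD(2)[OF L] NL by blast
  \<comment> \<open>Both \<open>m'\<close> and \<open>n'\<close> are \<open>N A\<close>-related to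
    \<open>u\<close>, so the second group element lies in \<open>A\<close>; it is a correction that
    conjugation by \<open>a\<close> absorbs.\<close>
  have b': "prt m' n' \<in> A"
    using subgrpD(4)[OF sA(1) tclD(2)[OF A NA(3)] tclD(2)[OF A NA(4)]] prt_trans[OF I(3) uI I(4)] by simp
  define a where "a = prt u m \<odot> prt m' n'"
  have aA: "a \<in> A" using b' tclD(2)[OF A NA(1)] subgrpD(4)[OF sA(1)] by (simp add: a_def)
  have aG: "a \<in> G" "iv a \<in> G" using aA sA iv_G by auto
  have cG: "?c \<in> G" using c derv_subset sL(2) by blast
  have pG: "prt n \<kappa> \<in> G" using prt_G I kI by blast
  \<comment> \<open>Travel from \<open>u\<close> to \<open>\<kappa>\<close> through \<open>m\<close>
    and \<open>n\<close>; the middle factor is split so that the inseparable part \<open>?c\<close>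
    is flanked by elements of \<open>A\<close>.\<close>
  have "\<kappa> = prt u m \<odot> prt m n \<odot> prt n \<kappa>" 
    by (simp add: prt_trans I kI uI prt_u kG)
  also have "prt m n = prt m' n' \<odot> ?c" 
    by (rule iv_cancel_left(2)[OF prt_G prt_G, symmetric]) (use I in auto)
  also have "prt u m \<odot> (prt m' n' \<odot> ?c) \<odot> prt n \<kappa> = a \<odot> ?c \<odot> prt n \<kappa>" by (simp add: a_def bmult_assoc)
  also have "\<dots> = (a \<odot> ?c \<odot> iv a \<odot> a) \<odot> prt n \<kappa>"
    using iv_cancel(2)[OF aG(1), of "a \<odot> ?c"] G_mult[OF aG(1) cG] G_I by simp
  also have "\<dots> = (a \<odot> ?c \<odot> iv a) \<odot> (a \<odot> prt n \<kappa>)" by (simp only: bmult_assoc)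
  finally have "\<kappa> = (a \<odot> ?c \<odot> iv a) \<odot> (a \<odot> prt n \<kappa>)" .
  moreover have "a \<odot> ?c \<odot> iv a \<in> derv L" by (rule derv_normal[OF sL(1) aG(1) AL[OF aA] c])
  moreover have "a \<odot> prt n \<kappa> \<in> A" using aA tclD(2)[OF A NA(2)] subgrpD(4)[OF sA(1)] by blast
  ultimately show ?thesis using gprodI by metis
qed

text \<open>Invariance under conjugation by \<open>A\<close> is built into the Zorn family
  \<open>S\<close> because it moves elements of \<open>A\<close> across the supplement:
  \<open>a l b = (a l (iv a)) (a b)\<close>. Together with \<open>derv_supplement\<close> this shows
  that the derived group of a member is again a member.\<close>

lemma eq_of_derived_supplement:
  assumes A: "tcl A" and K: "tcl K" "A \<subseteq> K" "K \<subseteq> gprod A (derv K)"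
    and stab: "\<And>L. tcl L \<Longrightarrow> L \<subseteq> K \<Longrightarrow> derv L = L \<Longrightarrow> L \<subseteq> A"
  shows "K = A"
proof -
  have sA: "subgrp A" "A \<subseteq> G" and sK: "subgrp K" "K \<subseteq> G" using A K by (auto simp: tcl_def subgrp_def)
  define S where "S = {L. tcl L \<and> L \<subseteq> K \<and> (\<forall>a\<in>A. \<forall>l\<in>L. a \<odot> l \<odot> iv a \<in> L) \<and> K \<subseteq> gprod L A}"
  have "\<exists>M\<in>S. \<forall>X\<in>S. X \<subseteq> M \<longrightarrow> X = M"
  proof (rule subset_Zorn_minimal)
    have "k \<in> gprod K A" if "k \<in> K" for k
      using gprodI[OF that subgrpD(3)[OF sA(1)]] that sK G_mult_u by auto
    then have "K \<in> S" using K subgrp_normal[OF sK(1)] by (auto simp: S_def)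
    then show "S \<noteq> {}" by blast
    fix \<D> assume D: "\<D> \<noteq> {}" "\<D> \<subseteq> S" and ch: "\<And>X Y. X \<in> \<D> \<Longrightarrow> Y \<in> \<D> \<Longrightarrow> X \<subseteq> Y \<or> Y \<subseteq> X"
    have DS: "tcl L" "L \<subseteq> K" "\<And>a l. a \<in> A \<Longrightarrow> l \<in> L \<Longrightarrow> a \<odot> l \<odot> iv a \<in> L" "K \<subseteq> gprod L A"
      if "L \<in> \<D>" for L using D(2) that by (auto simp: S_def)
    have "K \<subseteq> gprod (\<Inter>\<D>) A"
    proof
      fix k assume k: "k \<in> K"
      show "k \<in> gprod (\<Inter>\<D>) A"
        by (rule chain_Inter_supplement[OF A D(1) DS(1) ch]) (use k sK DS(4) in auto)
    qed
    moreover have "tcl (\<Inter>\<D>)" by (rule tcl_Inter) (use D DS in auto)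
    moreover have "\<Inter>\<D> \<subseteq> K" using DS(2) D(1) by blast
    ultimately show "\<Inter>\<D> \<in> S" using DS(3) by (auto simp: S_def)
  qed
  then obtain M where M: "M \<in> S" and min: "\<And>X. X \<in> S \<Longrightarrow> X \<subseteq> M \<Longrightarrow> X = M" by metis
  have MS: "tcl M" "M \<subseteq> K" "\<And>a l. a \<in> A \<Longrightarrow> l \<in> M \<Longrightarrow> a \<odot> l \<odot> iv a \<in> M" "K \<subseteq> gprod M A"
    using M by (auto simp: S_def)
  have sM: "subgrp M" using MS(1) by (simp add: tcl_def)
  have nd: "a \<odot> l \<odot> iv a \<in> derv M" if "a \<in> A" "l \<in> derv M" for a l
    by (rule derv_normal[OF sM _ MS(3) that(2)]) (use that sA in auto)
  have "K \<subseteq> gprod (derv M) A"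
  proof
    fix k assume "k \<in> K"
    then obtain a \<kappa> where k: "k = a \<odot> \<kappa>" "a \<in> A" "\<kappa> \<in> derv K" using K(3) by (auto simp: gprod_def)
    then have "\<kappa> \<in> gprod (derv M) A" using derv_supplement[OF A MS(1) MS(3) K(1) MS(4)] by blast
    then obtain l b where l: "\<kappa> = l \<odot> b" "l \<in> derv M" "b \<in> A" by (auto simp: gprod_def)
    have "a \<odot> l \<in> I" using k l sA sM subgrpD(1) derv_subset G_mult G_I by blast
    then have "a \<odot> l \<odot> iv a \<odot> a = a \<odot> l" using k(2) sA iv_cancel(2) by blast
    then have "k = (a \<odot> l \<odot> iv a) \<odot> (a \<odot> b)" using k l by (metis bmult_assoc)
    then show "k \<in> gprod (derv M) A"
      using gprodI[OF nd[OF k(2) l(2)] subgrpD(4)[OF sA(1) k(2) l(3)]] by simp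
  qed
  moreover have "derv M \<subseteq> K" using derv_subset MS(2) by blast
  ultimately have "derv M \<in> S" using nd tcl_derv[OF MS(1)] by (auto simp: S_def)
  then have "derv M = M" using min derv_subset by blast
  then have "M \<subseteq> A" using stab MS by blast
  then have "gprod M A \<subseteq> A" using subgrpD(4)[OF sA(1)] by (auto simp: gprod_def)
  then show ?thesis using MS(4) K(2) by blast
qed


section \<open>Quotients of the universal minimal system\<close>

lemma J_minimal:
  assumes C: "closedin J C" "C \<noteq> {}" "\<And>t m. m \<in> C \<Longrightarrow> bact t m \<in> C" shows "C = I"
proof
  show "C \<subseteq> I" using closedin_subset[OF C(1)] by simp
  then obtain m where m: "m \<in> C" "m \<in> I" using C(2) by blast
  have cl: "closedin beta_top C"
    using C(1) closedin_minimal_left_ideal[OF minI] unfolding Itop_def by (meson closedin_trans_full)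
  show "I \<subseteq> C"
  proof
    fix n assume "n \<in> I"
    then obtain p where "p \<in> I" "n = p \<odot> m" using I_reach[OF m(2)] by blast
    then show "n \<in> C" using closed_invariant_imp_left_ideal[OF cl C(3) _ m(1), of p] I_betaT by blast
  qed
qed

text \<open>\<open>PI_tower\<close> puts all its stages on one carrier type, here that of
  \<open>I\<close>, so a quotient is realised on chosen representatives instead of classes. Related
  points are related to the same points, hence the choice operator returns the same representative
  for both.\<close>

definition rep where "rep R m = (SOME n. (m, n) \<in> R)"
definition qtop where "qtop R = topology (\<lambda>U. U \<subseteq> rep R ` I \<and> openin J {m \<in> I. rep R m \<in> U})"
definition qact where "qact R t x = rep R (bact t x)"

lemma rep_rel: assumes "icer R" "m \<in> I" shows "(m, rep R m) \<in> R" "rep R m \<in> I"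
proof -
  show "(m, rep R m) \<in> R" unfolding rep_def using icer_refl[OF assms] by (rule someI)
  then show "rep R m \<in> I" using icer_subset[OF assms(1)] by blast
qed

lemma rep_eq_iff: assumes R: "icer R" and mn: "m \<in> I" "n \<in> I" shows "rep R m = rep R n \<longleftrightarrow> (m, n) \<in> R"
proof
  assume "rep R m = rep R n"
  then show "(m, n) \<in> R" using rep_rel[OF R] mn icer_sym[OF R] icer_trans[OF R] by metis
next
  assume "(m, n) \<in> R"
  then have "(m, k) \<in> R \<longleftrightarrow> (n, k) \<in> R" for k using icer_sym[OF R] icer_trans[OF R] by metis
  then show "rep R m = rep R n" by (simp add: rep_def)
qed

lemma rep_rep: "icer R \<Longrightarrow> S \<subseteq> R \<Longrightarrow> icer S \<Longrightarrow> m \<in> I \<Longrightarrow> rep R (rep S m) = rep R m"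
  using rep_eq_iff[of R "rep S m" m] rep_rel[of S m] icer_sym[of R] by blast

lemma rep_idem: "icer R \<Longrightarrow> x \<in> rep R ` I \<Longrightarrow> rep R x = x"
  using rep_rep[of R R] by auto

lemma rep_image: "icer R \<Longrightarrow> x \<in> rep R ` I \<Longrightarrow> x \<in> I"
  using rep_rel by blast

lemma openin_qtop: "openin (qtop R) U \<longleftrightarrow> U \<subseteq> rep R ` I \<and> openin J {m \<in> I. rep R m \<in> U}"
proof -
  have "istopology (\<lambda>U. U \<subseteq> rep R ` I \<and> openin J {m \<in> I. rep R m \<in> U})"
    unfolding istopology_def
  proof (intro conjI allI impI)
    fix S T assume "S \<subseteq> rep R ` I \<and> openin J {m \<in> I. rep R m \<in> S}" "T \<subseteq> rep R ` I \<and> openin J {m \<in> I. rep R m \<in> T}"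
    then have "openin J ({m \<in> I. rep R m \<in> S} \<inter> {m \<in> I. rep R m \<in> T})" "S \<inter> T \<subseteq> rep R ` I" by auto
    moreover have "{m \<in> I. rep R m \<in> S} \<inter> {m \<in> I. rep R m \<in> T} = {m \<in> I. rep R m \<in> S \<inter> T}" by auto
    ultimately show "openin J {m \<in> I. rep R m \<in> S \<inter> T}" "S \<inter> T \<subseteq> rep R ` I" by auto
  next
    fix \<K> assume K: "\<forall>K\<in>\<K>. K \<subseteq> rep R ` I \<and> openin J {m \<in> I. rep R m \<in> K}"
    then have "openin J (\<Union>K\<in>\<K>. {m \<in> I. rep R m \<in> K})" by (intro openin_Union) auto
    moreover have "(\<Union>K\<in>\<K>. {m \<in> I. rep R m \<in> K}) = {m \<in> I. rep R m \<in> \<Union>\<K>}" by auto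
    ultimately show "openin J {m \<in> I. rep R m \<in> \<Union>\<K>}" by simp
    show "\<Union>\<K> \<subseteq> rep R ` I" using K by blast
  qed
  then show ?thesis by (simp add: qtop_def topology_inverse')
qed

lemma topspace_qtop [simp]: "topspace (qtop R) = rep R ` I"
proof
  have "{m \<in> I. rep R m \<in> rep R ` I} = topspace J" by auto
  then have "openin (qtop R) (rep R ` I)" unfolding openin_qtop by (metis openin_topspace subset_refl)
  then show "rep R ` I \<subseteq> topspace (qtop R)" by (rule openin_subset)
  show "topspace (qtop R) \<subseteq> rep R ` I" using openin_topspace[of "qtop R"] unfolding openin_qtop by blast
qed

lemma continuous_rep: "continuous_map J (qtop R) (rep R)"
  unfolding continuous_map_def by (auto simp: openin_qtop)

lemma continuous_map_qtop:
  assumes R: "icer R" and c: "continuous_map J Z \<phi>" and h: "\<And>m. m \<in> I \<Longrightarrow> h (rep R m) = \<phi> m"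
  shows "continuous_map (qtop R) Z h"
  unfolding continuous_map_def
proof (intro conjI allI impI)
  show "h \<in> topspace (qtop R) \<rightarrow> topspace Z"
    using h continuous_map_image_subset_topspace[OF c] by auto
  fix U assume U: "openin Z U"
  have "{m \<in> I. rep R m \<in> {x \<in> topspace (qtop R). h x \<in> U}} = {m \<in> topspace J. \<phi> m \<in> U}"
    using h by auto
  then show "openin (qtop R) {x \<in> topspace (qtop R). h x \<in> U}"
    using openin_continuous_map_preimage[OF c U] by (auto simp: openin_qtop)
qed

text \<open>The saturation of a closed set \<open>C\<close> is the first projection of
  \<open>R \<inter> (I \<times> C)\<close>, hence closed by compactness.\<close>

lemma closed_map_rep: assumes R: "icer R" shows "closed_map J (qtop R) (rep R)"
  unfolding closed_map_def
proof (intro allI impI)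
  fix C assume C: "closedin J C"
  then have CI: "C \<subseteq> I" using closedin_subset by fastforce
  have "closedin JJ (R \<inter> (I \<times> C))"
    using C icer_closed[OF R] closedin_topspace[of J] by (intro closedin_Int) (auto simp: closedin_prod_Times_iff)
  then have "closedin J (fst ` (R \<inter> (I \<times> C)))"
    using continuous_imp_closed_map[OF continuous_map_fst compact_JJ Hausdorff_J] by (simp add: closed_map_def)
  then have "openin J (I - fst ` (R \<inter> (I \<times> C)))" by (simp add: closedin_def)
  moreover have "I - fst ` (R \<inter> (I \<times> C)) = {m \<in> I. rep R m \<in> rep R ` I - rep R ` C}"
  proof -
    have "m \<in> fst ` (R \<inter> (I \<times> C)) \<longleftrightarrow> rep R m \<in> rep R ` C" if m: "m \<in> I" for m
    proof -
      have "m \<in> fst ` (R \<inter> (I \<times> C)) \<longleftrightarrow> (\<exists>c\<in>C. (m, c) \<in> R)" using m by force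
      also have "\<dots> \<longleftrightarrow> rep R m \<in> rep R ` C" using rep_eq_iff[OF R m] CI by (auto simp: image_iff)
      finally show ?thesis .
    qed
    then show ?thesis by auto
  qed
  ultimately have "openin (qtop R) (rep R ` I - rep R ` C)" by (auto simp: openin_qtop)
  then show "closedin (qtop R) (rep R ` C)" using CI by (auto simp: closedin_def)
qed

lemma compact_qtop: "compact_space (qtop R)"
  using image_compactin[OF _ continuous_rep, of "topspace J"] compact_J by (simp add: compact_space_def)

text \<open>Closed continuous images of normal spaces are normal, so it remains to see that points
  are closed.\<close>

lemma Hausdorff_qtop: assumes R: "icer R" shows "Hausdorff_space (qtop R)"
proof (rule Hausdorff_normal_space_closed_continuous_map_image[of J _ "rep R"])
  show "normal_space J" by (simp add: compact_Hausdorff_or_regular_imp_normal_space compact_J Hausdorff_J)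
  show "closed_map J (qtop R) (rep R)" by (rule closed_map_rep[OF R])
  show "continuous_map J (qtop R) (rep R)" by (rule continuous_rep)
  show "t1_space (qtop R)"
    unfolding t1_space_closedin_singleton
  proof
    fix x assume "x \<in> topspace (qtop R)"
    then obtain m where m: "m \<in> I" "x = rep R m" by auto
    then have "closedin J {m}" by (simp add: closedin_Hausdorff_singleton Hausdorff_J)
    then have "closedin (qtop R) (rep R ` {m})" using closed_map_rep[OF R] unfolding closed_map_def by blast
    then show "closedin (qtop R) {x}" using m by simp
  qed
qed simp

lemma qact_rep: "icer R \<Longrightarrow> m \<in> I \<Longrightarrow> qact R t (rep R m) = rep R (bact t m)"
  unfolding qact_def using rep_eq_iff icer_act icer_sym rep_rel I_act by metis

lemma minimal_quotient: assumes R: "icer R" shows "minimal_compact_dynamic (qtop R) (qact R)"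
  unfolding minimal_compact_dynamic_def compact_dynamic_def dynamic_def
proof (intro conjI allI ballI impI)
  show "continuous_map (qtop R) (qtop R) (qact R t)" for t
    by (rule continuous_map_qtop[OF R continuous_map_compose[OF continuous_act_J continuous_rep]])
      (simp add: qact_rep R)
  show "qact R 1 x = x" if "x \<in> topspace (qtop R)" for x
    using rep_idem[OF R, of x] that by (simp add: qact_def bact_one)
  show "qact R (s * t) x = qact R s (qact R t x)" if x: "x \<in> topspace (qtop R)" for s t x
  proof -
    obtain m where "m \<in> I" "x = rep R m" using x by auto
    then show ?thesis by (simp add: qact_rep R bact_mult I_act)
  qed
  show "compact_space (qtop R)" by (rule compact_qtop)
  show "Hausdorff_space (qtop R)" by (rule Hausdorff_qtop[OF R])
  show "topspace (qtop R) \<noteq> {}" using uI by auto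
  fix A assume A: "closedin (qtop R) A \<and> invariant_set (qact R) A"
  let ?C = "{m \<in> topspace J. rep R m \<in> A}"
  have cl: "closedin J ?C" using closedin_continuous_map_preimage[OF continuous_rep] A by blast
  have inv: "bact t m \<in> ?C" if "m \<in> ?C" for t m
  proof -
    have m: "m \<in> I" "rep R m \<in> A" using that by auto
    then have "qact R t (rep R m) \<in> A" using A unfolding invariant_set_def by blast
    then show ?thesis using m qact_rep[OF R m(1)] I_act by simp
  qed
  have "?C = {} \<or> ?C = I" using J_minimal[OF cl _ inv] by blast
  moreover have "A \<subseteq> rep R ` I" using A closedin_subset by fastforce
  ultimately show "A = {} \<or> A = topspace (qtop R)" by auto
qed

definition ker where "ker \<phi> = {(m, n). m \<in> I \<and> n \<in> I \<and> \<phi> m = \<phi> n}"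

lemma icer_ker:
  assumes e: "extension J bact Z actZ \<phi>" and Z: "Hausdorff_space Z"
  shows "icer (ker \<phi>)"
proof -
  have c: "continuous_map J Z \<phi>" using e by (simp add: extension_def)
  have "closedin JJ {w \<in> topspace JJ. (\<phi> \<circ> fst) w = (\<phi> \<circ> snd) w}"
    by (intro closedin_continuous_maps_eq[OF Z] continuous_map_compose[OF continuous_map_fst c] continuous_map_compose[OF continuous_map_snd c])
  moreover have "{w \<in> topspace JJ. (\<phi> \<circ> fst) w = (\<phi> \<circ> snd) w} = ker \<phi>" by (auto simp: ker_def)
  ultimately have "closedin JJ (ker \<phi>)" by simp
  then show ?thesis using e I_act by (auto simp: icer_def ker_def extension_def sym_def trans_def)
qed

lemma extension_rep: "icer R \<Longrightarrow> extension J bact (qtop R) (qact R) (rep R)"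
  by (simp add: extension_def continuous_rep qact_rep)

lemma ker_rep: assumes R: "icer R" shows "ker (rep R) = R"
proof (intro equalityI subrelI)
  fix m n
  show "(m, n) \<in> R" if "(m, n) \<in> ker (rep R)" using that rep_eq_iff[OF R, of m n] by (simp add: ker_def)
  show "(m, n) \<in> ker (rep R)" if "(m, n) \<in> R"
    using that rep_eq_iff[OF R, of m n] icer_subset[OF R that] by (simp add: ker_def)
qed

lemma extension_quotient:
  assumes S: "icer S" and e: "extension J bact Z actZ \<phi>" and SR: "S \<subseteq> ker \<phi>"
  shows "extension (qtop S) (qact S) Z actZ \<phi>"
proof -
  have eq: "\<phi> (rep S m) = \<phi> m" if "m \<in> I" for m
    using rep_rel[OF S that] SR by (auto simp: ker_def)
  have "continuous_map (qtop S) Z \<phi>"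
    by (rule continuous_map_qtop[OF S, of _ \<phi>]) (use e eq in \<open>auto simp: extension_def\<close>)
  moreover have "\<phi> ` rep S ` I = \<phi> ` I" using eq by (auto simp: image_iff)
  ultimately show ?thesis using e eq by (auto simp: extension_def qact_rep S I_act)
qed

lemma continuous_rep_pair: "continuous_map JJ (prod_topology (qtop R) (qtop R)) (\<lambda>(m, n). (rep R m, rep R n))"
  by (simp add: continuous_map_prod_top continuous_rep)

lemma openin_rep_pair:
  assumes "openin (prod_topology (qtop R) (qtop R)) W"
  shows "openin JJ {(m, n). m \<in> I \<and> n \<in> I \<and> (rep R m, rep R n) \<in> W}"
  using openin_continuous_map_preimage[OF continuous_rep_pair assms] by (rule back_subst) auto

section \<open>Proximal and almost periodic maps between quotients\<close>

text \<open>Left multiplication by \<open>u\<close> is a limit of the action and sends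
  \<open>(x, y)\<close> to \<open>(u x, u x g)\<close> with \<open>g = prt x y\<close>. This
  \<open>g\<close> lies in the group of \<open>ker \<phi>\<close>, hence in that of
  \<open>S\<close>, so the limit pair is \<open>S\<close>-related.\<close>

lemma proximal_quotient:
  assumes S: "icer S" and e: "extension J bact Z actZ \<phi>" and SR: "S \<subseteq> ker \<phi>" and Z: "Hausdorff_space Z"
    and grp: "grp (ker \<phi>) \<subseteq> grp S"
  shows "proximal_ext (qtop S) (qact S) \<phi>"
  unfolding proximal_ext_def
proof
  fix z assume "z \<in> Rel (qtop S) \<phi>"
  then obtain x y where z: "z = (x, y)" "x \<in> rep S ` I" "y \<in> rep S ` I" "\<phi> x = \<phi> y" by (auto simp: Rel_def)
  have I: "x \<in> I" "y \<in> I" using z rep_image[OF S] by auto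
  then have "prt x y \<in> grp S" using icer_prt[OF icer_ker[OF e Z]] grp z by (auto simp: ker_def)
  then have "(u \<odot> x, u \<odot> x \<odot> prt x y) \<in> S" using icer_graph[OF S] I uI I_mult' by blast
  then have "(u \<odot> x, u \<odot> y) \<in> S" using um_prt I by simp
  then have eq: "rep S (u \<odot> x) = rep S (u \<odot> y)" using rep_eq_iff[OF S] icer_subset[OF S] by blast
  let ?w = "rep S (u \<odot> x)"
  have ux: "u \<odot> x \<in> I" "u \<odot> y \<in> I" using I uI I_mult' by auto
  have "(?w, ?w) \<in> prod_topology (qtop S) (qtop S) closure_of (range (\<lambda>t. diag_act (qact S) t z))"
    unfolding in_closure_of
  proof (intro conjI allI impI)
    show "(?w, ?w) \<in> topspace (prod_topology (qtop S) (qtop S))" using ux by simp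
    fix W assume W: "(?w, ?w) \<in> W \<and> openin (prod_topology (qtop S) (qtop S)) W"
    let ?W = "{(m, n). m \<in> I \<and> n \<in> I \<and> (rep S m, rep S n) \<in> W}"
    have W': "openin JJ ?W" "(u \<odot> x, u \<odot> y) \<in> ?W" using openin_rep_pair W ux eq by auto
    obtain t where "(bact t x, bact t y) \<in> ?W" by (rule orbit_approx[OF W'(1) I_betaT[OF uI] I W'(2)])
    then have "diag_act (qact S) t z \<in> W" by (simp add: diag_act_def z qact_def)
    then show "\<exists>y. y \<in> range (\<lambda>t. diag_act (qact S) t z) \<and> y \<in> W" by blast
  qed
  moreover have "(?w, ?w) \<in> Delta (qtop S)" using ux by (auto simp: Delta_def)
  ultimately show "prod_topology (qtop S) (qtop S) closure_of (range (\<lambda>t. diag_act (qact S) t z)) \<inter> Delta (qtop S) \<noteq> {}"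
    by blast
qed

text \<open>\<open>D\<close> collects limits of pairs together with their translates. By
  \<open>key\<close>, a pair that can be moved into \<open>S\<close> in the limit is itself in
  \<open>S\<close>. So the closed set \<open>Z1\<close> of images of such pairs misses the given
  off-diagonal point, and a whole neighbourhood of that point can be kept away from
  \<open>Z1\<close>.\<close>

lemma ap_quotient:
  assumes K: "tcl K" and B: "tcl B" "derv K \<subseteq> B" "B \<subseteq> K"
  shows "ap_ext (qtop (E K B)) (qact (E K B)) (rep (N K))"
  unfolding ap_ext_def
proof (intro notI, elim exE conjE)
  have sK: "subgrp K" "K \<subseteq> G" and sB: "subgrp B" "B \<subseteq> G" using K B by (auto simp: tcl_def subgrp_def)
  define S where "S = E K B"
  let ?X = "qtop S" and ?q = "rep S"
  let ?XX = "prod_topology ?X ?X"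
  let ?qq = "\<lambda>(m, n). (?q m, ?q n)"
  have iS: "icer S" unfolding S_def by (rule icer_E[OF assms])
  have iN: "icer (N K)" by (rule icer_N[OF sK(1)])
  fix x x' assume xx: "(x, x') \<in> Rel (qtop (E K B)) (rep (N K)) - Delta (qtop (E K B))"
    and H: "\<forall>U V. openin (qtop (E K B)) U \<and> x \<in> U \<and> openin (qtop (E K B)) V \<and> x' \<in> V \<longrightarrow>
      prod_topology (qtop (E K B)) (qtop (E K B)) closure_of
        (\<Union>t. diag_act (qact (E K B)) t ` (U \<times> V \<inter> Rel (qtop (E K B)) (rep (N K)))) \<inter> Delta (qtop (E K B)) \<noteq> {}"
  note xx = xx[folded S_def] and H = H[folded S_def]
  have x: "x \<in> ?q ` I" "x' \<in> ?q ` I" "x \<noteq> x'" using xx by (auto simp: Rel_def Delta_def)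
  have cXX: "compact_space ?XX" "Hausdorff_space ?XX"
    by (simp_all add: compact_space_prod_topology compact_qtop Hausdorff_space_prod_topology Hausdorff_qtop iS)
  have RelN: "(y, y') \<in> N K \<and> ?q y = y \<and> ?q y' = y'" if "(y, y') \<in> Rel ?X (rep (N K))" for y y'
  proof -
    have y: "y \<in> ?q ` I" "y' \<in> ?q ` I" "rep (N K) y = rep (N K) y'" using that by (auto simp: Rel_def)
    then show ?thesis
      using rep_eq_iff[OF iN rep_image[OF iS y(1)] rep_image[OF iS y(2)]] rep_idem[OF iS y(1)] rep_idem[OF iS y(2)]
      by blast
  qed
  define D where "D = JJJ closure_of {((m, n), (bact t m, bact t n)) | m n t. (m, n) \<in> N K}"
  have Dsub: "{((m, n), (bact t m, bact t n)) | m n t. (m, n) \<in> N K} \<subseteq> N K \<times> N K"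
    using N_act[OF sK(2)] by blast
  have NT: "N K \<subseteq> topspace JJ" by (auto simp: N_def)
  have D0: "((m, n), (bact t m, bact t n)) \<in> D" if "(m, n) \<in> N K" for m n t
    using closure_of_subset[of "{((m, n), (bact t m, bact t n)) | m n t. (m, n) \<in> N K}" JJJ] Dsub NT that
    unfolding D_def by fastforce
  have DN: "D \<subseteq> N K \<times> N K"
    unfolding D_def by (rule closure_of_minimal[OF Dsub]) (simp add: closedin_prod_Times_iff closedin_N sK)
  have clD: "closedin JJJ D" by (simp add: D_def)
  have cJJJ: "compact_space JJJ" by (simp add: compact_space_prod_topology compact_J)
  \<comment> \<open>A pair near \<open>(m, n)\<close> with a translate near \<open>(m', n')\<close>
    is approximated by a graph of some \<open>k\<close> in \<open>K\<close>, which then comes near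
    both. Hence the two group elements are inseparable in \<open>K\<close> and differ by an element
    of the derived group, which lies in \<open>B\<close>.\<close>
  have key: "(m, n) \<in> S" if D: "((m, n), (m', n')) \<in> D" and S': "(m', n') \<in> S" for m n m' n'
  proof -
    have mn: "(m, n) \<in> N K" "(m', n') \<in> N K" using D DN by auto
    have I: "m \<in> I" "n \<in> I" "m' \<in> I" "n' \<in> I" using mn by (auto simp: N_def)
    have b: "prt m' n' \<in> B" "prt m' n' \<in> K" using S' B(3) by (auto simp: S_def E_def)
    have "nonsep K (prt m n) (prt m' n')"
      unfolding N_nonsep_iff[OF K mn(1) b(2)]
    proof (intro allI impI)
      fix W V assume W: "openin JJ W" "(m, n) \<in> W" and V: "openin JJ V" "hits V (prt m' n')"
      obtain s where s: "(bact s m', bact s n') \<in> V" using prt_orbit[OF V I(3,4)] by metis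
      let ?V = "\<lambda>s. {(m, n). m \<in> I \<and> n \<in> I \<and> (bact s m, bact s n) \<in> V}"
      have WV: "openin JJJ (W \<times> ?V s)" "((m, n), (m', n')) \<in> W \<times> ?V s"
        using W openin_JJ_act[OF V(1)] I s by (auto simp: openin_prod_Times_iff)
      obtain y where y: "y \<in> {((m, n), (bact t m, bact t n)) | m n t. (m, n) \<in> N K}" "y \<in> W \<times> ?V s"
        using D[unfolded D_def in_closure_of, THEN conjunct2, rule_format, OF conjI[OF WV(2,1)]] by blast
      obtain a b t where ab: "(a, b) \<in> N K" "(a, b) \<in> W" "(bact t a, bact t b) \<in> ?V s" using y by auto
      then have "(a, b) \<in> ?V (s * t)" by (auto simp: bact_mult N_def)
      then have "openin JJ (W \<inter> ?V (s * t))" "(a, b) \<in> W \<inter> ?V (s * t)" using ab W openin_JJ_act[OF V(1)] by auto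
      then obtain k where k: "k \<in> K" "hits (W \<inter> ?V (s * t)) k" using ab(1) unfolding N_iff[OF sK(2)] by blast
      then have "hits W k" "hits V k" using I_act by (auto simp: hits_def bact_bmult)
      then show "\<exists>k\<in>K. hits V k \<and> hits W k" using k(1) by blast
    qed
    then have "iv (prt m' n') \<odot> prt m n \<in> B"
      using nonsep_imp_derv[OF sK(1)] tclD(2)[OF K] mn B(2) by blast
    then have "prt m' n' \<odot> (iv (prt m' n') \<odot> prt m n) \<in> B" using b subgrpD(4)[OF sB(1)] by blast
    then have "prt m n \<in> B" using iv_cancel_left(2)[OF prt_G prt_G] I by simp
    then show ?thesis using mn(1) by (simp add: S_def E_def)
  qed
  have cl_qq: "closedin ?XX (?qq ` C)" if "closedin JJ C" for C
    using continuous_imp_closed_map[OF continuous_rep_pair compact_JJ cXX(2)] that by (simp add: closed_map_def)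
  have cl_fst: "closedin JJ (fst ` C)" "closedin JJ (snd ` C)" if "closedin JJJ C" for C
    using continuous_imp_closed_map[OF continuous_map_fst cJJJ Hausdorff_JJ]
      continuous_imp_closed_map[OF continuous_map_snd cJJJ Hausdorff_JJ] that by (auto simp: closed_map_def)
  define Z0 where "Z0 = fst ` (D \<inter> (topspace JJ \<times> S))"
  define Z1 where "Z1 = ?qq ` Z0"
  have "closedin JJJ (topspace JJ \<times> S)"
    unfolding closedin_prod_Times_iff using icer_closed[OF iS] closedin_topspace by blast
  then have clZ1: "closedin ?XX Z1"
    unfolding Z1_def Z0_def by (intro cl_qq cl_fst closedin_Int clD)
  have "(x, x') \<notin> Z1"
  proof
    assume "(x, x') \<in> Z1"
    then obtain m n m' n' where mn: "x = ?q m" "x' = ?q n" "((m, n), (m', n')) \<in> D" "(m', n') \<in> S"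
      by (auto simp: Z1_def Z0_def)
    then have "(m, n) \<in> S" using key by blast
    then have "?q m = ?q n" using rep_eq_iff[OF iS] icer_subset[OF iS] by blast
    then show False using x(3) mn by simp
  qed
  then have "(x, x') \<in> topspace ?XX - Z1" using x by auto
  moreover have "openin ?XX (topspace ?XX - Z1)" using clZ1 by (simp add: closedin_def)
  \<comment> \<open>A closed set is inserted between the neighbourhood and the complement of
    \<open>Z1\<close>, because the first members of the pairs in \<open>D\<close> are about to pass
    to a limit.\<close>
  moreover have "neighbourhood_base_of (closedin ?XX) ?XX"
    unfolding neighbourhood_base_of_closedin by (rule compact_Hausdorff_imp_regular_space[OF cXX])
  ultimately obtain O' C where O': "openin ?XX O'" "closedin ?XX C" "(x, x') \<in> O'" "O' \<subseteq> C" "C \<subseteq> topspace ?XX - Z1"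
    unfolding neighbourhood_base_of by metis
  then obtain U V where UV: "openin ?X U" "openin ?X V" "x \<in> U" "x' \<in> V" "U \<times> V \<subseteq> O'"
    unfolding openin_prod_topology_alt by metis
  define C' where "C' = {w \<in> topspace JJ. ?qq w \<in> C}"
  have "closedin JJ C'" unfolding C'_def by (rule closedin_continuous_map_preimage[OF continuous_rep_pair O'(2)])
  then have "closedin JJJ (C' \<times> topspace JJ)" unfolding closedin_prod_Times_iff using closedin_topspace by blast
  then have clZ2: "closedin ?XX (?qq ` snd ` (D \<inter> (C' \<times> topspace JJ)))"
    by (intro cl_qq cl_fst closedin_Int clD)
  let ?U = "\<Union>t. diag_act (qact S) t ` (U \<times> V \<inter> Rel ?X (rep (N K)))"
  have "?U \<subseteq> ?qq ` snd ` (D \<inter> (C' \<times> topspace JJ))"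
  proof
    fix w assume "w \<in> ?U"
    then obtain t y y' where y: "w = diag_act (qact S) t (y, y')" "y \<in> U" "y' \<in> V" "(y, y') \<in> Rel ?X (rep (N K))" by auto
    have N: "(y, y') \<in> N K" "?q y = y" "?q y' = y'" using RelN[OF y(4)] by auto
    have "(y, y') \<in> C'" using N y UV(5) O'(4) NT by (auto simp: C'_def)
    moreover have "(bact t y, bact t y') \<in> topspace JJ" using N_act[OF sK(2) N(1)] NT by blast
    ultimately have "((y, y'), (bact t y, bact t y')) \<in> D \<inter> (C' \<times> topspace JJ)" using D0[OF N(1)] by blast
    then have "(bact t y, bact t y') \<in> snd ` (D \<inter> (C' \<times> topspace JJ))" by (metis image_eqI snd_conv)
    moreover have "w = ?qq (bact t y, bact t y')" by (simp add: y(1) diag_act_def qact_def)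
    ultimately show "w \<in> ?qq ` snd ` (D \<inter> (C' \<times> topspace JJ))" by blast
  qed
  then have sub: "?XX closure_of ?U \<subseteq> ?qq ` snd ` (D \<inter> (C' \<times> topspace JJ))" by (rule closure_of_minimal[OF _ clZ2])
  have "?XX closure_of ?U \<inter> Delta ?X \<noteq> {}" using H UV by blast
  then obtain z where z: "z \<in> ?XX closure_of ?U" "z \<in> Delta ?X" by blast
  then obtain w where "z = (w, w)" by (auto simp: Delta_def)
  then have w: "(w, w) \<in> ?qq ` snd ` (D \<inter> (C' \<times> topspace JJ))" using subsetD[OF sub z(1)] by simp
  then obtain m n m' n' where mn: "((m, n), (m', n')) \<in> D" "(m, n) \<in> C'" "?q m' = ?q n'"
    by auto
  have "(m', n') \<in> N K" "(m, n) \<in> N K" using mn(1) DN by auto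
  then have I: "m' \<in> I" "n' \<in> I" "m \<in> I" "n \<in> I" by (auto simp: N_def)
  have "(m', n') \<in> S" using mn(3) rep_eq_iff[OF iS] I by blast
  then have "((m, n), (m', n')) \<in> D \<inter> (topspace JJ \<times> S)" using mn I by auto
  then have "(m, n) \<in> Z0" unfolding Z0_def by (metis fst_conv image_eqI)
  then have "?qq (m, n) \<in> Z1" unfolding Z1_def by blast
  moreover have "?qq (m, n) \<in> C" using mn(2) by (simp add: C'_def)
  ultimately show False using O'(5) by blast
qed

end

section \<open>Transfinite iteration of a decreasing operator\<close>

text \<open>Stages are collected as a set instead of being indexed by ordinals; intersections of
  arbitrary nonempty families take the place of limit stages. The well-order is recovered from
  inclusion.\<close>

inductive_set iter :: "('a set \<Rightarrow> 'a set) \<Rightarrow> 'a set \<Rightarrow> 'a set set" for \<Phi> R0 where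
  iter_base: "R0 \<in> iter \<Phi> R0"
| iter_step: "R \<in> iter \<Phi> R0 \<Longrightarrow> \<Phi> R \<in> iter \<Phi> R0"
| iter_Inter: "(\<And>R. R \<in> C \<Longrightarrow> R \<in> iter \<Phi> R0) \<Longrightarrow> C \<noteq> {} \<Longrightarrow> \<Inter>C \<in> iter \<Phi> R0"

locale decreasing_iteration =
  fixes \<Phi> :: "'a set \<Rightarrow> 'a set" and R0 :: "'a set"
  assumes decreasing: "R \<in> iter \<Phi> R0 \<Longrightarrow> \<Phi> R \<subseteq> R"
begin

abbreviation "T \<equiv> iter \<Phi> R0"

lemma iter_subset_base: "R \<in> T \<Longrightarrow> R \<subseteq> R0"
  by (induction rule: iter.induct) (use decreasing in blast)+

text \<open>The comparison step of the Bourbaki-Witt argument, by induction on \<open>S\<close>: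
  while \<open>S\<close> is strictly above \<open>R\<close> the hypothesis keeps
  \<open>\<Phi> S\<close> above \<open>R\<close>, and once \<open>S = R\<close> the next stage is
  \<open>\<Phi> R\<close>.\<close>

lemma iter_gap_aux:
  assumes R: "R \<in> T" and good: "\<And>S. S \<in> T \<Longrightarrow> R \<subset> S \<Longrightarrow> R \<subseteq> \<Phi> S" and S: "S \<in> T"
  shows "S \<subseteq> \<Phi> R \<or> R \<subseteq> S"
  using S
proof induction
  case iter_base then show ?case using iter_subset_base[OF R] by blast
next
  case (iter_step S)
  then show ?case using decreasing[of S] good[of S] by blast
next
  case (iter_Inter C) then show ?case by (meson Inter_greatest Inter_lower order_trans)
qed

lemma iter_psubset_step: "R \<in> T \<Longrightarrow> S \<in> T \<Longrightarrow> R \<subset> S \<Longrightarrow> R \<subseteq> \<Phi> S"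
proof (induction arbitrary: S rule: iter.induct)
  case iter_base then show ?case using iter_subset_base by blast
next
  case (iter_step R)
  then show ?case using iter_gap_aux[of R S] decreasing[of R] by blast
next
  case (iter_Inter C)
  \<comment> \<open>\<open>S\<close> is not contained in the intersection, so it already fails to be
    contained in one member; comparability puts that member strictly below \<open>S\<close>.\<close>
  then obtain R where R: "R \<in> C" "\<not> S \<subseteq> R" by blast
  then have "S \<subseteq> \<Phi> R \<or> R \<subseteq> S" using iter_Inter iter_gap_aux[of R S] by blast
  then have "R \<subset> S" using R decreasing[of R] iter_Inter by blast
  then have "R \<subseteq> \<Phi> S" using iter_Inter R by blast
  then show ?case using R by blast
qed

lemma iter_gap: "R \<in> T \<Longrightarrow> S \<in> T \<Longrightarrow> S \<subseteq> \<Phi> R \<or> R \<subseteq> S"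
  using iter_gap_aux iter_psubset_step by blast

lemma iter_linear: "R \<in> T \<Longrightarrow> S \<in> T \<Longrightarrow> S \<subseteq> R \<or> R \<subseteq> S"
  using iter_gap decreasing by blast

lemma iter_fixpoint_least: assumes M: "M \<in> T" "\<Phi> M = M" and S: "S \<in> T" shows "M \<subseteq> S"
  using S
proof induction
  case iter_base then show ?case using iter_subset_base M by blast
next
  case (iter_step S) then show ?case using iter_psubset_step[OF M(1), of S] M(2) by blast
qed blast

text \<open>\<open>M\<close> is the supremum of \<open>D\<close> among the stages. If it were not
  attained, every member of \<open>D\<close> would lie below \<open>\<Phi> M\<close>, so
  \<open>M\<close> would be a fixed point; fixed points are contained in every stage, which forces
  \<open>M\<close> into \<open>D\<close> after all.\<close>

lemma iter_greatest:
  assumes D: "D \<noteq> {}" "D \<subseteq> T" shows "\<exists>R\<in>D. \<forall>S\<in>D. S \<subseteq> R"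
proof -
  let ?C = "{R \<in> T. \<forall>S\<in>D. S \<subseteq> R}"
  have ne: "R0 \<in> ?C" using D iter_subset_base iter_base by blast
  define M where "M = \<Inter>?C"
  have MT: "M \<in> T" unfolding M_def by (rule iter_Inter) (use ne in auto)
  have up: "\<forall>S\<in>D. S \<subseteq> M" by (auto simp: M_def)
  have "M \<in> D"
  proof (rule ccontr)
    assume n: "M \<notin> D"
    have "S \<subseteq> \<Phi> M" if S: "S \<in> D" for S
    proof (rule iter_psubset_step[OF _ MT])
      show "S \<in> T" using S D(2) by blast
      show "S \<subset> M" using S up n by (metis psubsetI)
    qed
    then have "\<Phi> M \<in> ?C" using iter_step[OF MT] by blast
    then have "M \<subseteq> \<Phi> M" unfolding M_def by blast
    then have "\<Phi> M = M" using decreasing[OF MT] by blast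
    then have least: "M \<subseteq> S" if "S \<in> D" for S using iter_fixpoint_least[OF MT] that D(2) by blast
    obtain S where S: "S \<in> D" using D(1) by blast
    then have "S = M" using least up by (metis subset_antisym)
    then show False using n S by simp
  qed
  then show ?thesis using up by blast
qed

lemma iter_bottom: "\<Inter>T \<in> T" "\<Phi> (\<Inter>T) = \<Inter>T"
proof -
  show 1: "\<Inter>T \<in> T" by (rule iter_Inter) (use iter_base in auto)
  show "\<Phi> (\<Inter>T) = \<Inter>T" using decreasing[OF 1] iter_step[OF 1] by blast
qed

section \<open>Transport of the stages to a prescribed index type\<close>

context
  fixes e :: "'a set \<Rightarrow> 'b"
  assumes e: "inj_on e (iter \<Phi> R0)"
begin

text \<open>\<open>PI_tower\<close> prescribes the type of its indices, so stages are indexed by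
  their codes under an injection \<open>e\<close>. Reverse inclusion makes the base stage the least
  index.\<close>

definition stage where "stage i = inv_into T e i"
definition ord where "ord = {(i, j). i \<in> e ` T \<and> j \<in> e ` T \<and> stage j \<subseteq> stage i}"

lemma stage_code: "R \<in> T \<Longrightarrow> stage (e R) = R"
  unfolding stage_def by (rule inv_into_f_f[OF e])

lemma stage_in: "i \<in> e ` T \<Longrightarrow> stage i \<in> T"
  unfolding stage_def by (rule inv_into_into)

lemma stage_inj: "i \<in> e ` T \<Longrightarrow> j \<in> e ` T \<Longrightarrow> stage i = stage j \<Longrightarrow> i = j"
  unfolding stage_def by (rule inv_into_injective)

lemma Field_ord: "Field ord = e ` T"
  unfolding Field_def ord_def by auto

lemma wo_less_ord: "wo_less ord i j \<longleftrightarrow> i \<in> e ` T \<and> j \<in> e ` T \<and> stage j \<subset> stage i"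
  using stage_inj[of i j] unfolding wo_less_def ord_def by blast

lemma Well_order_ord: "Well_order ord"
  unfolding order_on_defs Field_ord
proof (intro conjI)
  show "ord \<subseteq> e ` T \<times> e ` T" by (auto simp: ord_def)
  show "refl_on (e ` T) ord" by (auto simp: ord_def refl_on_def)
  show "trans ord" unfolding trans_def ord_def by blast
  show "antisym ord" unfolding antisym_def ord_def using stage_inj by blast
  show "total_on (e ` T) ord"
    using iter_linear stage_in unfolding total_on_def ord_def by blast
  show "wf (ord - Id)"
  proof (rule wfI_min)
    fix x and Q :: "'b set" assume x: "x \<in> Q"
    show "\<exists>z\<in>Q. \<forall>y. (y, z) \<in> ord - Id \<longrightarrow> y \<notin> Q"
    proof (cases "Q \<inter> e ` T = {}")
      case True then show ?thesis using x by (auto simp: ord_def)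
    next
      case False
      then have "stage ` (Q \<inter> e ` T) \<noteq> {}" "stage ` (Q \<inter> e ` T) \<subseteq> T" using stage_in by blast+
      then obtain R where "R \<in> stage ` (Q \<inter> e ` T)" "\<forall>S\<in>stage ` (Q \<inter> e ` T). S \<subseteq> R" using iter_greatest by metis
      then obtain z where z: "z \<in> Q" "z \<in> e ` T" "\<And>y. y \<in> Q \<Longrightarrow> y \<in> e ` T \<Longrightarrow> stage y \<subseteq> stage z" by auto
      have "y \<notin> Q" if "(y, z) \<in> ord - Id" for y
      proof
        assume "y \<in> Q"
        moreover have "y \<in> e ` T" "stage z \<subseteq> stage y" "y \<noteq> z" using that by (auto simp: ord_def)
        ultimately show False using z stage_inj by blast
      qed
      then show ?thesis using z(1) by blast
    qed
  qed
qed

text \<open>\<open>\<Phi> (stage i)\<close> contains every stage strictly below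
  \<open>stage i\<close>, so it alone can come next.\<close>

lemma wo_succ_ord:
  assumes "wo_succ ord i j" shows "stage j = \<Phi> (stage i)"
proof -
  have ij: "i \<in> e ` T" "j \<in> e ` T" "stage j \<subset> stage i" and
    no: "\<And>k. k \<in> e ` T \<Longrightarrow> \<not> (stage k \<subset> stage i \<and> stage j \<subset> stage k)"
    using assms unfolding wo_succ_def wo_less_ord by blast+
  have P: "\<Phi> (stage i) \<in> T" using iter_step[OF stage_in[OF ij(1)]] .
  have sub: "stage j \<subseteq> \<Phi> (stage i)" using iter_psubset_step[OF stage_in[OF ij(2)] stage_in[OF ij(1)] ij(3)] .
  have "\<Phi> (stage i) \<noteq> stage i"
    using iter_fixpoint_least[OF stage_in[OF ij(1)] _ stage_in[OF ij(2)]] ij(3) by blast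
  then have "\<Phi> (stage i) \<subset> stage i" using decreasing[OF stage_in[OF ij(1)]] by blast
  then show ?thesis using no[of "e (\<Phi> (stage i))"] P stage_code[OF P] sub by auto
qed

text \<open>If the intersection \<open>M\<close> of the earlier stages differed from
  \<open>stage g\<close>, the code of \<open>M\<close> would be an immediate predecessor of
  \<open>g\<close>.\<close>

lemma wo_limit_ord:
  assumes lim: "wo_limit ord (e R0) g"
  shows "stage g = \<Inter>(stage ` {l. wo_less ord l g})" "wo_less ord (e R0) g"
proof -
  have g: "g \<in> e ` T" "g \<noteq> e R0" and no: "\<not> (\<exists>a. wo_succ ord a g)"
    using lim unfolding wo_limit_def Field_ord by auto
  have z: "e R0 \<in> e ` T" using iter_base by blast
  have "stage g \<noteq> R0" using g stage_inj[OF g(1) z] stage_code[OF iter_base] by auto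
  then have "stage g \<subset> stage (e R0)" using iter_subset_base[OF stage_in[OF g(1)]] stage_code[OF iter_base] by auto
  then show zg: "wo_less ord (e R0) g" using g z by (simp add: wo_less_ord)
  define M where "M = \<Inter>(stage ` {l. wo_less ord l g})"
  have MT: "M \<in> T" unfolding M_def
  proof (rule iter_Inter)
    show "stage ` {l. wo_less ord l g} \<noteq> {}" using zg by blast
  qed (use stage_in wo_less_ord in blast)
  have sub: "stage g \<subseteq> M" by (auto simp: M_def wo_less_ord)
  have "stage g = M"
  proof (rule ccontr)
    assume "stage g \<noteq> M"
    then have less: "wo_less ord (e M) g" using sub MT g stage_code[OF MT] by (auto simp: wo_less_ord)
    have "\<not> (wo_less ord (e M) c \<and> wo_less ord c g)" for c
    proof
      assume c: "wo_less ord (e M) c \<and> wo_less ord c g"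
      then have "stage c \<subset> M" using stage_code[OF MT] by (simp add: wo_less_ord)
      moreover have "M \<subseteq> stage c" using c by (auto simp: M_def)
      ultimately show False by blast
    qed
    then show False using no less by (auto simp: wo_succ_def)
  qed
  then show "stage g = \<Inter>(stage ` {l. wo_less ord l g})" by (simp add: M_def)
qed

end
end

lemma extension_compose:
  assumes g: "extension W actW X actX g" and f: "extension X actX Y actY f"
  shows "extension W actW Y actY (f \<circ> g)"
  unfolding extension_def
proof (intro conjI allI ballI)
  have gx: "g x \<in> topspace X" if "x \<in> topspace W" for x
    using g imageI[OF that, of g] by (simp add: extension_def)
  show "continuous_map W Y (f \<circ> g)" 
    by (rule continuous_map_compose) (use f g in \<open>auto simp: extension_def\<close>)
  show "(f \<circ> g) ` topspace W = topspace Y" 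
    unfolding image_comp[symmetric] using f g by (simp add: extension_def)
  show "(f \<circ> g) (actW t x) = actY t ((f \<circ> g) x)" if "x \<in> topspace W" for t x
    using f g gx[OF that] that by (simp add: extension_def)
qed

context ellis_group begin

section \<open>The canonical PI tower\<close>

text \<open>A pair of ultrafilters is encoded by one family of sets: the members containing \<open>1\<close> are taken
  from the first, the others from the second component. Either half determines its ultrafilter by
  complementation.\<close>

definition code where "code R = (\<lambda>(U, V). {A \<in> U. 1 \<in> A} \<union> {A \<in> V. 1 \<notin> A}) ` R"

lemma inj_on_code: "inj_on code (Pow (I \<times> I))"
proof -
  have "inj_on (\<lambda>(U, V). {A \<in> U. 1 \<in> A} \<union> {A \<in> V. 1 \<notin> A}) (I \<times> I)"
  proof (rule inj_onI, clarify)
    fix U V U' V' assume I: "U \<in> I" "V \<in> I" "U' \<in> I" "V' \<in> I"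
      and eq: "{A \<in> U. 1 \<in> A} \<union> {A \<in> V. 1 \<notin> A} = {A \<in> U'. 1 \<in> A} \<union> {A \<in> V'. 1 \<notin> A}"
    have b: "U \<in> betaT" "V \<in> betaT" "U' \<in> betaT" "V' \<in> betaT" using I I_betaT by auto
    have 1: "A \<in> U \<longleftrightarrow> A \<in> U'" if "1 \<in> A" for A using eq that by blast
    have 2: "A \<in> V \<longleftrightarrow> A \<in> V'" if "1 \<notin> A" for A using eq that by blast
    have "A \<in> U \<longleftrightarrow> A \<in> U'" for A
      using 1[of A] 1[of "- A"] betaT_Compl[OF b(1), of A] betaT_Compl[OF b(3), of A] by (cases "1 \<in> A") auto
    moreover have "A \<in> V \<longleftrightarrow> A \<in> V'" for A
      using 2[of A] 2[of "- A"] betaT_Compl[OF b(2), of A] betaT_Compl[OF b(4), of A] by (cases "1 \<in> A") auto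
    ultimately show "U = U' \<and> V = V'" by blast
  qed
  then show ?thesis unfolding code_def by (rule inj_on_image_Pow)
qed

text \<open>Surjectivity needs compactness: a thread prescribes fibres in \<open>I\<close> that are
  closed, nonempty and nested, and any common point represents the thread. Injectivity holds because
  \<open>Rg\<close> is the intersection of the \<open>R l\<close>.\<close>

lemma inverse_limit_quotients:
  assumes L: "L \<noteq> {}" and R: "\<And>l. l \<in> L \<Longrightarrow> icer (R l)" and Rg: "icer Rg" "Rg = (\<Inter>l\<in>L. R l)"
    and ch: "\<And>l m. l \<in> L \<Longrightarrow> m \<in> L \<Longrightarrow> (l, m) \<in> r \<or> (m, l) \<in> r"
    and r: "\<And>l m. l \<in> L \<Longrightarrow> m \<in> L \<Longrightarrow> (l, m) \<in> r \<Longrightarrow> R m \<subseteq> R l"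
    and Ys: "\<And>l. l \<in> L \<Longrightarrow> Ys l = qtop (R l)"
  shows "homeomorphic_map (qtop Rg) (subtopology (product_topology Ys L)
      {f \<in> topspace (product_topology Ys L). \<forall>l\<in>L. \<forall>m\<in>L. (l, m) \<in> r \<longrightarrow> rep (R l) (f m) = f l})
      (\<lambda>y. restrict (\<lambda>l. rep (R l) y) L)" (is "homeomorphic_map _ (subtopology ?P ?S) ?h")
proof (rule continuous_imp_homeomorphic_map)
  have sub: "Rg \<subseteq> R l" if "l \<in> L" for l using that Rg(2) by blast
  have topP: "topspace ?P = (\<Pi>\<^sub>E l\<in>L. rep (R l) ` I)" using Ys by (auto simp: PiE_def Pi_def)
  have hS: "?h y \<in> ?S" if "y \<in> rep Rg ` I" for y
  proof -
    have y: "y \<in> I" using rep_image[OF Rg(1) that] .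
    have "rep (R l) (rep (R m) y) = rep (R l) y" if "l \<in> L" "m \<in> L" "(l, m) \<in> r" for l m
      using rep_rep[OF R[OF that(1)] r[OF that] R[OF that(2)] y] .
    then show ?thesis using y unfolding topP by auto
  qed
  have comp: "continuous_map (qtop Rg) (Ys l) (rep (R l))" if l: "l \<in> L" for l
    unfolding Ys[OF l]
    by (rule continuous_map_qtop[OF Rg(1) continuous_rep]) (rule rep_rep[OF R[OF l] sub[OF l] Rg(1)])
  then show "continuous_map (qtop Rg) (subtopology ?P ?S) ?h"
    unfolding continuous_map_in_subtopology continuous_map_componentwise using hS by auto
  show "compact_space (qtop Rg)" by (rule compact_qtop)
  show "Hausdorff_space (subtopology ?P ?S)"
    by (intro Hausdorff_space_subtopology) (simp add: Hausdorff_space_product_topology Ys Hausdorff_qtop R)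
  show "inj_on ?h (topspace (qtop Rg))"
  proof (rule inj_onI)
    fix x y assume xy: "x \<in> topspace (qtop Rg)" "y \<in> topspace (qtop Rg)" "?h x = ?h y"
    then have x: "x \<in> I" "y \<in> I" "rep Rg x = x" "rep Rg y = y"
      using rep_image[OF Rg(1), of x] rep_image[OF Rg(1), of y] rep_idem[OF Rg(1), of x] rep_idem[OF Rg(1), of y]
      by simp_all
    have "(x, y) \<in> R l" if l: "l \<in> L" for l
    proof -
      have "rep (R l) x = rep (R l) y" using fun_cong[OF xy(3), of l] l by simp
      then show ?thesis using rep_eq_iff[OF R[OF l]] x by blast
    qed
    then have "(x, y) \<in> Rg" using Rg(2) by blast
    then have "rep Rg x = rep Rg y" using rep_eq_iff[OF Rg(1)] x by blast
    then show "x = y" using x by simp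
  qed
  have "?S \<subseteq> ?h ` rep Rg ` I"
  proof
    fix f assume "f \<in> ?S"
    then have f: "f \<in> (\<Pi>\<^sub>E l\<in>L. rep (R l) ` I)" and th: "\<And>l m. l \<in> L \<Longrightarrow> m \<in> L \<Longrightarrow> (l, m) \<in> r \<Longrightarrow> rep (R l) (f m) = f l"
      unfolding topP by auto
    define C where "C l = {m \<in> topspace J. rep (R l) m \<in> {f l}}" for l
    have fl: "f l \<in> rep (R l) ` I" if "l \<in> L" for l using f that by (auto simp: PiE_def Pi_def)
    have C_mono: "C m \<subseteq> C l" if lm: "l \<in> L" "m \<in> L" "(l, m) \<in> r" for l m
    proof
      fix x assume "x \<in> C m"
      then have x: "x \<in> I" "rep (R m) x = f m" by (auto simp: C_def)
      then show "x \<in> C l" using rep_rep[OF R[OF lm(1)] r[OF lm] R[OF lm(2)] x(1)] th[OF lm] by (simp add: C_def)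
    qed
    have "\<Inter>(C ` L) \<noteq> {}"
    proof (rule compact_chain_Inter_nonempty[OF compact_J])
      show "C ` L \<noteq> {}" using L by simp
      fix A assume "A \<in> C ` L"
      then obtain l where l: "l \<in> L" "A = C l" by blast
      have "closedin (qtop (R l)) {f l}"
        using fl[OF l(1)] by (intro closedin_Hausdorff_singleton Hausdorff_qtop R l) simp
      then have "closedin J A" unfolding l(2) C_def by (rule closedin_continuous_map_preimage[OF continuous_rep])
      moreover have "A \<noteq> {}" using fl[OF l(1)] by (auto simp: l(2) C_def)
      ultimately show "closedin J A \<and> A \<noteq> {}" ..
    next
      fix A B assume "A \<in> C ` L" "B \<in> C ` L"
      then show "A \<subseteq> B \<or> B \<subseteq> A" using C_mono ch by (metis imageE)
    qed
    then obtain m where m: "\<And>l. l \<in> L \<Longrightarrow> m \<in> C l" by blast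
    have mI: "m \<in> I" using L m by (auto simp: C_def)
    have "f = ?h (rep Rg m)"
    proof
      fix l show "f l = ?h (rep Rg m) l"
      proof (cases "l \<in> L")
        case True
        then show ?thesis using rep_rep[OF R sub Rg(1) mI] m[OF True] by (simp add: C_def)
      next
        case False then show ?thesis using f by (auto simp: PiE_def extensional_def)
      qed
    qed
    then show "f \<in> ?h ` rep Rg ` I" using mI by blast
  qed
  then have "?h ` rep Rg ` I = ?S" using hS by blast
  moreover have "topspace (subtopology ?P ?S) = ?S" by auto
  ultimately show "?h ` topspace (qtop Rg) = topspace (subtopology ?P ?S)" by simp
qed

lemma iso_quotient_ker:
  assumes e: "extension J bact Z actZ \<phi>" and Z: "Hausdorff_space Z" and SR: "S = ker \<phi>"
  shows "iso_dynamic (qtop S) (qact S) Z actZ \<phi>"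
proof -
  have S: "icer S" unfolding SR by (rule icer_ker[OF e Z])
  have e': "extension (qtop S) (qact S) Z actZ \<phi>" by (rule extension_quotient[OF S e]) (simp add: SR)
  have "inj_on \<phi> (rep S ` I)"
  proof (rule inj_onI)
    fix x y assume xy: "x \<in> rep S ` I" "y \<in> rep S ` I" "\<phi> x = \<phi> y"
    then have "(x, y) \<in> S" using rep_image[OF S xy(1)] rep_image[OF S xy(2)] by (simp add: SR ker_def)
    then have "rep S x = rep S y" using rep_eq_iff[OF S] icer_subset[OF S] by metis
    then show "x = y" using rep_idem[OF S xy(1)] rep_idem[OF S xy(2)] by simp
  qed
  then have "homeomorphic_map (qtop S) Z \<phi>"
    using e' by (intro continuous_imp_homeomorphic_map compact_qtop Z) (auto simp: extension_def)
  then show ?thesis using e' by (simp add: iso_dynamic_def extension_def)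
qed

text \<open>Representatives of every stage are points of \<open>I\<close>, so all maps of the tower
  are functions \<open>rep (d i)\<close> and their compatibility is \<open>rep_rep\<close>. At the
  bottom the isomorphism onto \<open>Y\<close> is \<open>\<phi>\<close> itself, restricted to
  representatives.\<close>

lemma PI_tower_iteration:
  assumes it: "decreasing_iteration \<Phi> R0"
    and inv: "\<And>R. R \<in> iter \<Phi> R0 \<Longrightarrow> icer R"
    and S0: "\<Inter>(iter \<Phi> R0) = S0"
    and R0: "R0 = ker \<phi>" and e: "extension J bact Y actY \<phi>" and Y: "Hausdorff_space Y"
    and step: "\<And>R. R \<in> iter \<Phi> R0 \<Longrightarrow> proximal_ext (qtop (\<Phi> R)) (qact (\<Phi> R)) (rep R)
        \<or> ap_ext (qtop (\<Phi> R)) (qact (\<Phi> R)) (rep R)"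
  shows "PI_tower (qtop S0) (qact S0) Y actY \<phi>"
proof -
  interpret decreasing_iteration \<Phi> R0 by (rule it)
  have ic: "inj_on code T"
    by (rule inj_on_subset[OF inj_on_code]) (use inv icer_subset in auto)
  define r where "r = ord code"
  define d where "d = stage code"
  have d: "d i \<in> T" "icer (d i)" if "i \<in> code ` T" for i
    using stage_in[OF ic that] inv by (auto simp: d_def)
  have F: "Field r = code ` T" unfolding r_def by (rule Field_ord[OF ic])
  have r: "(i, j) \<in> r \<longleftrightarrow> i \<in> code ` T \<and> j \<in> code ` T \<and> d j \<subseteq> d i" for i j
    by (simp add: r_def d_def ord_def[OF ic])
  have dc: "d (code R) = R" if "R \<in> T" for R unfolding d_def by (rule stage_code[OF ic that])
  have S0T: "S0 \<in> T" using iter_bottom(1) S0 by simp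
  have R0T: "R0 \<in> T" by (rule iter_base)
  have S0sub: "S0 \<subseteq> R" if "R \<in> T" for R using S0 that by blast
  have iS0: "icer S0" by (rule inv[OF S0T])
  have ext: "extension (qtop S) (qact S) (qtop R) (qact R) (rep R)" if "icer S" "icer R" "S \<subseteq> R" for S R
    by (rule extension_quotient[OF that(1) extension_rep[OF that(2)]]) (simp add: ker_rep that)
  show ?thesis
    unfolding PI_tower_def
  proof (intro exI conjI)
    show "Well_order r" unfolding r_def by (rule Well_order_ord[OF ic])
    show "code R0 \<in> Field r" "code S0 \<in> Field r" using R0T S0T F by auto
    show "\<forall>a\<in>Field r. (code R0, a) \<in> r \<and> (a, code S0) \<in> r"
      using iter_subset_base S0sub d dc R0T S0T by (auto simp: F r)
    show "\<forall>g\<in>Field r. minimal_compact_dynamic (qtop (d g)) (qact (d g)) \<and>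
        extension (qtop S0) (qact S0) (qtop (d g)) (qact (d g)) (rep (d g))"
      using minimal_quotient ext[OF iS0] S0sub d unfolding F by blast
    have "\<phi> (rep R0 x) = \<phi> x" if "x \<in> topspace (qtop S0)" for x
      using rep_rel[OF inv[OF R0T], of x] rep_image[OF iS0, of x] that by (simp add: R0 ker_def)
    then show "iso_dynamic (qtop (d (code R0))) (qact (d (code R0))) Y actY \<phi>"
      "\<forall>x\<in>topspace (qtop S0). \<phi> (rep (d (code R0)) x) = \<phi> x"
      using iso_quotient_ker[OF e Y R0] dc[OF R0T] by simp_all
    show "\<forall>l\<in>Field r. \<forall>m\<in>Field r. (l, m) \<in> r \<longrightarrow>
        extension (qtop (d m)) (qact (d m)) (qtop (d l)) (qact (d l)) (rep (d l)) \<and>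
        (\<forall>x\<in>topspace (qtop S0). rep (d l) (rep (d m) x) = rep (d l) x)"
    proof (intro ballI impI conjI)
      fix l m assume lm: "l \<in> Field r" "m \<in> Field r" "(l, m) \<in> r"
      then have sub: "d m \<subseteq> d l" and ii: "icer (d l)" "icer (d m)" using d by (auto simp: r F)
      show "extension (qtop (d m)) (qact (d m)) (qtop (d l)) (qact (d l)) (rep (d l))" by (rule ext[OF ii(2,1) sub])
      fix x assume "x \<in> topspace (qtop S0)"
      then have "x \<in> I" using rep_image[OF iS0] by simp
      then show "rep (d l) (rep (d m) x) = rep (d l) x" by (rule rep_rep[OF ii(1) sub ii(2)])
    qed
    show "\<forall>a b. wo_succ r a b \<longrightarrow>
        proximal_ext (qtop (d b)) (qact (d b)) (rep (d a)) \<or> ap_ext (qtop (d b)) (qact (d b)) (rep (d a))"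
    proof (intro allI impI)
      fix a b assume ab: "wo_succ r a b"
      then have "a \<in> code ` T" using F by (auto simp: wo_succ_def wo_less_def r)
      moreover have "d b = \<Phi> (d a)" using wo_succ_ord[OF ic] ab by (simp add: r_def d_def)
      ultimately show "proximal_ext (qtop (d b)) (qact (d b)) (rep (d a)) \<or> ap_ext (qtop (d b)) (qact (d b)) (rep (d a))"
        using step d by simp
    qed
    show "\<forall>g. wo_limit r (code R0) g \<longrightarrow> inv_limit_cond r (\<lambda>g. qtop (d g)) (\<lambda>l m. rep (d l)) g"
    proof (intro allI impI)
      fix g assume lim: "wo_limit r (code R0) g"
      note lim' = wo_limit_ord[OF ic lim[unfolded r_def], folded r_def d_def]
      have g: "g \<in> code ` T" using lim F by (simp add: wo_limit_def)
      show "inv_limit_cond r (\<lambda>g. qtop (d g)) (\<lambda>l m. rep (d l)) g"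
        unfolding inv_limit_cond_def Let_def
      proof (rule inverse_limit_quotients)
        show "{l. wo_less r l g} \<noteq> {}" using lim'(2) by blast
        show "icer (d l)" if "l \<in> {l. wo_less r l g}" for l using that d by (auto simp: wo_less_def r)
        show "icer (d g)" by (rule d[OF g])
        show "d g = (\<Inter>l\<in>{l. wo_less r l g}. d l)" by (rule lim'(1))
        fix l m assume "l \<in> {l. wo_less r l g}" "m \<in> {l. wo_less r l g}"
        then have lm: "l \<in> code ` T" "m \<in> code ` T" by (auto simp: wo_less_def r)
        then show "(l, m) \<in> r \<or> (m, l) \<in> r" using iter_linear d by (auto simp: r)
        show "d m \<subseteq> d l" if "(l, m) \<in> r" using that by (simp add: r)
      qed simp
    qed
    show "iso_dynamic (qtop S0) (qact S0) (qtop (d (code S0))) (qact (d (code S0))) (rep (d (code S0)))"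
      unfolding dc[OF S0T] by (rule iso_quotient_ker[OF extension_rep[OF iS0] Hausdorff_qtop[OF iS0]]) (simp add: ker_rep iS0)
  qed
qed

text \<open>One step of the tower above a relation \<open>R\<close> with group \<open>K\<close>: first the maximal proximal extension
  \<open>I / N K\<close> with the same group, then the almost periodic extension with group \<open>A K'\<close>.\<close>

definition tower_step where "tower_step A R =
  (if R = N (grp R) then E (grp R) (gprod A (derv (grp R))) else N (grp R))"

text \<open>The invariant of the iteration is \<open>N A \<subseteq> R\<close>. It gives
  \<open>A \<subseteq> grp R\<close>, which makes the products \<open>A K'\<close> groups, and it
  keeps \<open>X' = I / N A\<close> above every stage.\<close>

lemma is_PI_of_stable_subset:
  assumes X: "Hausdorff_space X" and Y: "Hausdorff_space Y"
    and f: "extension X actX Y actY f" and piX: "extension J bact X actX piX"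
    and stab: "\<And>L. tcl L \<Longrightarrow> L \<subseteq> grp (ker (f \<circ> piX)) \<Longrightarrow> derv L = L \<Longrightarrow> L \<subseteq> grp (ker piX)"
  shows "is_PI X actX Y actY f"
proof -
  let ?\<phi> = "f \<circ> piX"
  have e: "extension J bact Y actY ?\<phi>"
    by (rule extension_compose[OF piX f])
  define A where "A = grp (ker piX)"
  define R0 where "R0 = ker ?\<phi>"
  let ?\<Phi> = "tower_step A"
  have iX: "icer (ker piX)" by (rule icer_ker[OF piX X])
  have iR0: "icer R0" unfolding R0_def by (rule icer_ker[OF e Y])
  have XR: "ker piX \<subseteq> R0" by (auto simp: ker_def R0_def)
  have tA: "tcl A" unfolding A_def by (rule tcl_grp[OF iX])
  have sA: "subgrp A" "A \<subseteq> G" using tA by (auto simp: tcl_def subgrp_def)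
  have iNA: "icer (N A)" by (rule icer_N[OF sA(1)])
  have NAX: "N A \<subseteq> ker piX" unfolding A_def by (rule N_grp_subset[OF iX])
  have grpN: "grp (N K) = K" if K: "tcl K" for K
  proof
    show "grp (N K) \<subseteq> K" using K by (simp add: tcl_def)
    have "K \<subseteq> G" using K by (auto simp: tcl_def subgrp_def)
    then show "K \<subseteq> grp (N K)" using N_graph[of K u] uI u_mult by (force simp: grp_def)
  qed
  have grp_mono: "grp R \<subseteq> grp S" if "R \<subseteq> S" for R S using that by (auto simp: grp_def)
  have props: "tcl (grp R)" "A \<subseteq> grp R" "tcl (gprod A (derv (grp R)))" "derv (grp R) \<subseteq> gprod A (derv (grp R))"
      "A \<subseteq> gprod A (derv (grp R))" "gprod A (derv (grp R)) \<subseteq> grp R"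
    if R: "icer R" "N A \<subseteq> R" for R
  proof -
    let ?K = "grp R"
    show K: "tcl ?K" by (rule tcl_grp[OF R(1)])
    then have sK: "subgrp ?K" by (simp add: tcl_def)
    show AK: "A \<subseteq> ?K" using grp_mono[OF R(2)] grpN[OF tA] by simp
    have sD: "subgrp (derv ?K)" by (rule subgrp_derv[OF sK])
    \<comment> \<open>\<open>A\<close> lies in \<open>?K\<close>, in which the derived group is
      normal; so \<open>A\<close> normalises the derived group and the two factors may be
      interchanged.\<close>
    have "gprod A (derv ?K) = gprod (derv ?K) A"
    proof (rule gprod_commute[OF sA(1) sD])
      fix a l assume al: "a \<in> A" "l \<in> derv ?K"
      then have aK: "a \<in> ?K" "a \<in> G" using AK sA by auto
      show "a \<odot> l \<odot> iv a \<in> derv ?K"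
        by (rule derv_normal[OF sK aK(2) subgrp_normal[OF sK aK(1)] al(2)])
    qed
    then show "tcl (gprod A (derv ?K))" by (rule tcl_gprod[OF tA tcl_derv[OF K]])
    show "derv ?K \<subseteq> gprod A (derv ?K)"
    proof
      fix x assume x: "x \<in> derv ?K"
      then show "x \<in> gprod A (derv ?K)"
        using gprodI[OF subgrpD(3)[OF sA(1)] x] subgrpD(1)[OF sD x] u_mult by simp
    qed
    show "A \<subseteq> gprod A (derv ?K)"
    proof
      fix x assume x: "x \<in> A"
      then show "x \<in> gprod A (derv ?K)"
        using gprodI[OF x subgrpD(3)[OF sD]] subgrpD(2)[OF sA(1) x] mult_u by simp
    qed
    show "gprod A (derv ?K) \<subseteq> ?K" using AK derv_subset subgrpD(4)[OF sK] by (fastforce simp: gprod_def)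
  qed
  have step_inv: "icer (?\<Phi> R) \<and> N A \<subseteq> ?\<Phi> R \<and> ?\<Phi> R \<subseteq> R" if R: "icer R" "N A \<subseteq> R" for R
  proof (cases "R = N (grp R)")
    case False
    have "subgrp (grp R)" using props(1)[OF R] by (simp add: tcl_def)
    then show ?thesis
      using False icer_N N_mono[OF props(2)[OF R]] N_grp_subset[OF R(1)] by (simp add: tower_step_def)
  next
    case True
    have "N A \<subseteq> E (grp R) (gprod A (derv (grp R)))"
      using N_mono[OF props(2)[OF R]] tclD(2)[OF tA] props(5)[OF R] by (auto simp: E_def)
    moreover have "E (grp R) (gprod A (derv (grp R))) \<subseteq> R" using True by (auto simp: E_def)
    moreover have "icer (E (grp R) (gprod A (derv (grp R))))" by (rule icer_E[OF props(1,3,4,6)[OF R]])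
    ultimately show ?thesis using True by (simp add: tower_step_def)
  qed
  have inv: "icer R \<and> N A \<subseteq> R" if "R \<in> iter ?\<Phi> R0" for R
    using that
  proof induction
    case iter_base then show ?case using iR0 NAX XR by blast
  next
    case (iter_step R) then show ?case using step_inv by blast
  next
    case (iter_Inter C)
    have "closedin JJ (\<Inter>C)" using iter_Inter icer_closed by (intro closedin_Inter) auto
    moreover have "sym (\<Inter>C)" using iter_Inter.IH icer_sym by (meson Inter_iff symI)
    moreover have "trans (\<Inter>C)" using iter_Inter.IH icer_trans by (meson Inter_iff transI)
    moreover have "(bact t m, bact t n) \<in> \<Inter>C" if "(m, n) \<in> \<Inter>C" for t m n
      using iter_Inter.IH icer_act that by (meson Inter_iff)
    moreover have "(m, m) \<in> \<Inter>C" if "m \<in> I" for m using iter_Inter.IH icer_refl that by (meson Inter_iff)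
    ultimately show ?case using iter_Inter.IH unfolding icer_def by blast
  qed
  interpret decreasing_iteration ?\<Phi> R0
    using step_inv inv by unfold_locales blast
  define S where "S = \<Inter>(iter ?\<Phi> R0)"
  have ST: "S \<in> T" and fix_S: "?\<Phi> S = S" using iter_bottom by (simp_all add: S_def)
  have iS: "icer S" "N A \<subseteq> S" using inv[OF ST] by auto
  let ?K = "grp S"
  note pS = props[OF iS]
  \<comment> \<open>At the fixed point neither branch of the step moves: if \<open>S\<close> were
    not \<open>N\<close> of its group, the step would return exactly that relation.\<close>
  have SN: "S = N ?K"
    using fix_S unfolding tower_step_def by (metis (full_types))
  then have "E ?K (gprod A (derv ?K)) = S" using fix_S unfolding tower_step_def by (metis (full_types))
  then have "?K = gprod A (derv ?K)" using grp_E[OF pS(1) pS(6)] by simp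
  moreover have "L \<subseteq> A" if L: "tcl L" "L \<subseteq> ?K" "derv L = L" for L
    unfolding A_def
  proof (rule stab[OF L(1) _ L(3)])
    show "L \<subseteq> grp (ker ?\<phi>)" using L(2) grp_mono[OF iter_subset_base[OF ST]] by (auto simp: R0_def)
  qed
  ultimately have "?K = A" using eq_of_derived_supplement[OF tA pS(1,2)] by blast
  then have S_eq: "S = N A" using SN by simp
  have "PI_tower (qtop (N A)) (qact (N A)) Y actY ?\<phi>"
  proof (rule PI_tower_iteration[OF decreasing_iteration_axioms _ _ R0_def e Y])
    show "\<Inter>(iter ?\<Phi> R0) = N A" using S_eq by (simp add: S_def)
    fix R assume "R \<in> iter ?\<Phi> R0"
    then have R: "icer R" "N A \<subseteq> R" using inv by auto
    then show "icer R" by simp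
    show "proximal_ext (qtop (?\<Phi> R)) (qact (?\<Phi> R)) (rep R) \<or> ap_ext (qtop (?\<Phi> R)) (qact (?\<Phi> R)) (rep R)"
    proof (cases "R = N (grp R)")
      case False
      have "proximal_ext (qtop (N (grp R))) (qact (N (grp R))) (rep R)"
      proof (rule proximal_quotient[OF _ extension_rep[OF R(1)]])
        show "icer (N (grp R))" using props(1)[OF R] icer_N by (simp add: tcl_def)
        show "N (grp R) \<subseteq> ker (rep R)" using N_grp_subset[OF R(1)] ker_rep[OF R(1)] by simp
        show "Hausdorff_space (qtop R)" by (rule Hausdorff_qtop[OF R(1)])
        show "grp (ker (rep R)) \<subseteq> grp (N (grp R))" using grpN[OF props(1)[OF R]] ker_rep[OF R(1)] by simp
      qed
      then show ?thesis using False by (simp add: tower_step_def)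
    next
      case True
      have "ap_ext (qtop (?\<Phi> R)) (qact (?\<Phi> R)) (rep (N (grp R)))"
        using ap_quotient[OF props(1,3,4,6)[OF R]] True by (simp add: tower_step_def)
      then show ?thesis using True by simp
    qed
  qed
  moreover have "proximal_ext (qtop (N A)) (qact (N A)) piX"
    by (rule proximal_quotient[OF iNA piX NAX X]) (simp add: grpN[OF tA] A_def[symmetric])
  ultimately show ?thesis
    unfolding is_PI_def using minimal_quotient[OF iNA] extension_quotient[OF iNA piX NAX] by blast
qed


section \<open>Automorphisms as right multiplications\<close>

text \<open>The graph of \<open>a\<close> is closed and \<open>a\<close> commutes with the monoid,
  so \<open>a\<close> commutes with left multiplication by elements of \<open>I\<close>; then
  \<open>a m = a (m u) = m (a u)\<close>.\<close>

lemma Aut_mult: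
  assumes a: "a \<in> Aut I" shows "a u \<in> G" "\<And>m. m \<in> I \<Longrightarrow> a m = m \<odot> a u"
proof -
  have c: "continuous_map J J a" using a by (simp add: Aut_def homeomorphic_imp_continuous_map)
  have aI: "a m \<in> I" if "m \<in> I" for m using continuous_map_image_subset_topspace[OF c] that by auto
  have eq: "a (bact t m) = bact t (a m)" if "m \<in> I" for t m using a that by (simp add: Aut_def)
  let ?R = "{w \<in> topspace JJ. (a \<circ> fst) w = snd w}"
  have cl: "closedin JJ ?R"
    by (intro closedin_continuous_maps_eq[OF Hausdorff_J] continuous_map_compose[OF continuous_map_fst c] continuous_map_snd)
  have am: "a (p \<odot> m) = p \<odot> a m" if "p \<in> I" "m \<in> I" for p m
  proof -
    have "(p \<odot> m, p \<odot> a m) \<in> ?R"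
      by (rule closed_invariant_mult[OF cl]) (use that eq aI I_act I_betaT in auto)
    then show ?thesis by simp
  qed
  show "a u \<in> G" using am[OF uI uI] aI[OF uI] uu by (simp add: G_def)
  show "a m = m \<odot> a u" if "m \<in> I" for m using am[OF that uI] mult_u[OF that] by simp
qed

lemma rmult_Aut: assumes g: "g \<in> G" shows "(\<lambda>m. m \<odot> g) \<in> Aut I"
proof -
  have inj: "inj_on (\<lambda>m. m \<odot> g) I" 
    by (rule inj_on_inverseI[of _ "\<lambda>m. m \<odot> iv g"]) (rule iv_cancel(1)[OF g])
  have surj: "(\<lambda>m. m \<odot> g) ` I = I"
  proof
    show "(\<lambda>m. m \<odot> g) ` I \<subseteq> I" using g by (auto simp: I_mult' G_I)
    show "I \<subseteq> (\<lambda>m. m \<odot> g) ` I"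
    proof
      fix m assume m: "m \<in> I"
      show "m \<in> (\<lambda>m. m \<odot> g) ` I"
        by (rule image_eqI[of _ _ "m \<odot> iv g"]) (use m g iv_cancel(2) in \<open>auto simp: I_mult' iv_G G_I\<close>)
    qed
  qed
  have "homeomorphic_map J J (\<lambda>m. m \<odot> g)"
    by (rule continuous_imp_homeomorphic_map) (use inj surj g in \<open>auto simp: continuous_rmult_J compact_J Hausdorff_J G_I\<close>)
  then show ?thesis by (simp add: Aut_def bact_bmult)
qed

text \<open>Elements of \<open>Aut I\<close> are arbitrary outside \<open>I\<close>; \<open>determined H\<close> says that membership in \<open>H\<close> only
  depends on the values on \<open>I\<close>, that is, on the corresponding element of \<open>G\<close>.\<close>

definition mults where "mults H = {g \<in> G. (\<lambda>m. m \<odot> g) \<in> H}"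
definition determined where "determined H \<longleftrightarrow> subgrp (mults H) \<and> H = {a \<in> Aut I. a u \<in> mults H}"

lemma determined_iff: "determined H \<Longrightarrow> a \<in> H \<longleftrightarrow> a \<in> Aut I \<and> a u \<in> mults H"
  unfolding determined_def by blast

lemma determinedI: assumes V: "subgrp V" and H: "\<And>a. a \<in> H \<longleftrightarrow> a \<in> Aut I \<and> a u \<in> V"
  shows "determined H" "mults H = V"
proof -
  show v: "mults H = V" using H rmult_Aut u_mult subgrpD(1)[OF V] by (auto simp: mults_def)
  show "determined H" unfolding determined_def v using V H by blast
qed

lemma determined_Fgrp: assumes "icer (ker \<phi>)" shows "determined (Fgrp I \<phi>)" "mults (Fgrp I \<phi>) = grp (ker \<phi>)"
proof -
  have "a \<in> Fgrp I \<phi> \<longleftrightarrow> a \<in> Aut I \<and> a u \<in> grp (ker \<phi>)" for a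
  proof (cases "a \<in> Aut I")
    case True
    note am = Aut_mult[OF True]
    have "(\<forall>m\<in>I. \<phi> (a m) = \<phi> m) \<longleftrightarrow> a u \<in> grp (ker \<phi>)"
    proof
      assume "\<forall>m\<in>I. \<phi> (a m) = \<phi> m"
      then show "a u \<in> grp (ker \<phi>)" using am(1) uI G_I by (simp add: grp_def ker_def)
    next
      assume g: "a u \<in> grp (ker \<phi>)"
      have "\<phi> (a m) = \<phi> m" if "m \<in> I" for m
        using icer_graph[OF assms g that] am(2)[OF that] by (simp add: ker_def)
      then show "\<forall>m\<in>I. \<phi> (a m) = \<phi> m" by blast
    qed
    then show ?thesis using True by (simp add: Fgrp_def)
  qed (simp add: Fgrp_def)
  from determinedI[OF subgrp_grp[OF assms] this]
  show "determined (Fgrp I \<phi>)" "mults (Fgrp I \<phi>) = grp (ker \<phi>)" .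
qed

section \<open>\<tau>-convergence of automorphisms and inseparability\<close>

lemma tau_conv_eventually:
  assumes t: "tau_conv I F d a" and a: "a \<in> Aut I" and W: "openin JJ W" "hits W (a u)"
  shows "eventually (\<lambda>i. \<exists>m\<in>I. (m, d i m) \<in> W) F"
proof -
  obtain m where m: "m \<in> I" "(m, a m) \<in> W" using W(2) Aut_mult(2)[OF a] by (auto simp: hits_def)
  obtain g where g: "limitin J g m F" "limitin J (\<lambda>i. d i (g i)) (a m) F"
    using t m(1) unfolding tau_conv_def by blast
  obtain U V where UV: "openin J U" "openin J V" "m \<in> U" "a m \<in> V" "U \<times> V \<subseteq> W"
    using W(1) m(2) unfolding openin_prod_topology_alt by metis
  have "eventually (\<lambda>i. g i \<in> U) F" "eventually (\<lambda>i. d i (g i) \<in> V) F" using g UV by (simp_all add: limitin_def)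
  then show ?thesis
  proof eventually_elim
    case (elim i)
    then have "(g i, d i (g i)) \<in> W" "g i \<in> I" using UV openin_subset[OF UV(1)] by auto
    then show ?case by blast
  qed
qed

text \<open>Since the graph of an automorphism is a minimal set, finitely many neighbourhoods of points of it
  can be pulled back into a single one.\<close>

lemma finite_hits:
  assumes X: "finite X" "\<And>m W. (m, W) \<in> X \<Longrightarrow> m \<in> I \<and> openin JJ W \<and> (m, m \<odot> g) \<in> W" and g: "g \<in> G"
  obtains V where "openin JJ V" "hits V g"
    "\<And>k. k \<in> G \<Longrightarrow> hits V k \<Longrightarrow> \<exists>h. \<forall>(m, W)\<in>X. (h m, h m \<odot> k) \<in> W"
proof -
  define Wm where "Wm m = (\<Inter>W\<in>snd ` {x \<in> X. fst x = m}. W) \<inter> topspace JJ" for m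
  have Wo: "openin JJ (Wm m)" for m
    unfolding Wm_def by (rule openin_INT) (use X in auto)
  have Wsub: "Wm m \<subseteq> W" if "(m, W) \<in> X" for m W using that by (force simp: Wm_def)
  have Wg: "(m, m \<odot> g) \<in> Wm m" if m: "m \<in> fst ` X" for m
  proof -
    have "m \<in> I" using m X(2) by auto
    then show ?thesis using X(2) g by (auto simp: Wm_def I_mult' G_I)
  qed
  have "\<exists>t. (bact t u, bact t u \<odot> g) \<in> Wm m" if m: "m \<in> fst ` X" for m
  proof -
    have "m \<in> I" using m X(2) by auto
    then have "hits (Wm m) g" using Wg[OF m] by (rule hitsI)
    then show ?thesis using graph_orbit[OF Wo _ G_I[OF g] uI] by metis
  qed
  then obtain t where t: "\<And>m. m \<in> fst ` X \<Longrightarrow> (bact (t m) u, bact (t m) u \<odot> g) \<in> Wm m" by metis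
  define V where "V = (\<Inter>m\<in>fst ` X. {(x, y). x \<in> I \<and> y \<in> I \<and> (bact (t m) x, bact (t m) y) \<in> Wm m}) \<inter> topspace JJ"
  show thesis
  proof (rule that)
    show "openin JJ V" unfolding V_def by (rule openin_INT) (use X openin_JJ_act[OF Wo] in auto)
    have "(u, u \<odot> g) \<in> V" using t uI G_I[OF g] I_mult' by (auto simp: V_def bact_bmult)
    then show "hits V g" by (rule hitsI[OF uI])
    fix k assume k: "k \<in> G" "hits V k"
    then obtain x where x: "x \<in> I" "(x, x \<odot> k) \<in> V" by (auto simp: hits_def)
    have "(bact (t m) x, bact (t m) x \<odot> k) \<in> W" if mW: "(m, W) \<in> X" for m W
    proof -
      have "m \<in> fst ` X" using mW by force
      then have "(bact (t m) x, bact (t m) (x \<odot> k)) \<in> Wm m" using x(2) by (auto simp: V_def)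
      then show ?thesis using Wsub[OF mW] by (auto simp: bact_bmult)
    qed
    then show "\<exists>h. \<forall>(m, W)\<in>X. (h m, h m \<odot> k) \<in> W" by (intro exI[of _ "\<lambda>m. bact (t m) x"]) blast
  qed
qed

text \<open>Convergence of a net of automorphisms needs approximating points for every
  \<open>m\<close> at the same time. The filter therefore lives on triples
  \<open>(\<delta>, g, h)\<close>, where \<open>g\<close> and \<open>h\<close> choose these points
  for the limits \<open>a\<close> and \<open>id\<close>. It is proper because
  \<open>finite_hits\<close> condenses finitely many requirements for one limit into a single open
  set, to which inseparability applies.\<close>

lemma derived_iff:
  assumes H: "determined H"
  shows "a \<in> derived I H \<longleftrightarrow> a \<in> H \<and> nonsep (mults H) (a u) u"
proof (intro iffI conjI)
  assume "a \<in> derived I H"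
  then obtain F :: "(('t set set \<Rightarrow> 't set set) \<times> ('t set set \<Rightarrow> 't set set) \<times> ('t set set \<Rightarrow> 't set set)) filter"
    where aH: "a \<in> H" and F: "F \<noteq> bot" "eventually (\<lambda>i. fst i \<in> H) F" "tau_conv I F fst a" "tau_conv I F fst id"
    unfolding derived_def by blast
  then show "a \<in> H" by simp
  have aA: "a \<in> Aut I" using aH determined_iff[OF H] by blast
  have idA: "id \<in> Aut I" by (simp add: Aut_def)
  show "nonsep (mults H) (a u) u"
    unfolding nonsep_def
  proof (intro allI impI)
    fix V W assume VW: "openin JJ V" "openin JJ W" "hits V (a u)" "hits W u"
    have W': "hits W (id u)" using VW(4) by simp
    have ev: "eventually (\<lambda>i. fst i \<in> H \<and> (\<exists>m\<in>I. (m, fst i m) \<in> V) \<and> (\<exists>m\<in>I. (m, fst i m) \<in> W)) F"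
      using F(2) tau_conv_eventually[OF F(3) aA VW(1,3)] tau_conv_eventually[OF F(4) idA VW(2) W']
      by eventually_elim blast
    obtain \<delta> where i: "\<delta> \<in> H" "\<exists>m\<in>I. (m, \<delta> m) \<in> V" "\<exists>m\<in>I. (m, \<delta> m) \<in> W"
      using eventually_happens'[OF F(1) ev] by blast
    have "\<delta> \<in> Aut I" "\<delta> u \<in> mults H" using i(1) determined_iff[OF H] by auto
    moreover have "hits V (\<delta> u)" "hits W (\<delta> u)"
      using i(2,3) Aut_mult(2)[OF \<open>\<delta> \<in> Aut I\<close>] by (auto intro: hitsI)
    ultimately show "\<exists>k\<in>mults H. hits V k \<and> hits W k" by blast
  qed
next
  assume "a \<in> H \<and> nonsep (mults H) (a u) u"
  then have aH: "a \<in> H" and ns: "nonsep (mults H) (a u) u" by auto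
  have aA: "a \<in> Aut I" using aH determined_iff[OF H] by blast
  note am = Aut_mult[OF aA]
  define B1 where "B1 = {(m, W). m \<in> I \<and> openin JJ W \<and> (m, a m) \<in> W}"
  define B2 where "B2 = {(m, W). m \<in> I \<and> openin JJ W \<and> (m, m) \<in> W}"
  define P where "P = (\<lambda>((m, W), (n, V)). {(\<delta>, g, h). \<delta> \<in> H \<and>
    ((g :: 't set set \<Rightarrow> 't set set) m, \<delta> (g m)) \<in> W \<and> ((h :: 't set set \<Rightarrow> 't set set) n, \<delta> (h n)) \<in> V})"
  define F where "F = (INF x\<in>B1 \<times> B2. principal (P x))"
  have "F \<noteq> bot"
    unfolding F_def
  proof (rule INF_filter_not_bot)
    fix X assume X: "X \<subseteq> B1 \<times> B2" "finite X"
    obtain V1 where V1: "openin JJ V1" "hits V1 (a u)"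
      "\<And>k. k \<in> G \<Longrightarrow> hits V1 k \<Longrightarrow> \<exists>h. \<forall>(m, W)\<in>fst ` X. (h m, h m \<odot> k) \<in> W"
    proof (rule finite_hits[of "fst ` X" "a u"])
      show "m \<in> I \<and> openin JJ W \<and> (m, m \<odot> a u) \<in> W" if "(m, W) \<in> fst ` X" for m W
        using that X(1) am(2)[of m] by (auto simp: B1_def)
    qed (use X am in auto)
    obtain V2 where V2: "openin JJ V2" "hits V2 u"
      "\<And>k. k \<in> G \<Longrightarrow> hits V2 k \<Longrightarrow> \<exists>h. \<forall>(m, W)\<in>snd ` X. (h m, h m \<odot> k) \<in> W"
    proof (rule finite_hits[of "snd ` X" u])
      show "m \<in> I \<and> openin JJ W \<and> (m, m \<odot> u) \<in> W" if "(m, W) \<in> snd ` X" for m W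
        using that X(1) mult_u[of m] by (auto simp: B2_def)
    qed (use X u_G in auto)
    obtain k where k: "k \<in> mults H" "hits V1 k" "hits V2 k" using nonsepD[OF ns V1(1) V2(1) V1(2) V2(2)] by blast
    have kG: "k \<in> G" using k(1) by (simp add: mults_def)
    obtain g where g: "\<forall>(m, W)\<in>fst ` X. (g m, g m \<odot> k) \<in> W" using V1(3)[OF kG k(2)] by blast
    obtain h where h: "\<forall>(m, W)\<in>snd ` X. (h m, h m \<odot> k) \<in> W" using V2(3)[OF kG k(3)] by blast
    have kH: "(\<lambda>m. m \<odot> k) \<in> H" using k(1) by (simp add: mults_def)
    have "((\<lambda>m. m \<odot> k), g, h) \<in> P x" if x: "x \<in> X" for x
    proof -
      obtain m W n V where mW: "x = ((m, W), (n, V))" by (metis surj_pair)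
      have "(m, W) \<in> fst ` X" "(n, V) \<in> snd ` X" using x mW by force+
      then show ?thesis using g h kH unfolding P_def mW by auto
    qed
    then have "(\<Inter>x\<in>X. P x) \<noteq> {}" by blast
    then show "(INF x\<in>X. principal (P x)) \<noteq> bot" using X(2) by (simp add: INF_principal_finite principal_eq_bot_iff)
  qed
  have evP: "eventually (\<lambda>i. i \<in> P x) F" if "x \<in> B1 \<times> B2" for x
    unfolding F_def by (rule eventually_INF1[OF that]) (simp add: eventually_principal)
  \<comment> \<open>\<open>(u, topspace JJ)\<close> is the trivial requirement; it fills one
    component of the index when a condition on the other is extracted.\<close>
  have oJJ: "openin JJ (I \<times> I)" using openin_topspace[of JJ] by simp
  then have top2: "(u, topspace JJ) \<in> B2" using uI by (simp add: B2_def)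
  have aI: "a m \<in> I" if "m \<in> I" for m using am that by (simp add: I_mult' G_I)
  have top1: "(u, topspace JJ) \<in> B1" using uI aI oJJ by (simp add: B1_def)
  have 1: "eventually (\<lambda>i. (fst (snd i) m, fst i (fst (snd i) m)) \<in> W) F" if "(m, W) \<in> B1" for m W
    by (rule eventually_mono[OF evP[of "((m, W), (u, topspace JJ))"]]) (use that top2 in \<open>auto simp: P_def\<close>)
  have 2: "eventually (\<lambda>i. (snd (snd i) m, fst i (snd (snd i) m)) \<in> W) F" if "(m, W) \<in> B2" for m W
    by (rule eventually_mono[OF evP[of "((u, topspace JJ), (m, W))"]]) (use that top1 in \<open>auto simp: P_def\<close>)
  have "eventually (\<lambda>i. fst i \<in> H) F"
    by (rule eventually_mono[OF evP[of "((u, topspace JJ), (u, topspace JJ))"]]) (use top1 top2 in \<open>auto simp: P_def\<close>)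
  moreover have "tau_conv I F fst a"
    unfolding tau_conv_def
  proof (intro ballI exI[of _ "\<lambda>i. fst (snd i) m" for m] conjI)
    fix m assume m: "m \<in> I"
    show "limitin J (\<lambda>i. fst (snd i) m) m F"
      unfolding limitin_def
    proof (intro conjI allI impI)
      fix U assume "openin J U \<and> m \<in> U"
      then have "(m, U \<times> I) \<in> B1" using m aI openin_topspace[of J] by (auto simp: B1_def openin_prod_Times_iff)
      from 1[OF this] show "eventually (\<lambda>i. fst (snd i) m \<in> U) F" by (rule eventually_mono) auto
    qed (use m in simp)
    show "limitin J (\<lambda>i. fst i (fst (snd i) m)) (a m) F"
      unfolding limitin_def
    proof (intro conjI allI impI)
      fix U assume "openin J U \<and> a m \<in> U"
      then have "(m, I \<times> U) \<in> B1" using m aI openin_topspace[of J] by (auto simp: B1_def openin_prod_Times_iff)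
      from 1[OF this] show "eventually (\<lambda>i. fst i (fst (snd i) m) \<in> U) F" by (rule eventually_mono) auto
    qed (use m aI in simp)
  qed
  moreover have "tau_conv I F fst id"
    unfolding tau_conv_def
  proof (intro ballI exI[of _ "\<lambda>i. snd (snd i) m" for m] conjI)
    fix m assume m: "m \<in> I"
    show "limitin J (\<lambda>i. snd (snd i) m) m F"
      unfolding limitin_def
    proof (intro conjI allI impI)
      fix U assume "openin J U \<and> m \<in> U"
      then have "(m, U \<times> I) \<in> B2" using m openin_topspace[of J] by (auto simp: B2_def openin_prod_Times_iff)
      from 2[OF this] show "eventually (\<lambda>i. snd (snd i) m \<in> U) F" by (rule eventually_mono) auto
    qed (use m in simp)
    show "limitin J (\<lambda>i. fst i (snd (snd i) m)) (id m) F"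
      unfolding limitin_def
    proof (intro conjI allI impI)
      fix U assume "openin J U \<and> id m \<in> U"
      then have "(m, I \<times> U) \<in> B2" using m openin_topspace[of J] by (auto simp: B2_def openin_prod_Times_iff)
      from 2[OF this] show "eventually (\<lambda>i. fst i (snd (snd i) m) \<in> U) F" by (rule eventually_mono) auto
    qed (use m in simp)
  qed
  ultimately show "a \<in> derived I H" using aH \<open>F \<noteq> bot\<close> unfolding derived_def by blast
qed

lemma determined_derived: assumes "determined H" shows "determined (derived I H)" "mults (derived I H) = derv (mults H)"
proof -
  have "a \<in> derived I H \<longleftrightarrow> a \<in> Aut I \<and> a u \<in> derv (mults H)" for a
    using derived_iff[OF assms, of a] determined_iff[OF assms, of a] by (auto simp: derv_def)
  from determinedI[OF subgrp_derv this] assms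
  show "determined (derived I H)" "mults (derived I H) = derv (mults H)" by (simp_all add: determined_def)
qed

lemma determined_Inter:
  assumes C: "C \<noteq> {}" "\<And>H. H \<in> C \<Longrightarrow> determined H"
  shows "determined (\<Inter>C)" "mults (\<Inter>C) = \<Inter>(mults ` C)"
proof -
  obtain H0 where H0: "H0 \<in> C" using C(1) by blast
  have s: "subgrp (mults H)" if "H \<in> C" for H using C(2)[OF that] by (simp add: determined_def)
  have "subgrp (\<Inter>(mults ` C))"
    unfolding subgrp_def
  proof (intro conjI ballI)
    show "\<Inter>(mults ` C) \<subseteq> G" using H0 by (auto simp: mults_def)
  qed (use subgrpD[OF s] in auto)
  moreover have "a \<in> \<Inter>C \<longleftrightarrow> a \<in> Aut I \<and> a u \<in> \<Inter>(mults ` C)" for a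
  proof
    assume "a \<in> \<Inter>C"
    then have "a \<in> Aut I \<and> a u \<in> mults H" if "H \<in> C" for H using determined_iff[OF C(2)[OF that]] that by blast
    then show "a \<in> Aut I \<and> a u \<in> \<Inter>(mults ` C)" using H0 by blast
  next
    assume "a \<in> Aut I \<and> a u \<in> \<Inter>(mults ` C)"
    then have "a \<in> H" if "H \<in> C" for H using determined_iff[OF C(2)[OF that]] that by blast
    then show "a \<in> \<Inter>C" by blast
  qed
  ultimately show "determined (\<Inter>C)" "mults (\<Inter>C) = \<Inter>(mults ` C)" by (rule determinedI[of "\<Inter>(mults ` C)" "\<Inter>C"])+
qed

section \<open>The stable value of the derived sequence\<close>

lemma determined_Fseq: "H \<in> Fseq I F \<Longrightarrow> determined F \<Longrightarrow> determined H"
proof (induction rule: Fseq.induct)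
  case (deriv H) then show ?case by (simp add: determined_derived(1))
next
  case (inter C) then show ?case by (intro determined_Inter(1))
qed

lemma Finf_Fseq: "Finf I F \<in> Fseq I F"
  unfolding Finf_def by (rule Fseq.inter) (use Fseq.base in auto)

lemma derv_mono: "K \<subseteq> L \<Longrightarrow> derv K \<subseteq> derv L"
  unfolding derv_def nonsep_def by (blast dest: subsetD)

text \<open>The stable value is itself a member of the family, so its derived group is a member as
  well and contains it. A set fixed by \<open>derv\<close> stays inside every member by
  monotonicity; this maximality is what the groups found at the end of the tower are compared
  with.\<close>

lemma mults_Finf:
  assumes F: "determined F"
  shows "determined (Finf I F)" "mults (Finf I F) \<subseteq> mults F" "mults (Finf I F) \<subseteq> derv (mults (Finf I F))"
    "\<And>L. L \<subseteq> mults F \<Longrightarrow> derv L = L \<Longrightarrow> L \<subseteq> mults (Finf I F)"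
proof -
  show g: "determined (Finf I F)" by (rule determined_Fseq[OF Finf_Fseq F])
  have "Finf I F \<subseteq> F" unfolding Finf_def using Fseq.base by blast
  then show "mults (Finf I F) \<subseteq> mults F" by (auto simp: mults_def)
  have "Finf I F \<subseteq> derived I (Finf I F)" using Fseq.deriv[OF Finf_Fseq] unfolding Finf_def by blast
  then have "mults (Finf I F) \<subseteq> mults (derived I (Finf I F))" by (auto simp: mults_def)
  then show "mults (Finf I F) \<subseteq> derv (mults (Finf I F))" using determined_derived(2)[OF g] by simp
  fix L assume L: "L \<subseteq> mults F" "derv L = L"
  have "L \<subseteq> mults H" if "H \<in> Fseq I F" for H
    using that
  proof induction
    case (deriv H) then show ?case using determined_derived(2)[OF determined_Fseq[OF deriv.hyps F]] derv_mono[of L] L(2) by auto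
  next
    case (inter C)
    have "mults (\<Inter>C) = \<Inter>(mults ` C)"
      by (rule determined_Inter(2)[OF inter.hyps(2) determined_Fseq[OF inter.hyps(1) F]])
    then show ?case using inter.IH by simp blast
  qed (rule L(1))
  then show "L \<subseteq> mults (Finf I F)" using Finf_Fseq by blast
qed

lemma Minf_eq:
  assumes "determined (Fgrp I (f \<circ> piX))"
  shows "Minf X f I piX = (\<lambda>(m, n). (piX m, piX n)) ` N (mults (Finf I (Fgrp I (f \<circ> piX))))"
proof -
  let ?H = "Finf I (Fgrp I (f \<circ> piX))"
  have g: "determined ?H" by (rule mults_Finf(1)[OF assms])
  have "(\<Union>a\<in>?H. Gamma I a) = {(m, m \<odot> g) | m g. m \<in> I \<and> g \<in> mults ?H}"
  proof (intro equalityI subsetI)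
    fix z assume "z \<in> (\<Union>a\<in>?H. Gamma I a)"
    then obtain a m where a: "a \<in> ?H" "m \<in> I" "z = (m, a m)" by (auto simp: Gamma_def)
    then have "a \<in> Aut I" "a u \<in> mults ?H" using determined_iff[OF g] by auto
    then show "z \<in> {(m, m \<odot> g) | m g. m \<in> I \<and> g \<in> mults ?H}" using a Aut_mult(2) by blast
  next
    fix z assume "z \<in> {(m, m \<odot> g) | m g. m \<in> I \<and> g \<in> mults ?H}"
    then obtain m h where "z = (m, m \<odot> h)" "m \<in> I" "(\<lambda>m. m \<odot> h) \<in> ?H" by (auto simp: mults_def)
    then show "z \<in> (\<Union>a\<in>?H. Gamma I a)" unfolding Gamma_def by blast
  qed
  moreover have "mults ?H \<subseteq> G" by (auto simp: mults_def)
  ultimately show ?thesis unfolding Minf_def by (simp add: N_eq_closure)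
qed


section \<open>The closure of the graphs of a group without separated points\<close>

context
  fixes X :: "'x topology" and actX :: "'t \<Rightarrow> 'x \<Rightarrow> 'x" and piX :: "'t set set \<Rightarrow> 'x" and V :: "'t set set set"
  assumes X: "dynamic X actX"
    and piX: "extension J bact X actX piX"
    and V: "subgrp V" "V \<subseteq> derv V"
begin

abbreviation "XX \<equiv> prod_topology X X"
abbreviation "pp \<equiv> \<lambda>(m, n). (piX m, piX n)"
abbreviation "M \<equiv> pp ` N V"

lemma VG: "V \<subseteq> G" using V(1) by (simp add: subgrp_def)

lemma continuous_pp: "continuous_map JJ XX pp"
  using piX by (simp add: continuous_map_prod_top extension_def)

lemma piX_in: "m \<in> I \<Longrightarrow> piX m \<in> topspace X"
  using piX by (auto simp: extension_def)

lemma M_topspace: "M \<subseteq> topspace XX"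
  using piX_in by (auto simp: N_def)

lemma diag_act_pp: "m \<in> I \<Longrightarrow> n \<in> I \<Longrightarrow> diag_act actX t (pp (m, n)) = pp (bact t m, bact t n)"
  using piX by (simp add: extension_def diag_act_def)

lemma M_invariant: "z \<in> M \<Longrightarrow> diag_act actX t z \<in> M"
proof -
  assume "z \<in> M"
  then obtain m n where mn: "(m, n) \<in> N V" "z = pp (m, n)" by auto
  then have "diag_act actX t z = pp (bact t m, bact t n)" using diag_act_pp by (auto simp: N_def)
  then show ?thesis using N_act[OF VG mn(1)] by blast
qed

lemma M_open_preimage:
  assumes "openin XX W" shows "openin JJ {w \<in> topspace JJ. pp w \<in> W}"
  by (rule openin_continuous_map_preimage[OF continuous_pp assms])

lemma M_transitive:
  assumes U: "openin XX U" "U \<inter> M \<noteq> {}" and W: "openin XX W" "W \<inter> M \<noteq> {}"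
  obtains t z where "z \<in> U \<inter> M" "diag_act actX t z \<in> W \<inter> M"
proof -
  let ?O = "\<lambda>W. {w \<in> topspace JJ. pp w \<in> W}"
  have hit: "\<exists>k\<in>V. hits (?O W) k" if W: "openin XX W" "W \<inter> M \<noteq> {}" for W
  proof -
    obtain m n where mn: "(m, n) \<in> N V" "pp (m, n) \<in> W" using W(2) by auto
    then have "(m, n) \<in> ?O W" by (auto simp: N_def)
    then show ?thesis using mn(1) M_open_preimage[OF W(1)] unfolding N_iff[OF VG] by blast
  qed
  obtain k where k: "k \<in> V" "hits (?O U) k" using hit[OF U] by blast
  obtain l where l: "l \<in> V" "hits (?O W) l" using hit[OF W] by blast
  have uV: "u \<in> V" using subgrpD[OF V(1)] by blast
  \<comment> \<open>Every element of \<open>V\<close> is inseparable from \<open>u\<close>, so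
    transitivity makes any two elements inseparable from each other.\<close>
  have "nonsep V k u" "nonsep V u l" using k l V(2) nonsep_sym by (auto simp: derv_def)
  then have kl: "nonsep V k l" using nonsep_trans[OF V(1)] k(1) l(1) uV by blast
  obtain g where g: "g \<in> V" "hits (?O U) g" "hits (?O W) g"
    using nonsepD[OF kl M_open_preimage[OF U(1)] M_open_preimage[OF W(1)] k(2) l(2)] by blast
  have gG: "g \<in> G" using g VG by auto
  obtain x where x: "x \<in> I" "(x, x \<odot> g) \<in> ?O U" using g(2) by (auto simp: hits_def)
  obtain t where t: "(bact t x, bact t x \<odot> g) \<in> ?O W"
    by (rule graph_orbit[OF M_open_preimage[OF W(1)] g(3) G_I[OF gG] x(1)])
  have xN: "(x, x \<odot> g) \<in> N V" by (rule N_graph[OF VG x(1) g(1)])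
  have "diag_act actX t (pp (x, x \<odot> g)) = pp (bact t x, bact t x \<odot> g)"
    using diag_act_pp x(1) gG by (simp add: bact_bmult I_mult' G_I)
  then have "diag_act actX t (pp (x, x \<odot> g)) \<in> W" using t by simp
  moreover have xM: "pp (x, x \<odot> g) \<in> M" using xN by (rule imageI)
  moreover have "pp (x, x \<odot> g) \<in> U" using x(2) by simp
  ultimately show thesis using that[of "pp (x, x \<odot> g)" t] M_invariant[OF xM] by blast
qed

text \<open>Almost periodic points come from single graphs: \<open>n \<mapsto> pp (n, n g)\<close>
  maps the minimal system \<open>I\<close> equivariantly into \<open>M\<close>, and these images are
  dense because \<open>N V\<close> is the closure of the graphs.\<close>

lemma M_dynamic_M: "M_dynamic (subtopology XX M) (diag_act actX)"
  unfolding M_dynamic_def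
proof (intro conjI)
  have top: "topspace (subtopology XX M) = M" using M_topspace by auto
  have act: "continuous_map X X (actX t)" for t using X by (simp add: dynamic_def)
  show "dynamic (subtopology XX M) (diag_act actX)"
    unfolding dynamic_def top
  proof (intro conjI allI ballI)
    show "continuous_map (subtopology XX M) (subtopology XX M) (diag_act actX t)" for t
    proof -
      have "continuous_map XX XX (\<lambda>(x, y). (actX t x, actX t y))"
        using act by (simp add: continuous_map_prod_top)
      moreover have "(\<lambda>(x, y). (actX t x, actX t y)) = diag_act actX t" by (auto simp: diag_act_def)
      ultimately show ?thesis
        unfolding continuous_map_in_subtopology top using M_invariant by (auto intro: continuous_map_from_subtopology)
    qed
    fix z assume "z \<in> M"
    then have z: "fst z \<in> topspace X" "snd z \<in> topspace X" using M_topspace by auto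
    show "diag_act actX 1 z = z" using X z by (simp add: dynamic_def diag_act_def)
    show "diag_act actX (s * t) z = diag_act actX s (diag_act actX t z)" for s t
      using X z by (simp add: dynamic_def diag_act_def)
  qed
  show "TT (subtopology XX M) (diag_act actX)"
    unfolding TT_def
  proof (intro allI impI)
    fix U W assume UW: "openin (subtopology XX M) U \<and> U \<noteq> {} \<and> openin (subtopology XX M) W \<and> W \<noteq> {}"
    then obtain U' W' where U': "openin XX U'" "U = U' \<inter> M" "openin XX W'" "W = W' \<inter> M"
      by (auto simp: openin_subtopology)
    then obtain t z where "z \<in> U' \<inter> M" "diag_act actX t z \<in> W' \<inter> M"
      using M_transitive[of U' W'] UW by metis
    then show "{t. W \<inter> diag_act actX t ` U \<noteq> {}} \<noteq> {}" using U' by blast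
  qed
  have ap: "ap_point (subtopology XX M) (diag_act actX) (pp (m, m \<odot> g))" if m: "m \<in> I" and g: "g \<in> V" for m g
    unfolding ap_point_def
  proof (intro conjI allI impI)
    have gG: "g \<in> G" using g VG by auto
    have gr: "pp (n, n \<odot> g) \<in> M" if "n \<in> I" for n using N_graph[OF VG that g] by blast
    show "pp (m, m \<odot> g) \<in> topspace (subtopology XX M)" unfolding top by (rule gr[OF m])
    fix U assume U: "openin (subtopology XX M) U \<and> pp (m, m \<odot> g) \<in> U"
    then obtain U' where U': "openin XX U'" "U = U' \<inter> M" by (auto simp: openin_subtopology)
    let ?O = "{n \<in> topspace J. pp (n, n \<odot> g) \<in> U'}"
    have "continuous_map J JJ (\<lambda>n. (n, n \<odot> g))"
      using continuous_rmult_J[OF G_I[OF gG]] by (simp add: continuous_map_paired)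
    then have "continuous_map J XX (\<lambda>n. pp (n, n \<odot> g))"
      using continuous_map_compose[OF _ continuous_pp, of J "\<lambda>n. (n, n \<odot> g)"] by (simp add: o_def)
    then have O: "openin J ?O" by (rule openin_continuous_map_preimage[OF _ U'(1)])
    have mO: "m \<in> ?O" using U U' m by simp
    \<comment> \<open>Syndeticity by compactness: the preimages of \<open>?O\<close> under the
      action cover \<open>I\<close>, and a finite subcover supplies the finite set
      \<open>K\<close>.\<close>
    define \<U> where "\<U> = (\<lambda>k. {n \<in> topspace J. bact k n \<in> ?O}) ` UNIV"
    have "topspace J \<subseteq> \<Union>\<U>"
    proof
      fix n assume n: "n \<in> topspace J"
      \<comment> \<open>The graph of \<open>u\<close> is the diagonal, so \<open>graph_orbit\<close>
        for it says that every orbit in \<open>I\<close> is dense.\<close>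
      have "hits (I \<times> ?O) u" using mO m mult_u by (auto intro!: hitsI[of m])
      moreover have "openin JJ (I \<times> ?O)" using O openin_topspace[of J] by (simp add: openin_prod_Times_iff)
      ultimately obtain t where "(bact t n, bact t n \<odot> u) \<in> I \<times> ?O"
        using graph_orbit[of "I \<times> ?O" u n] n uI by auto
      then have "bact t n \<in> ?O" using mult_u I_act n by simp
      then show "n \<in> \<Union>\<U>" using n unfolding \<U>_def by blast
    qed
    moreover have "openin J W" if "W \<in> \<U>" for W
      using that openin_continuous_map_preimage[OF continuous_act_J O] unfolding \<U>_def by blast
    ultimately obtain \<F> where F: "finite \<F>" "\<F> \<subseteq> \<U>" "topspace J \<subseteq> \<Union>\<F>"
      using compact_J unfolding compact_space_def compactin_def by metis
    obtain K where K: "finite K" "\<F> = (\<lambda>k. {n \<in> topspace J. bact k n \<in> ?O}) ` K"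
      using finite_subset_image[OF F(1,2)[unfolded \<U>_def]] by blast
    have "(\<lambda>k. k * t) ` K \<inter> {t. diag_act actX t (pp (m, m \<odot> g)) \<in> U} \<noteq> {}" for t
    proof -
      have tm: "bact t m \<in> I" using m I_act by blast
      then obtain k where k: "k \<in> K" "bact k (bact t m) \<in> ?O" using F(3) K(2) by auto
      have "diag_act actX (k * t) (pp (m, m \<odot> g)) = pp (bact (k * t) m, bact (k * t) m \<odot> g)"
        using diag_act_pp m gG by (simp add: bact_bmult I_mult' G_I)
      moreover have "pp (bact (k * t) m, bact (k * t) m \<odot> g) \<in> U' \<inter> M"
        using k(2) gr[of "bact (k * t) m"] m I_act by (simp add: bact_mult)
      ultimately have "diag_act actX (k * t) (pp (m, m \<odot> g)) \<in> U" using U'(2) by simp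
      then show ?thesis using k(1) by blast
    qed
    then show "syndetic {t. diag_act actX t (pp (m, m \<odot> g)) \<in> U}" unfolding syndetic_def using K(1) by blast
  qed
  let ?A = "{z. ap_point (subtopology XX M) (diag_act actX) z}"
  have "M \<subseteq> XX closure_of ?A"
  proof -
    have "M = pp ` (JJ closure_of {(m, m \<odot> g) | m g. m \<in> I \<and> g \<in> V})" by (simp add: N_eq_closure[OF VG])
    also have "\<dots> \<subseteq> XX closure_of (pp ` {(m, m \<odot> g) | m g. m \<in> I \<and> g \<in> V})"
      by (rule continuous_map_image_closure_subset[OF continuous_pp])
    also have "\<dots> \<subseteq> XX closure_of ?A" by (rule closure_of_mono) (use ap in auto)
    finally show ?thesis .
  qed
  moreover have "?A \<subseteq> M" using top by (auto simp: ap_point_def)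
  then have "M \<inter> ?A = ?A" by blast
  ultimately show "subtopology XX M closure_of ?A = topspace (subtopology XX M)"
    unfolding closure_of_subtopology top by auto
qed

lemma Delta_subset_M: "Delta X \<subseteq> M"
proof
  fix z assume "z \<in> Delta X"
  then obtain x where x: "z = (x, x)" "x \<in> topspace X" by (auto simp: Delta_def)
  have "x \<in> piX ` I" using piX x(2) by (simp add: extension_def)
  then obtain m where "m \<in> I" "z = pp (m, m)" using x(1) by auto
  then show "z \<in> M" using icer_refl[OF icer_N[OF V(1)]] by blast
qed

text \<open>Transitivity moves points of \<open>M\<close> near an arbitrary \<open>z\<close> to
  points near a fixed diagonal point; the filter is generated by these requirements for all pairs of
  neighbourhoods.\<close>

lemma RP_M: "RP X actX M = M"
proof (intro equalityI subsetI)
  fix z assume z: "z \<in> M"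
  define y where "y = pp (u, u)"
  have y: "y \<in> Delta X" "y \<in> M" using uI piX_in Delta_subset_M by (auto simp: y_def Delta_def)
  have yT: "y \<in> topspace XX" "z \<in> topspace XX" using y z M_topspace by auto
  define B where "B = {(U, W). openin XX U \<and> openin XX W \<and> z \<in> U \<and> y \<in> W}"
  define P where "P = (\<lambda>(U, W). {(t, w). w \<in> U \<inter> M \<and> diag_act actX t w \<in> W})"
  define F where "F = (INF x\<in>B. principal (P x))"
  have "F \<noteq> bot"
    unfolding F_def
  proof (rule INF_filter_not_bot)
    fix S assume S: "S \<subseteq> B" "finite S"
    define U where "U = (\<Inter>x\<in>S. fst x) \<inter> topspace XX"
    define W where "W = (\<Inter>x\<in>S. snd x) \<inter> topspace XX"
    have "openin XX U" "openin XX W"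
      unfolding U_def W_def by (rule openin_INT[OF S(2)]; use S(1) in \<open>auto simp: B_def\<close>)+
    moreover have "z \<in> U" "y \<in> W" using S(1) yT by (auto simp: U_def W_def B_def)
    moreover have "U \<inter> M \<noteq> {}" "W \<inter> M \<noteq> {}" using calculation(3,4) z y(2) by auto
    ultimately obtain t w where tw: "w \<in> U \<inter> M" "diag_act actX t w \<in> W \<inter> M"
      using M_transitive[of U W] by metis
    have "(t, w) \<in> P x" if "x \<in> S" for x
      using tw that by (cases x) (force simp: P_def U_def W_def)
    then have "(\<Inter>x\<in>S. P x) \<noteq> {}" by blast
    then show "(INF x\<in>S. principal (P x)) \<noteq> bot" using S(2) by (simp add: INF_principal_finite principal_eq_bot_iff)
  qed
  have ev: "eventually (\<lambda>j. j \<in> P x) F" if "x \<in> B" for x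
    unfolding F_def by (rule eventually_INF1[OF that]) (simp add: eventually_principal)
  have oXX: "openin XX (topspace X \<times> topspace X)" using openin_topspace[of XX] by simp
  have "eventually (\<lambda>j. snd j \<in> M) F"
    by (rule eventually_mono[OF ev[of "(topspace XX, topspace XX)"]]) (use yT oXX in \<open>auto simp: B_def P_def\<close>)
  moreover have "limitin XX snd z F"
    unfolding limitin_def
  proof (intro conjI allI impI yT)
    fix U assume "openin XX U \<and> z \<in> U"
    then have "(U, topspace XX) \<in> B" using yT oXX by (auto simp: B_def)
    from ev[OF this] show "eventually (\<lambda>j. snd j \<in> U) F" by (rule eventually_mono) (auto simp: P_def)
  qed
  moreover have "limitin XX (\<lambda>j. diag_act actX (fst j) (snd j)) y F"
    unfolding limitin_def
  proof (intro conjI allI impI yT)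
    fix W assume "openin XX W \<and> y \<in> W"
    then have "(topspace XX, W) \<in> B" using yT oXX by (auto simp: B_def)
    from ev[OF this] show "eventually (\<lambda>j. diag_act actX (fst j) (snd j) \<in> W) F"
      by (rule eventually_mono) (auto simp: P_def)
  qed
  ultimately show "z \<in> RP X actX M" using \<open>F \<noteq> bot\<close> z y(1) unfolding RP_def by blast
qed (simp add: RP_def)

end
end

theorem theorem3p5:
  fixes X :: "'x topology" and actX :: "'t::monoid_mult \<Rightarrow> 'x \<Rightarrow> 'x"
    and Y :: "'y topology" and actY :: "'t \<Rightarrow> 'y \<Rightarrow> 'y"
    and f :: "'x \<Rightarrow> 'y"
    and II :: "'t set set set" and piX :: "'t set set \<Rightarrow> 'x"
  assumes "minimal_compact_dynamic X actX"
    and "minimal_compact_dynamic Y actY"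
    and "extension X actX Y actY f"
    and "\<not> is_PI X actX Y actY f"
    and "minimal_left_ideal II"
    and "extension (Itop II) bact X actX piX"
  shows "M_dynamic (subtopology (prod_topology X X) (Minf X f II piX)) (diag_act actX)
       \<and> Minf X f II piX \<subseteq> Rel X f
       \<and> Delta X \<subset> Minf X f II piX
       \<and> RP X actX (Minf X f II piX) = Minf X f II piX"
proof -
  obtain u where u: "u \<in> II" "bmult u u = u" using exists_idempotent[OF assms(5)] by blast
  interpret ellis_group II u by unfold_locales (use assms(5) u in auto)
  have X: "dynamic X actX" "Hausdorff_space X" and Y: "Hausdorff_space Y"
    using assms(1,2) by (auto simp: minimal_compact_dynamic_def compact_dynamic_def)
  let ?\<phi> = "f \<circ> piX"
  have i\<phi>: "icer (ker ?\<phi>)" by (rule icer_ker[OF extension_compose[OF assms(6,3)] Y])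
  let ?F = "Fgrp II ?\<phi>"
  have F: "determined ?F" "mults ?F = grp (ker ?\<phi>)" using determined_Fgrp[OF i\<phi>] .
  define V where "V = mults (Finf II ?F)"
  have V: "subgrp V" "V \<subseteq> derv V" "V \<subseteq> grp (ker ?\<phi>)"
    using mults_Finf[OF F(1)] F(2) by (auto simp: V_def determined_def)
  have V_largest: "L \<subseteq> V" if "L \<subseteq> grp (ker ?\<phi>)" "derv L = L" for L
    using mults_Finf(4)[OF F(1)] F(2) that by (simp add: V_def)
  have M: "Minf X f II piX = (\<lambda>(m, n). (piX m, piX n)) ` N V"
    unfolding V_def by (rule Minf_eq[OF F(1)])
  have "N V \<subseteq> ker ?\<phi>" using N_mono[OF V(3)] N_grp_subset[OF i\<phi>] by blast
  then have "Minf X f II piX \<subseteq> Rel X f"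
    unfolding M using piX_in[OF X(1) assms(6) V(1,2)] by (auto simp: Rel_def ker_def)
  moreover have "Delta X \<noteq> Minf X f II piX"
  proof
    assume eq: "Delta X = Minf X f II piX"
    \<comment> \<open>If the image were the diagonal, \<open>piX\<close> would collapse the graphs
      of \<open>V\<close>; so \<open>V\<close>, and with it every set fixed by \<open>derv\<close>
      inside the group of \<open>Y\<close>, would lie in the group of \<open>X\<close>.\<close>
    have "L \<subseteq> grp (ker piX)" if L: "L \<subseteq> grp (ker ?\<phi>)" "derv L = L" for L
    proof
      fix g assume "g \<in> L"
      then have g: "g \<in> V" using V_largest[OF L] by blast
      have gG: "g \<in> G" using g subgrpD[OF V(1)] by blast
      have "(u, u \<odot> g) \<in> N V" using N_graph[OF _ u(1) g] V(1) by (simp add: subgrp_def)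
      then have "(piX u, piX (u \<odot> g)) \<in> Delta X"
        unfolding eq M using imageI[of "(u, u \<odot> g)" "N V" "\<lambda>(m, n). (piX m, piX n)"] by simp
      then show "g \<in> grp (ker piX)" using gG u(1) G_I u_mult by (auto simp: grp_def ker_def Delta_def)
    qed
    then have "is_PI X actX Y actY f" by (intro is_PI_of_stable_subset[OF X(2) Y assms(3,6)])
    then show False using assms(4) by blast
  qed
  ultimately show ?thesis
    using M_dynamic_M[OF X(1) assms(6) V(1,2)] Delta_subset_M[OF X(1) assms(6) V(1,2)]
      RP_M[OF X(1) assms(6) V(1,2)] unfolding M by blast
qed

end
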